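(* Let $\mathcal{F}_5$, $G$, $\mathcal{F}_6$, $M$, $\perp$ and the set $\mathcal{F}_{15}$ of fifteen lines of $\mathsf{PG}(5,3)$ be as defined in the context, where $\perp$ is the symplectic polarity for which the $21$ lines $\mathcal{F}_6\cup\mathcal{F}_{15}$ form a perp-system. Let $\mathcal{F}_{10}$ be the set of all lines of the form $\langle \ell,m\rangle^\perp$ where $\ell,m$ are different elements of $\mathcal{F}_5$. Define the following incidence structure: the points are the elements of $\mathcal{F}_{15}$; the lines of type (i) are the elements of $\mathcal{F}_5$; the lines of type (ii) are the elements of $\mathcal{F}_{10}$; a line $\ell$ of type (i) is incident with a point $P$ if and only if $P\cap\ell^\perp=\varnothing$; a line $\ell$ of type (ii) is incident with a point $P$ if and only if $P\subseteq\ell^\perp$. Then this incidence structure is isomorphic to the generalised quadrangle $\mathsf{W}(2)$.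
   Context: $I$ and $O$ are the $2\times2$ identity and zero matrices over $\mathrm{GF}(3)$, and $X=\begin{pmatrix} 0 & 1 \\ 2 & 0 \end{pmatrix}$ over $\mathrm{GF}(3)$. A line of $\mathsf{PG}(5,3)$ is represented by a $2\times 6$ matrix of rank $2$ over $\mathrm{GF}(3)$, written as three $2\times 2$ blocks; the line is the row space of the matrix. Matrices of $\mathsf{GL}(6,3)$ act on row vectors by right multiplication. A Gram matrix $M$ defines the form $(u,v)\mapsto uMv^T$. Let $\mathcal{F}_4=\{(I\ O\ O),(O\ I\ O),(O\ O\ I),(I\ I\ I)\}$, and let $\perp_0$ be the symplectic polarity with Gram matrix $M_0=\begin{pmatrix} O & X & X \\ X & O & X \\ X & X & O \end{pmatrix}$. Let $\mathcal{L}$ be the set of lines that are totally isotropic with respect to $M_0$, are disjoint from the span of every pair of distinct elements of $\mathcal{F}_4$, and for each $\ell\in\mathcal{F}_4$ meet $\ell^{\perp_0}$ in exactly one point. Every line of $\mathcal{L}$ can be written as $(I\ R\ S)$ with $R,S\in\mathsf{GL}(2,3)$. Fix any $(I\ R\ S)\in\mathcal{L}$ and put $\mathcal{F}_5=\mathcal{F}_4\cup\{(I\ R\ S)\}$. Let $G$ be the setwise stabiliser of $\mathcal{F}_5$ in $\mathsf{PGL}(6,3)$ (it is isomorphic to $S_5$), and let $\mathcal{F}_6$ be the set of lines of $\mathsf{PG}(5,3)$ fixed (setwise) by some element of order $5$ of $G$; it consists of six lines. Let $M$ be a nonsingular matrix of the form $\begin{pmatrix} O & A & B \\ -A^T & O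 & C \\ -B^T & -C^T & O \end{pmatrix}$ over $\mathrm{GF}(3)$, where $A,B,C$ are $2\times2$ matrices such that $A+B+C$ and $AR^T+BS^T+RCS^T$ are symmetric, whose form is stabilised up to scalars by $G$ (i.e. $gMg^T=\pm M$ for every $g\in\mathsf{GL}(6,3)$ inducing an element of $G$); let $\perp$ be the corresponding symplectic polarity. Two not necessarily distinct lines $\ell,m$ are opposite if $\ell\cap m^\perp=\varnothing$ (as sets of projective points). For each of the fifteen solids $\alpha$ spanned by two distinct elements of $\mathcal{F}_6$, there is a unique line $\ell_\alpha\subset\alpha$ which is opposite to all elements of $\mathcal{F}_6$ and disjoint from every other solid spanned by two distinct elements of $\mathcal{F}_6$; $\mathcal{F}_{15}$ is the set of these fifteen lines $\ell_\alpha$. The set $\mathcal{F}_6\cup\mathcal{F}_{15}$ is Mathon's perp-system, where a perp-system of lines of $\mathsf{PG}(5,3)$ with respect to a polarity is a set of $21$ mutually disjoint lines such that every two not necessarily distinct elements are opposite. $\mathsf{W}(2)$ is the (unique) generalised quadrangle of order $2$: its points are the nonzero vectors of $\mathrm{GF}(2)^4$, its lines are the two-dimensional subspaces that are totally isotropic for the symplectic form $x_1y_4+x_4y_1+x_2y_3+x_3y_2$, and incidence is containment. *)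

theory Defs
  imports "HOL-Analysis.Analysis" "HOL-Algebra.Multiplicative_Group"
begin

(* Subspaces of PG(5,3) are modelled as vector subspaces (sets of row vectors) of GF(3)^6;
   a projective point is a 1-dimensional subspace. *)

type_synonym gf2 = Enum.finite_2
type_synonym gf3 = Enum.finite_3
type_synonym mat2 = "gf3 ^ 2 ^ 2"
type_synonym vec6 = "gf3 ^ 6"
type_synonym mat6 = "gf3 ^ 6 ^ 6"

definition subspaces_of_dim :: "nat \<Rightarrow> ('k::field ^ 'n) set set" where
  "subspaces_of_dim d = {U. vec.subspace U \<and> vec.dim U = d}"

definition pg_lines :: "vec6 set set" where
  "pg_lines = subspaces_of_dim 2"

definition points_of :: "vec6 set \<Rightarrow> vec6 set set" where
  "points_of U = {P \<in> subspaces_of_dim 1. P \<subseteq> U}"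

definition pg_disjoint :: "vec6 set \<Rightarrow> vec6 set \<Rightarrow> bool" where
  "pg_disjoint U V \<longleftrightarrow> points_of U \<inter> points_of V = {}"

definition join :: "vec6 set \<Rightarrow> vec6 set \<Rightarrow> vec6 set" where
  "join U V = vec.span (U \<union> V)"

definition joins :: "vec6 set set \<Rightarrow> vec6 set set" where
  "joins F = {join l m | l m. l \<in> F \<and> m \<in> F \<and> l \<noteq> m}"


definition form :: "'k::field ^ 'n ^ 'n \<Rightarrow> 'k ^ 'n \<Rightarrow> 'k ^ 'n \<Rightarrow> 'k" where
  "form M u v = (\<Sum>j\<in>UNIV. (u v* M) $ j * v $ j)"

(* The Gram matrices used below are skew-symmetric, so left and right perp coincide. *)
definition perp :: "mat6 \<Rightarrow> vec6 set \<Rightarrow> vec6 set" where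
  "perp M U = {v. \<forall>u\<in>U. form M u v = 0}"

definition totally_isotropic :: "'k::field ^ 'n ^ 'n \<Rightarrow> ('k ^ 'n) set \<Rightarrow> bool" where
  "totally_isotropic M U \<longleftrightarrow> (\<forall>u\<in>U. \<forall>v\<in>U. form M u v = 0)"

definition opposite :: "mat6 \<Rightarrow> vec6 set \<Rightarrow> vec6 set \<Rightarrow> bool" where
  "opposite M l m \<longleftrightarrow> pg_disjoint l (perp M m)"


definition block_row :: "mat2 \<Rightarrow> mat2 \<Rightarrow> mat2 \<Rightarrow> 2 \<Rightarrow> vec6" where
  "block_row A B C i = vector [A$i$1, A$i$2, B$i$1, B$i$2, C$i$1, C$i$2]"

(* The row space of the 2 x 6 matrix (A B C). *)
definition block_line :: "mat2 \<Rightarrow> mat2 \<Rightarrow> mat2 \<Rightarrow> vec6 set" where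
  "block_line A B C = vec.span (rows (\<chi> i. block_row A B C i))"

definition block_mat ::
  "mat2 \<Rightarrow> mat2 \<Rightarrow> mat2 \<Rightarrow> mat2 \<Rightarrow> mat2 \<Rightarrow> mat2 \<Rightarrow> mat2 \<Rightarrow> mat2 \<Rightarrow> mat2 \<Rightarrow> mat6" where
  "block_mat A\<^sub>1\<^sub>1 A\<^sub>1\<^sub>2 A\<^sub>1\<^sub>3 A\<^sub>2\<^sub>1 A\<^sub>2\<^sub>2 A\<^sub>2\<^sub>3 A\<^sub>3\<^sub>1 A\<^sub>3\<^sub>2 A\<^sub>3\<^sub>3 =
     vector [block_row A\<^sub>1\<^sub>1 A\<^sub>1\<^sub>2 A\<^sub>1\<^sub>3 1, block_row A\<^sub>1\<^sub>1 A\<^sub>1\<^sub>2 A\<^sub>1\<^sub>3 2,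
             block_row A\<^sub>2\<^sub>1 A\<^sub>2\<^sub>2 A\<^sub>2\<^sub>3 1, block_row A\<^sub>2\<^sub>1 A\<^sub>2\<^sub>2 A\<^sub>2\<^sub>3 2,
             block_row A\<^sub>3\<^sub>1 A\<^sub>3\<^sub>2 A\<^sub>3\<^sub>3 1, block_row A\<^sub>3\<^sub>1 A\<^sub>3\<^sub>2 A\<^sub>3\<^sub>3 2]"

definition X :: mat2 where
  "X = vector [vector [0, 1], vector [2, 0]]"

definition M\<^sub>0 :: mat6 where
  "M\<^sub>0 = block_mat 0 X X
                  X 0 X
                  X X 0"

definition F4 :: "vec6 set set" where
  "F4 = {block_line (mat 1) 0 0, block_line 0 (mat 1) 0, block_line 0 0 (mat 1),
         block_line (mat 1) (mat 1) (mat 1)}"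

definition \<L> :: "vec6 set set" where
  "\<L> = {m \<in> pg_lines. totally_isotropic M\<^sub>0 m \<and>
         (\<forall>k\<in>F4. \<forall>l\<in>F4. k \<noteq> l \<longrightarrow> pg_disjoint m (join k l)) \<and>
         (\<forall>l\<in>F4. \<exists>!P. P \<in> points_of m \<inter> points_of (perp M\<^sub>0 l))}"

definition F5 :: "mat2 \<Rightarrow> mat2 \<Rightarrow> vec6 set set" where
  "F5 R S = F4 \<union> {block_line (mat 1) R S}"


definition GL6 :: "mat6 monoid" where
  "GL6 = \<lparr>carrier = {g. invertible g}, mult = (**), one = mat 1\<rparr>"

(* Elements of PGL(6,3) are cosets, i.e. the sets of all matrices inducing a given projectivity. *)
definition PGL6 :: "mat6 set monoid" where
  "PGL6 = GL6 Mod {mat c | c. c \<noteq> 0}"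

definition act :: "mat6 \<Rightarrow> vec6 set \<Rightarrow> vec6 set" where
  "act g U = (\<lambda>v. v v* g) ` U"

definition stabiliser :: "vec6 set set \<Rightarrow> mat6 set set" where
  "stabiliser F = {\<gamma> \<in> carrier PGL6. \<forall>g\<in>\<gamma>. act g ` F = F}"

definition F6 :: "mat6 set set \<Rightarrow> vec6 set set" where
  "F6 G = {l \<in> pg_lines. \<exists>\<gamma>\<in>G. group.ord PGL6 \<gamma> = 5 \<and> (\<forall>g\<in>\<gamma>. act g l = l)}"

(* All lines l_\<alpha>, for \<alpha> a solid spanned by two elements of F; that each \<alpha> contains exactly one
   such line is not built in. *)
definition F15 :: "mat6 \<Rightarrow> vec6 set set \<Rightarrow> vec6 set set" where
  "F15 M F = {l \<in> pg_lines. \<exists>\<alpha>\<in>joins F. l \<subseteq> \<alpha> \<and> (\<forall>m\<in>F. opposite M l m) \<and>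
                (\<forall>\<beta>\<in>joins F. \<beta> \<noteq> \<alpha> \<longrightarrow> pg_disjoint l \<beta>)}"

definition F10 :: "mat6 \<Rightarrow> vec6 set set \<Rightarrow> vec6 set set" where
  "F10 M F = perp M ` joins F"


record ('p, 'l) incidence_structure =
  Points :: "'p set"
  Lines :: "'l set"
  Inc :: "'p \<Rightarrow> 'l \<Rightarrow> bool"

definition isomorphic ::
  "('p, 'l) incidence_structure \<Rightarrow> ('q, 'm) incidence_structure \<Rightarrow> bool" where
  "isomorphic A B \<longleftrightarrow> (\<exists>f g. bij_betw f (Points A) (Points B) \<and> bij_betw g (Lines A) (Lines B) \<and>
     (\<forall>p\<in>Points A. \<forall>l\<in>Lines A. Inc A p l \<longleftrightarrow> Inc B (f p) (g l)))"

(* Inl l is a line of type (i), Inr l a line of type (ii). *)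
definition mathon_structure ::
  "mat6 \<Rightarrow> vec6 set set \<Rightarrow> vec6 set set \<Rightarrow> vec6 set set
    \<Rightarrow> (vec6 set, vec6 set + vec6 set) incidence_structure" where
  "mathon_structure M \<F>\<^sub>1\<^sub>5 \<F>\<^sub>5 \<F>\<^sub>1\<^sub>0 =
     \<lparr>Points = \<F>\<^sub>1\<^sub>5,
      Lines = Inl ` \<F>\<^sub>5 \<union> Inr ` \<F>\<^sub>1\<^sub>0,
      Inc = (\<lambda>P l. case l of Inl l \<Rightarrow> pg_disjoint P (perp M l) | Inr l \<Rightarrow> P \<subseteq> perp M l)\<rparr>"

(* The Gram matrix of x1 y4 + x4 y1 + x2 y3 + x3 y2. *)
definition W2_gram :: "gf2 ^ 4 ^ 4" where
  "W2_gram = vector [vector [0, 0, 0, 1],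
                     vector [0, 0, 1, 0],
                     vector [0, 1, 0, 0],
                     vector [1, 0, 0, 0]]"

definition W2 :: "(gf2 ^ 4, (gf2 ^ 4) set) incidence_structure" where
  "W2 = \<lparr>Points = {v. v \<noteq> 0},
         Lines = {U \<in> subspaces_of_dim 2. totally_isotropic W2_gram U},
         Inc = (\<lambda>v U. v \<in> U)\<rparr>"

end

theory Submission
  imports Defs
begin

text \<open>Write \<open>\<langle>k, l\<rangle>\<close> for the solid spanned by two of the five lines of \<open>\<F>\<^sub>5\<close>. Any three of these lines
span the whole space, so for two disjoint pairs the solids \<open>\<langle>a, b\<rangle>\<close> and \<open>\<langle>c, d\<rangle>\<close> meet in a line. The
fifteen lines obtained this way are the elements of \<open>\<F>\<^sub>1\<^sub>5\<close>; hence a point of the structure is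
a splitting \<open>ab|cd|e\<close> of the five lines. It is disjoint from \<open>l\<^sup>\<perp>\<close> only for \<open>l = e\<close>, and since
\<open>\<langle>k, l\<rangle>\<^sup>\<perp>\<^sup>\<perp> = \<langle>k, l\<rangle>\<close>, it is incident with a line \<open>\<langle>k, l\<rangle>\<^sup>\<perp>\<close> of type (ii) exactly when the pair \<open>kl\<close> is
\<open>ab\<close> or \<open>cd\<close>. Reading \<open>e\<close> as the pair \<open>{e, \<infinity>}\<close>, points are the partitions of a six-element set into
pairs and lines are the pairs of that set, which is the classical model of \<open>W(2)\<close>.

The work lies in determining \<open>\<F>\<^sub>6\<close>, \<open>\<perp>\<close> and \<open>\<F>\<^sub>1\<^sub>5\<close>. All admissible pairs \<open>(R, S)\<close> are conjugate under
\<open>GL(2,3)\<close> to one fixed pair (\<open>F5_conjugate\<close>), and every notion involved is transported by a change of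
coordinates (\<open>F6_stabiliser_act\<close>, \<open>F15_act\<close>, \<open>F10_act\<close>, \<open>mathon_structure_act\<close>), so a single
configuration has to be treated.

There, a matrix that fixes each of the five lines is a scalar (\<open>scalar_of_fixes_five_lines\<close>).
Therefore a projectivity of order 5 in the stabiliser permutes the five lines in a 5-cycle and is
determined by that cycle. Each of the six subgroups of order 5 of the symmetric group contains
exactly one cycle that maps the first line to the second, and these six cycles are induced by six
explicit matrices \<open>g\<close> with \<open>g\<^sup>5 = 1\<close>. As \<open>GL(2,3)\<close> has no element of order 5, such a \<open>g\<close> fixes every
vector of an invariant line, so its fixed space is its only invariant line. This gives the six lines
of \<open>\<F>\<^sub>6\<close> (\<open>F6_reference\<close>).

Two of these six matrices leave only one alternating form of the required shape invariant, up to a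
scalar (\<open>invariant_form_unique\<close>), and scaling a form does not change its polarity. Both conditions
that define \<open>\<F>\<^sub>1\<^sub>5\<close> are conditions on the nonzero vectors of a line: they must avoid the other
solids and the six subspaces \<open>m\<^sup>\<perp>\<close>. In every solid just eight vectors survive, and together with zero
they form one line (\<open>F15_reference\<close>). The incidences of these fifteen lines are then
compared with those of \<open>W(2)\<close> (\<open>reference_structure_isomorphic_W2\<close>).

The finite checks are made by rewriting on tuples over \<open>GF(3)\<close>. In them an implication is first turned
into a disjunction, which is evaluated from the left, so that its conclusion is only examined where
its premise holds.\<close>

section \<open>Subspaces, forms and the action of matrices\<close>

text \<open>The constants \<open>0\<close> and \<open>1\<close> of the finite fields, and not the constructors that they stand for, are kept
as normal forms, so that the simplification rules for rings apply.\<close>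

declare Enum.zero_finite_3_def [simp del] Enum.one_finite_3_def [simp del]
declare Enum.zero_finite_2_def [simp del] Enum.one_finite_2_def [simp del]

lemma mem_span_pair:
  fixes u w :: "'k::field ^ 'n"
  shows "v \<in> vec.span {u, w} \<longleftrightarrow> (\<exists>a b. v = a *s u + b *s w)"
  by (auto simp: vec.span_breakdown_eq algebra_simps)

definition independent_pair :: "'k::field ^ 'n \<Rightarrow> 'k ^ 'n \<Rightarrow> bool" where
  "independent_pair u w \<longleftrightarrow> (\<forall>a b. a *s u + b *s w = 0 \<longrightarrow> a = 0 \<and> b = 0)"

lemma span_pair_dim_2:
  fixes u w :: "'k::field ^ 'n"
  assumes "independent_pair u w"
  shows "vec.span {u, w} \<in> subspaces_of_dim 2"
proof -
  have w: "w \<noteq> 0"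
    using assms unfolding independent_pair_def by (metis add.right_neutral vec.scale_zero_left vec.scale_zero_right one_neq_zero)
  have u: "u \<notin> vec.span {w}"
  proof
    assume "u \<in> vec.span {w}"
    then obtain k where "u = k *s w" by (auto simp: vec.span_singleton)
    then have "1 *s u + (- k) *s w = 0" by simp
    then show False using assms unfolding independent_pair_def by (metis one_neq_zero)
  qed
  have "vec.dim {u, w} = 2"
    using u w by (simp add: vec.dim_insert)
  then show ?thesis by (simp add: subspaces_of_dim_def)
qed

text \<open>Bases of lines: an arbitrary line becomes a pair of vectors, on which finite checks are possible.\<close>

lemma dim_2_span_pair:
  fixes U :: "('k::field ^ 'n) set"
  assumes "U \<in> subspaces_of_dim 2"
  obtains u w where "independent_pair u w" "U = vec.span {u, w}"
proof -
  obtain B where B: "B \<subseteq> U" "vec.independent B" "U \<subseteq> vec.span B" "card B = 2"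
    using vec.basis_exists[of U] assms unfolding subspaces_of_dim_def by auto
  have span: "vec.span B = U"
    using B assms vec.span_minimal[of B U] unfolding subspaces_of_dim_def by auto
  obtain u w where uw: "B = {u, w}" "u \<noteq> w" using B(4) by (meson card_2_iff)
  have u: "u \<notin> vec.span {w}" and w: "w \<notin> vec.span {}"
    using B(2) uw by (auto simp: vec.independent_insert split: if_splits)
  have "independent_pair u w" unfolding independent_pair_def
  proof (intro allI impI)
    fix a b assume eq: "a *s u + b *s w = 0"
    have a: "a = 0"
    proof (rule ccontr)
      assume a: "a \<noteq> 0"
      have "u = inverse a *s (a *s u)" using a by simp
      also have "a *s u = (- b) *s w" using eq by (simp add: eq_neg_iff_add_eq_0)
      finally have "u = (inverse a * (- b)) *s w" by simp
      then show False using u unfolding vec.span_singleton by blast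
    qed
    then show "a = 0 \<and> b = 0" using eq w by auto
  qed
  then show ?thesis using that span uw by auto
qed

lemma dim_2_eqI:
  assumes "U \<in> subspaces_of_dim 2" "V \<in> subspaces_of_dim 2" "U \<subseteq> V"
  shows "U = V"
  using assms vec.subspace_dim_equal[of U V] unfolding subspaces_of_dim_def by auto

lemma pg_disjointI:
  assumes "\<And>v. v \<in> U \<Longrightarrow> v \<in> V \<Longrightarrow> v = 0"
  shows "pg_disjoint U V"
proof -
  have False if P: "P \<in> subspaces_of_dim 1" "P \<subseteq> U" "P \<subseteq> V" for P :: "vec6 set"
  proof -
    have "P \<subseteq> {0}" using P assms by auto
    then show False using P vec.dim_eq_0[of P] unfolding subspaces_of_dim_def by simp
  qed
  then show ?thesis unfolding pg_disjoint_def points_of_def by auto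
qed

lemma span_singleton_point:
  fixes v :: vec6
  assumes "v \<noteq> 0"
  shows "vec.span {v} \<in> subspaces_of_dim 1"
  using assms by (simp add: subspaces_of_dim_def)

lemma pg_disjointD:
  assumes "pg_disjoint U V" "vec.subspace U" "vec.subspace V" "v \<in> U" "v \<in> V"
  shows "v = 0"
proof (rule ccontr)
  assume "v \<noteq> 0"
  then have "vec.span {v} \<in> points_of U \<inter> points_of V"
    using assms span_singleton_point vec.span_minimal[of "{v}"] unfolding points_of_def by auto
  then show False using assms unfolding pg_disjoint_def by auto
qed

lemma form_add_left: "form M (u + u') v = form M u v + form M u' v"
  and form_scale_left: "form M (c *s u) v = c * form M u v"
  and form_add_right: "form M u (v + v') = form M u v + form M u v'"
  and form_scale_right: "form M u (c *s v) = c * form M u v"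
  and form_zero_right: "form M u 0 = 0"
  by (simp_all add: form_def vector_matrix_left_distrib scaleR_vector_matrix_assoc
      vector_matrix_mult_def algebra_simps sum.distrib sum_distrib_left sum_distrib_right)

lemma perp_subspace: "vec.subspace (perp M U)"
  unfolding perp_def vec.subspace_def by (simp add: form_add_right form_scale_right form_zero_right)

lemma subspace_join: "vec.subspace (join U V)"
  by (simp add: join_def)

text \<open>Rewriting a form in new coordinates is the congruence \<open>T M T\<^sup>T\<close> of its Gram matrix. All transport of
polarities rests on this identity.\<close>

lemma form_transform: "form M (u v* T) (v v* T) = form (T ** M ** transpose T) u v"
  for M T :: "'k::field ^ 'n ^ 'n"
proof -
  have "form M u (v v* T) = form (M ** transpose T) u v" for u v
  proof -
    have "form M u (v v* T) = (\<Sum>j\<in>UNIV. \<Sum>i\<in>UNIV. (u v* M) $ j * (v $ i * T $ i $ j))"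
      by (simp add: form_def vector_matrix_mult_def sum_distrib_left)
    also have "\<dots> = (\<Sum>i\<in>UNIV. (\<Sum>j\<in>UNIV. (u v* M) $ j * transpose T $ j $ i) * v $ i)"
      by (subst sum.swap) (simp add: sum_distrib_left sum_distrib_right transpose_def mult_ac)
    also have "\<dots> = (\<Sum>i\<in>UNIV. ((u v* M) v* transpose T) $ i * v $ i)"
      by (simp add: vector_matrix_mult_def mult_ac)
    finally show ?thesis by (simp add: form_def vector_matrix_mul_assoc del: vector_transpose_matrix)
  qed
  then have "form M (u v* T) (v v* T) = form (M ** transpose T) (u v* T) v" .
  then show ?thesis by (simp add: form_def vector_matrix_mul_assoc matrix_mul_assoc)
qed

lemma act_mult: "act (g ** h) U = act h (act g U)"
  by (simp add: act_def image_image vector_matrix_mul_assoc)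

lemma act_one [simp]: "act (mat 1) U = U"
  by (simp add: act_def)

lemma matrix_inv:
  assumes "invertible g"
  shows "g ** matrix_inv g = mat 1" "matrix_inv g ** g = mat 1"
  using someI_ex[of "\<lambda>h. g ** h = mat 1 \<and> h ** g = mat 1"] assms
  unfolding invertible_def matrix_inv_def by auto

lemma invertible_matrix_inv: "invertible g \<Longrightarrow> invertible (matrix_inv g)"
  using matrix_inv unfolding invertible_def by blast

lemma matrix_inv_involutive:
  assumes "invertible g" shows "matrix_inv (matrix_inv g) = g"
proof -
  have "matrix_inv (matrix_inv g) = (g ** matrix_inv g) ** matrix_inv (matrix_inv g)"
    using matrix_inv(1)[OF assms] by simp
  also have "\<dots> = g ** (matrix_inv g ** matrix_inv (matrix_inv g))"
    by (simp only: matrix_mul_assoc)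
  also have "\<dots> = g"
    using matrix_inv(1)[OF invertible_matrix_inv[OF assms]] by simp
  finally show ?thesis .
qed

lemma act_inverse:
  assumes "invertible g"
  shows "act (matrix_inv g) (act g U) = U" "act g (act (matrix_inv g) U) = U"
  using matrix_inv[OF assms] by (simp_all flip: act_mult)

lemma act_eq_iff: "invertible g \<Longrightarrow> act g U = act g V \<longleftrightarrow> U = V"
  by (metis act_inverse(1))

lemma inj_vector_matrix_mult:
  fixes g :: "'k::field^'n^'n"
  assumes "invertible g" shows "inj (\<lambda>v. v v* g)"
  by (rule inj_on_inverseI[where g = "\<lambda>v. v v* matrix_inv g"]) (use matrix_inv[OF assms] in \<open>simp add: vector_matrix_mul_assoc\<close>)

lemma mem_act_iff:
  assumes "invertible g"
  shows "v v* g \<in> act g U \<longleftrightarrow> v \<in> U"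
  unfolding act_def using inj_image_mem_iff[OF inj_vector_matrix_mult[OF assms]] .

lemma vec_linear_act: "Vector_Spaces.linear (*s) (*s) (\<lambda>v. v v* g)"
  for g :: "'k::field^'n^'n"
  using matrix_vector_mul_linear_gen[of "transpose g"] unfolding transpose_matrix_vector .

lemma act_span: "act g (vec.span S) = vec.span ((\<lambda>v. v v* g) ` S)"
  unfolding act_def by (rule vec.linear_span_image[OF vec_linear_act, symmetric])

lemma subspace_act: "vec.subspace U \<Longrightarrow> vec.subspace (act g U)"
  unfolding act_def by (rule vec.linear_subspace_image[OF vec_linear_act])

lemma act_subspaces_of_dim:
  assumes "invertible g"
  shows "act g U \<in> subspaces_of_dim d \<longleftrightarrow> U \<in> subspaces_of_dim d"
proof -
  have *: "act g U \<in> subspaces_of_dim d" if "invertible g" "U \<in> subspaces_of_dim d" for g U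
  proof -
    have "vec.dim (act g U) = vec.dim U"
      unfolding act_def
      by (rule vec.dim_image_eq[OF vec_linear_act]) (use inj_vector_matrix_mult[OF that(1)] in \<open>auto intro: inj_on_subset\<close>)
    then show ?thesis using that subspace_act unfolding subspaces_of_dim_def by auto
  qed
  then show ?thesis using invertible_matrix_inv assms act_inverse by metis
qed

lemma points_of_act:
  assumes "invertible g"
  shows "points_of (act g U) = act g ` points_of U"
proof (intro Set.set_eqI iffI)
  fix P assume P: "P \<in> points_of (act g U)"
  define Q where "Q = act (matrix_inv g) P"
  have "P = act g Q" using assms act_inverse Q_def by simp
  moreover have "Q \<subseteq> U"
    using P act_inverse[OF assms] unfolding Q_def points_of_def by (metis (no_types, lifting) act_def image_mono mem_Collect_eq)
  ultimately show "P \<in> act g ` points_of U"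
    using P act_subspaces_of_dim[OF assms] unfolding points_of_def by auto
next
  fix P assume "P \<in> act g ` points_of U"
  then show "P \<in> points_of (act g U)"
    using act_subspaces_of_dim[OF assms] unfolding points_of_def by (auto simp: act_def)
qed

lemma pg_disjoint_act:
  assumes "invertible g"
  shows "pg_disjoint (act g U) (act g V) \<longleftrightarrow> pg_disjoint U V"
proof -
  have "inj (act g)" by (rule injI) (simp add: act_eq_iff[OF assms])
  then show ?thesis unfolding pg_disjoint_def points_of_act[OF assms] by (simp flip: image_Int)
qed

text \<open>The polarity of \<open>M\<close> in the old coordinates is the polarity of the congruent matrix in the new ones.\<close>

lemma perp_act:
  assumes "invertible g"
  shows "perp M (act g U) = act g (perp (g ** M ** transpose g) U)"
proof (intro Set.set_eqI)
  fix v
  have "v = (v v* matrix_inv g) v* g" using matrix_inv[OF assms] by (simp add: vector_matrix_mul_assoc)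
  then obtain w where v: "v = w v* g" by blast
  show "v \<in> perp M (act g U) \<longleftrightarrow> v \<in> act g (perp (g ** M ** transpose g) U)"
    unfolding v mem_act_iff[OF assms] by (auto simp: perp_def act_def form_transform)
qed

lemma opposite_act:
  assumes "invertible g"
  shows "opposite M (act g l) (act g m) \<longleftrightarrow> opposite (g ** M ** transpose g) l m"
  unfolding opposite_def perp_act[OF assms] pg_disjoint_act[OF assms] ..

lemma join_act: "join (act g U) (act g V) = act g (join U V)"
  unfolding join_def act_span by (simp add: act_def image_Un)

lemma joins_act:
  assumes "invertible g"
  shows "joins (act g ` F) = act g ` joins F"
proof (rule Set.set_eqI)
  fix a
  have "a \<in> joins (act g ` F) \<longleftrightarrow> (\<exists>l\<in>F. \<exists>m\<in>F. act g l \<noteq> act g m \<and> a = join (act g l) (act g m))"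
    unfolding joins_def by blast
  also have "\<dots> \<longleftrightarrow> (\<exists>l\<in>F. \<exists>m\<in>F. l \<noteq> m \<and> a = act g (join l m))"
    by (simp add: act_eq_iff[OF assms] join_act)
  also have "\<dots> \<longleftrightarrow> a \<in> act g ` joins F"
    unfolding joins_def by blast
  finally show "a \<in> joins (act g ` F) \<longleftrightarrow> a \<in> act g ` joins F" .
qed

lemma F10_act:
  assumes "invertible g"
  shows "F10 M (act g ` F) = act g ` F10 (g ** M ** transpose g) F"
  unfolding F10_def joins_act[OF assms] by (simp add: image_image perp_act[OF assms])

lemma mem_F15_act:
  assumes "invertible g"
  shows "act g l \<in> F15 M (act g ` F) \<longleftrightarrow> l \<in> F15 (g ** M ** transpose g) F"
proof -
  have "act g l \<subseteq> act g a \<longleftrightarrow> l \<subseteq> a" for a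
    unfolding act_def using inj_image_subset_iff[OF inj_vector_matrix_mult[OF assms]] by blast
  then show ?thesis
    unfolding F15_def joins_act[OF assms] pg_lines_def
    by (simp add: act_subspaces_of_dim[OF assms] opposite_act[OF assms] pg_disjoint_act[OF assms] act_eq_iff[OF assms])
qed

lemma F15_act:
  assumes "invertible g"
  shows "F15 M (act g ` F) = act g ` F15 (g ** M ** transpose g) F"
proof (intro Set.set_eqI)
  fix l
  obtain k where "l = act g k" using act_inverse(2)[OF assms] by metis
  then show "l \<in> F15 M (act g ` F) \<longleftrightarrow> l \<in> act g ` F15 (g ** M ** transpose g) F"
    using mem_F15_act[OF assms] act_eq_iff[OF assms] by auto
qed

lemma isomorphic_trans:
  assumes "isomorphic A B" "isomorphic B C"
  shows "isomorphic A C"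
proof -
  obtain f g where fg: "bij_betw f (Points A) (Points B)" "bij_betw g (Lines A) (Lines B)"
     "\<forall>p\<in>Points A. \<forall>l\<in>Lines A. Inc A p l \<longleftrightarrow> Inc B (f p) (g l)"
    using assms(1) unfolding isomorphic_def by auto
  obtain f' g' where fg': "bij_betw f' (Points B) (Points C)" "bij_betw g' (Lines B) (Lines C)"
     "\<forall>p\<in>Points B. \<forall>l\<in>Lines B. Inc B p l \<longleftrightarrow> Inc C (f' p) (g' l)"
    using assms(2) unfolding isomorphic_def by auto
  have "bij_betw (f' \<circ> f) (Points A) (Points C)" "bij_betw (g' \<circ> g) (Lines A) (Lines C)"
    using fg fg' by (auto intro: bij_betw_trans)
  moreover have "\<forall>p\<in>Points A. \<forall>l\<in>Lines A. Inc A p l \<longleftrightarrow> Inc C ((f' \<circ> f) p) ((g' \<circ> g) l)"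
    using fg(3) fg'(3) bij_betwE[OF fg(1)] bij_betwE[OF fg(2)] by simp
  ultimately show ?thesis unfolding isomorphic_def by blast
qed

lemma isomorphic_sym:
  assumes "isomorphic A B"
  shows "isomorphic B A"
proof -
  obtain f g where f: "bij_betw f (Points A) (Points B)" and g: "bij_betw g (Lines A) (Lines B)"
     and inc: "\<forall>p\<in>Points A. \<forall>l\<in>Lines A. Inc A p l \<longleftrightarrow> Inc B (f p) (g l)"
    using assms(1) unfolding isomorphic_def by auto
  let ?f = "inv_into (Points A) f" and ?g = "inv_into (Lines A) g"
  have f': "bij_betw ?f (Points B) (Points A)" and g': "bij_betw ?g (Lines B) (Lines A)"
    using f g by (auto intro: bij_betw_inv_into)
  have "Inc B p l \<longleftrightarrow> Inc A (?f p) (?g l)" if "p \<in> Points B" "l \<in> Lines B" for p l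
  proof -
    have "?f p \<in> Points A" "?g l \<in> Lines A" using bij_betwE[OF f'] bij_betwE[OF g'] that by auto
    moreover have "f (?f p) = p" "g (?g l) = l" using bij_betw_inv_into_right[OF f that(1)] bij_betw_inv_into_right[OF g that(2)] .
    ultimately show ?thesis using inc by simp
  qed
  then show ?thesis unfolding isomorphic_def using f' g' by blast
qed

text \<open>Incidence is expressed through disjointness, inclusion and the polarity, all of which commute with
\<open>act g\<close>.\<close>

lemma mathon_structure_act:
  assumes "invertible g"
  shows "isomorphic (mathon_structure (g ** M ** transpose g) P F L)
           (mathon_structure M (act g ` P) (act g ` F) (act g ` L))"
proof -
  have inj: "inj (act g)" by (rule injI) (simp add: act_eq_iff[OF assms])
  have sub: "act g l \<subseteq> act g a \<longleftrightarrow> l \<subseteq> a" for l a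
    unfolding act_def using inj_image_subset_iff[OF inj_vector_matrix_mult[OF assms]] by blast
  have "bij_betw (act g) P (act g ` P)" using inj by (auto simp: bij_betw_def intro: inj_on_subset)
  moreover have "bij_betw (map_sum (act g) (act g)) (Inl ` F \<union> Inr ` L) (Inl ` act g ` F \<union> Inr ` act g ` L)"
  proof (rule bij_betw_imageI)
    show "inj_on (map_sum (act g) (act g)) (Inl ` F \<union> Inr ` L)"
      using sum.inj_map[OF inj inj] by (auto intro: inj_on_subset)
    show "map_sum (act g) (act g) ` (Inl ` F \<union> Inr ` L) = Inl ` act g ` F \<union> Inr ` act g ` L"
      by (simp add: image_Un image_image)
  qed
  ultimately show ?thesis
    unfolding isomorphic_def mathon_structure_def
    by (intro exI[of _ "act g"] exI[of _ "map_sum (act g) (act g)"])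
       (auto simp: perp_act[OF assms] pg_disjoint_act[OF assms] sub)
qed

section \<open>The projective group\<close>

lemma GL6_simps: "carrier GL6 = {g. invertible g}" "g \<otimes>\<^bsub>GL6\<^esub> h = g ** h" "\<one>\<^bsub>GL6\<^esub> = mat 1"
  by (simp_all add: GL6_def)

lemma invertible_mat_one: "invertible (mat 1 :: 'k::field ^ 'n ^ 'n)"
  unfolding invertible_def by (metis matrix_mul_lid)

lemma group_GL6: "group GL6"
proof (rule groupI)
  show "\<exists>y\<in>carrier GL6. y \<otimes>\<^bsub>GL6\<^esub> x = \<one>\<^bsub>GL6\<^esub>" if "x \<in> carrier GL6" for x
    using that by (intro bexI[of _ "matrix_inv x"]) (simp_all add: GL6_simps matrix_inv invertible_matrix_inv)
qed (simp_all add: GL6_simps invertible_mult invertible_mat_one matrix_mul_assoc)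

lemma matrix_eqI:
  fixes g h :: "'k::field ^ 'n ^ 'n"
  assumes "\<And>v. v v* g = v v* h"
  shows "g = h"
proof -
  have "transpose g = transpose h"
    by (subst matrix_eq) (simp add: assms)
  then show ?thesis by (metis transpose_transpose)
qed

lemma vector_mult_mat: "v v* mat c = c *s (v :: 'k::field ^ 'n)"
proof -
  have "(\<Sum>i\<in>UNIV. v $ i * (if i = j then c else 0)) = (\<Sum>i\<in>UNIV. if i = j then v $ i * c else 0)" for j
    by (rule sum.cong) auto
  then show ?thesis
    by (simp add: vector_matrix_mult_def mat_def vec_eq_iff)
qed

lemma mat_mult: "mat c ** mat d = (mat (c * d) :: 'k::field ^ 'n ^ 'n)"
  by (rule matrix_eqI) (simp add: vector_mult_mat mult.commute flip: vector_matrix_mul_assoc)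

lemma mat_commute: "mat c ** g = g ** mat c" for g :: "'k::field ^ 'n ^ 'n"
  by (rule matrix_eqI) (simp add: vector_mult_mat scalar_vector_matrix_assoc flip: vector_matrix_mul_assoc)

lemma invertible_mat: "c \<noteq> 0 \<Longrightarrow> invertible (mat c :: 'k::field ^ 'n ^ 'n)"
  unfolding invertible_def by (rule exI[of _ "mat (inverse c)"]) (simp add: mat_mult)

lemma invertible_mat_nonzero: "invertible (mat c :: mat6) \<Longrightarrow> c \<noteq> 0"
proof
  assume "invertible (mat c :: mat6)" "c = 0"
  have "v = 0" for v :: vec6
  proof -
    have "v = v v* (mat c ** matrix_inv (mat c))"
      by (subst matrix_inv(1)[OF \<open>invertible (mat c)\<close>]) simp
    also have "\<dots> = (c *s v) v* matrix_inv (mat c)"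
      by (simp add: vector_mult_mat flip: vector_matrix_mul_assoc)
    finally show ?thesis using \<open>c = 0\<close> by simp
  qed
  from this[of 1] show False by (simp add: vec_eq_iff)
qed

definition scalars :: "mat6 set" where
  "scalars = {mat c | c. c \<noteq> 0}"

lemma subgroup_scalars: "subgroup scalars GL6"
proof (rule group.subgroupI[OF group_GL6])
  show "scalars \<subseteq> carrier GL6"
    by (auto simp: scalars_def GL6_simps invertible_mat)
  show "scalars \<noteq> {}"
    unfolding scalars_def by (auto intro: exI[of _ 1])
next
  fix a assume "a \<in> scalars"
  then obtain c where c: "c \<noteq> 0" "a = mat c" unfolding scalars_def by blast
  have "inv\<^bsub>GL6\<^esub> a = mat (inverse c)"
    by (rule group.inv_equality[OF group_GL6]) (simp_all add: c GL6_simps invertible_mat mat_mult)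
  then show "inv\<^bsub>GL6\<^esub> a \<in> scalars" using c unfolding scalars_def by auto
next
  fix a b assume "a \<in> scalars" "b \<in> scalars"
  then obtain c d where "c \<noteq> 0" "a = mat c" "d \<noteq> 0" "b = mat d" unfolding scalars_def by blast
  then show "a \<otimes>\<^bsub>GL6\<^esub> b \<in> scalars"
    unfolding scalars_def by (auto simp: GL6_simps mat_mult intro!: exI[of _ "c * d"])
qed

lemma normal_scalars: "normal scalars GL6"
  by (rule group.normalI[OF group_GL6 subgroup_scalars])
     (auto simp: r_coset_def l_coset_def GL6_simps scalars_def mat_commute)

lemma PGL6_eq: "PGL6 = GL6 Mod scalars"
  by (simp add: PGL6_def scalars_def)

lemma group_PGL6: "group PGL6"
  unfolding PGL6_eq by (rule normal.factorgroup_is_group[OF normal_scalars])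

text \<open>The coset of \<open>g\<close> modulo scalars, i.e. the set of all matrices that induce the same projectivity.\<close>

definition projectivity :: "mat6 \<Rightarrow> mat6 set" where
  "projectivity g = {mat c ** g | c. c \<noteq> 0}"

lemma projectivity_eq_coset: "projectivity g = scalars #>\<^bsub>GL6\<^esub> g"
  by (auto simp: projectivity_def r_coset_def scalars_def GL6_simps)

lemma carrier_PGL6: "carrier PGL6 = projectivity ` {g. invertible g}"
  by (simp add: PGL6_eq carrier_FactGroup projectivity_eq_coset GL6_simps)

lemma projectivity_self: "g \<in> projectivity g"
  unfolding projectivity_def by (auto intro!: exI[of _ 1])

lemma projectivity_pow:
  assumes "invertible g"
  shows "projectivity g [^]\<^bsub>PGL6\<^esub> (n::nat) = projectivity (g [^]\<^bsub>GL6\<^esub> n)"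
proof -
  have "projectivity \<in> hom GL6 PGL6"
    unfolding PGL6_eq using normal.r_coset_hom_Mod[OF normal_scalars] by (simp add: projectivity_eq_coset[abs_def])
  then interpret group_hom GL6 PGL6 projectivity
    by (simp add: group_GL6 group_PGL6 group_hom_axioms_def group_hom_def)
  show ?thesis using assms by (simp add: hom_nat_pow GL6_simps)
qed

lemma projectivity_eq_one_iff:
  assumes "invertible g"
  shows "projectivity g = \<one>\<^bsub>PGL6\<^esub> \<longleftrightarrow> (\<exists>c. g = mat c)"
proof
  assume "projectivity g = \<one>\<^bsub>PGL6\<^esub>"
  then have "g \<in> scalars" using projectivity_self by (auto simp: PGL6_eq)
  then show "\<exists>c. g = mat c" by (auto simp: scalars_def)
next
  assume "\<exists>c. g = mat c"
  then obtain c where "g = mat c" by blast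
  then have "g \<in> scalars" using invertible_mat_nonzero assms by (auto simp: scalars_def)
  then show "projectivity g = \<one>\<^bsub>PGL6\<^esub>"
    by (simp add: projectivity_eq_coset PGL6_eq group.coset_join2[OF group_GL6 _ subgroup_scalars] assms GL6_simps)
qed

lemma invertible_pow: "invertible g \<Longrightarrow> invertible (g [^]\<^bsub>GL6\<^esub> (n::nat))"
  using group.is_monoid[OF group_GL6] monoid.nat_pow_closed[of GL6 g n] by (simp add: GL6_simps)

definition projective_order_5 :: "mat6 \<Rightarrow> bool" where
  "projective_order_5 g \<longleftrightarrow> (\<nexists>c. g = mat c) \<and> (\<exists>c. g [^]\<^bsub>GL6\<^esub> (5::nat) = mat c)"

text \<open>As 5 is prime, an element has order 5 as soon as it is nontrivial and its fifth power is trivial.\<close>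

lemma ord_projectivity_5_iff:
  assumes "invertible g"
  shows "group.ord PGL6 (projectivity g) = 5 \<longleftrightarrow> projective_order_5 g"
proof -
  interpret group PGL6 by (rule group_PGL6)
  have car: "projectivity g \<in> carrier PGL6" using assms by (simp add: carrier_PGL6)
  have "ord (projectivity g) = 5 \<longleftrightarrow> ord (projectivity g) \<noteq> 1 \<and> ord (projectivity g) dvd 5"
  proof
    assume *: "ord (projectivity g) \<noteq> 1 \<and> ord (projectivity g) dvd 5"
    moreover have "prime (5::nat)" by simp
    ultimately show "ord (projectivity g) = 5" by (metis prime_nat_iff)
  qed simp
  also have "\<dots> \<longleftrightarrow> projectivity g \<noteq> \<one>\<^bsub>PGL6\<^esub> \<and> projectivity g [^]\<^bsub>PGL6\<^esub> (5::nat) = \<one>\<^bsub>PGL6\<^esub>"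
    using car by (simp add: pow_eq_id ord_eq_1 del: One_nat_def)
  finally show ?thesis
    by (simp add: projectivity_eq_one_iff projectivity_pow invertible_pow assms projective_order_5_def)
qed

lemma act_scalar:
  assumes "vec.subspace U" "c \<noteq> 0"
  shows "act (mat c) U = U"
proof
  show "act (mat c) U \<subseteq> U" using assms by (auto simp: act_def vector_mult_mat vec.subspace_scale)
  show "U \<subseteq> act (mat c) U"
  proof
    fix v assume "v \<in> U"
    then have "inverse c *s v \<in> U" "v = (inverse c *s v) v* mat c" using assms by (auto simp: vector_mult_mat vec.subspace_scale)
    then show "v \<in> act (mat c) U" unfolding act_def by blast
  qed
qed

lemma act_projectivity:
  assumes "h \<in> projectivity g" "vec.subspace U"
  shows "act h U = act g U"
  using assms by (auto simp: projectivity_def act_mult act_scalar)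

text \<open>Scalars fix every subspace, so any one representative decides whether a projectivity stabilises \<open>F\<close>.\<close>

lemma projectivity_mem_stabiliser_iff:
  assumes "invertible g" "\<forall>U\<in>F. vec.subspace U"
  shows "projectivity g \<in> stabiliser F \<longleftrightarrow> act g ` F = F"
proof -
  have "act h ` F = act g ` F" if "h \<in> projectivity g" for h
    using act_projectivity[OF that] assms(2) by auto
  then have "(\<forall>h\<in>projectivity g. act h ` F = F) \<longleftrightarrow> act g ` F = F"
    using projectivity_self[of g] by metis
  moreover have "projectivity g \<in> carrier PGL6" using assms(1) by (simp add: carrier_PGL6)
  ultimately show ?thesis by (simp add: stabiliser_def)
qed

text \<open>The definition of \<open>F6\<close> with cosets replaced by single matrices.\<close>

lemma mem_F6_stabiliser_iff:
  assumes F: "\<forall>U\<in>F. vec.subspace U"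
  shows "l \<in> F6 (stabiliser F) \<longleftrightarrow> l \<in> pg_lines \<and>
    (\<exists>g. invertible g \<and> act g ` F = F \<and> projective_order_5 g \<and> act g l = l)"
proof (cases "l \<in> pg_lines")
  case True
  then have l: "vec.subspace l" by (simp add: pg_lines_def subspaces_of_dim_def)
  have fix_l: "(\<forall>h\<in>projectivity g. act h l = l) \<longleftrightarrow> act g l = l" for g
    using act_projectivity[OF _ l] projectivity_self by metis
  have "l \<in> F6 (stabiliser F) \<longleftrightarrow>
      (\<exists>\<gamma>\<in>projectivity ` {g. invertible g}. \<gamma> \<in> stabiliser F \<and> group.ord PGL6 \<gamma> = 5 \<and> (\<forall>h\<in>\<gamma>. act h l = l))"
    using True unfolding F6_def by (auto simp: stabiliser_def carrier_PGL6)
  also have "\<dots> \<longleftrightarrow> (\<exists>g. invertible g \<and> projectivity g \<in> stabiliser F \<and> group.ord PGL6 (projectivity g) = 5 \<and> (\<forall>h\<in>projectivity g. act h l = l))"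
    by blast
  also have "\<dots> \<longleftrightarrow> (\<exists>g. invertible g \<and> act g ` F = F \<and> projective_order_5 g \<and> act g l = l)"
    using projectivity_mem_stabiliser_iff[OF _ F] ord_projectivity_5_iff fix_l by (metis (no_types, lifting))
  finally show ?thesis using True by simp
qed (simp add: F6_def)

lemma conj_pow:
  assumes "invertible t"
  shows "(t ** g ** matrix_inv t) [^]\<^bsub>GL6\<^esub> (n::nat) = t ** g [^]\<^bsub>GL6\<^esub> n ** matrix_inv t"
proof (induction n)
  case 0
  then show ?case using matrix_inv[OF assms] by (simp add: GL6_simps)
next
  case (Suc n)
  have "(t ** g [^]\<^bsub>GL6\<^esub> n ** matrix_inv t) ** (t ** g ** matrix_inv t)
      = t ** g [^]\<^bsub>GL6\<^esub> n ** (matrix_inv t ** t) ** g ** matrix_inv t"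
    by (simp only: matrix_mul_assoc)
  then show ?case using Suc matrix_inv[OF assms] by (simp add: GL6_simps matrix_mul_assoc)
qed

lemma conj_mat:
  fixes t :: mat6
  assumes "invertible t"
  shows "t ** mat c ** matrix_inv t = (mat c :: mat6)"
proof -
  have "t ** mat c ** matrix_inv t = mat c ** (t ** matrix_inv t)"
    by (simp only: mat_commute[of c t] matrix_mul_assoc)
  then show ?thesis using matrix_inv(1)[OF assms] by simp
qed

lemma act_mem_F6_stabiliser:
  assumes t: "invertible t" and F: "\<forall>U\<in>F. vec.subspace U" and l: "l \<in> F6 (stabiliser F)"
  shows "act t l \<in> F6 (stabiliser (act t ` F))"
proof -
  let ?t' = "matrix_inv t"
  obtain g where g: "invertible g" "act g ` F = F" "projective_order_5 g" "act g l = l"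
    and l: "l \<in> pg_lines"
    using l mem_F6_stabiliser_iff[OF F] by auto
  obtain c where g5: "g [^]\<^bsub>GL6\<^esub> (5::nat) = mat c" and g1: "\<nexists>c. g = mat c"
    using g(3) unfolding projective_order_5_def by auto
  define h where "h = ?t' ** g ** t"
  have t': "matrix_inv ?t' = t" "invertible ?t'"
    using matrix_inv_involutive[OF t] invertible_matrix_inv[OF t] by auto
  have act_h: "act h (act t U) = act t (act g U)" for U
    unfolding h_def using act_inverse[OF t] by (simp add: act_mult)
  have "invertible h" using g t t' by (simp add: h_def invertible_mult)
  moreover have "act h ` act t ` F = act t ` F"
  proof -
    have "act h ` act t ` F = act t ` act g ` F" by (simp add: image_image act_h)
    then show ?thesis using g(2) by simp
  qed
  moreover have "\<nexists>c. h = mat c"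
  proof
    assume "\<exists>c. h = mat c"
    then obtain c where "h = mat c" by blast
    moreover have "t ** h ** ?t' = (t ** ?t') ** g ** (t ** ?t')" by (simp add: h_def matrix_mul_assoc)
    ultimately have "g = mat c" using matrix_inv[OF t] conj_mat[OF t] by simp
    then show False using g1 by blast
  qed
  moreover have "h [^]\<^bsub>GL6\<^esub> (5::nat) = mat c"
    using conj_pow[OF t'(2), of g 5] conj_mat[OF t'(2)] g5 by (simp add: h_def t')
  moreover have "act h (act t l) = act t l" using g by (simp add: act_h)
  moreover have "act t l \<in> pg_lines" using l act_subspaces_of_dim[OF t] by (simp add: pg_lines_def)
  moreover have "\<forall>U\<in>act t ` F. vec.subspace U" using F subspace_act by blast
  ultimately show ?thesis
    unfolding projective_order_5_def by (simp add: mem_F6_stabiliser_iff projective_order_5_def) blast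
qed

text \<open>Conjugation by \<open>t\<close> carries the stabiliser of \<open>F\<close> to that of its image and preserves projective orders.\<close>

lemma F6_stabiliser_act:
  assumes t: "invertible t" and F: "\<forall>U\<in>F. vec.subspace U"
  shows "F6 (stabiliser (act t ` F)) = act t ` F6 (stabiliser F)"
proof
  show "act t ` F6 (stabiliser F) \<subseteq> F6 (stabiliser (act t ` F))"
    using act_mem_F6_stabiliser[OF assms] by blast
  show "F6 (stabiliser (act t ` F)) \<subseteq> act t ` F6 (stabiliser F)"
  proof
    fix l assume "l \<in> F6 (stabiliser (act t ` F))"
    then have "act (matrix_inv t) l \<in> F6 (stabiliser (act (matrix_inv t) ` act t ` F))"
      using act_mem_F6_stabiliser[OF invertible_matrix_inv[OF t]] F subspace_act by blast
    then have "act (matrix_inv t) l \<in> F6 (stabiliser F)" by (simp add: image_image act_inverse[OF t])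
    then show "l \<in> act t ` F6 (stabiliser F)" using act_inverse(2)[OF t] by (metis image_eqI)
  qed
qed

section \<open>Coordinates over GF(3)\<close>

lemma exhaust_6: "x = 1 \<or> x = 2 \<or> x = 3 \<or> x = 4 \<or> x = 5 \<or> x = 6" for x :: 6
proof (induct x)
  case (of_int z)
  then have "z = 0 \<or> z = 1 \<or> z = 2 \<or> z = 3 \<or> z = 4 \<or> z = 5" by fastforce
  then show ?case by auto
qed

lemma UNIV_6: "UNIV = {1, 2, 3, 4, 5, 6::6}"
  using exhaust_6 by auto

lemma sum_6: "sum f (UNIV::6 set) = f 1 + f 2 + f 3 + f 4 + f 5 + f 6"
  unfolding UNIV_6 by (simp add: ac_simps)

lemma forall_6: "(\<forall>i::6. P i) \<longleftrightarrow> P 1 \<and> P 2 \<and> P 3 \<and> P 4 \<and> P 5 \<and> P 6"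
  by (metis exhaust_6)

lemma vector_6 [simp]:
  "(vector [a,b,c,d,e,f] :: 'a::zero^6) $ 1 = a"
  "(vector [a,b,c,d,e,f] :: 'a::zero^6) $ 2 = b"
  "(vector [a,b,c,d,e,f] :: 'a::zero^6) $ 3 = c"
  "(vector [a,b,c,d,e,f] :: 'a::zero^6) $ 4 = d"
  "(vector [a,b,c,d,e,f] :: 'a::zero^6) $ 5 = e"
  "(vector [a,b,c,d,e,f] :: 'a::zero^6) $ 6 = f"
  unfolding vector_def by simp_all

text \<open>Vectors and matrices over \<open>GF(3)\<close> as nested tuples, on which all operations can be evaluated.\<close>

type_synonym row = "gf3 \<times> gf3 \<times> gf3 \<times> gf3 \<times> gf3 \<times> gf3"
type_synonym rows = "row \<times> row \<times> row \<times> row \<times> row \<times> row"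

fun vec_of :: "row \<Rightarrow> vec6" where
  "vec_of (a, b, c, d, e, f) = vector [a, b, c, d, e, f]"

fun mat_of :: "rows \<Rightarrow> mat6" where
  "mat_of (r\<^sub>1, r\<^sub>2, r\<^sub>3, r\<^sub>4, r\<^sub>5, r\<^sub>6) =
     vector [vec_of r\<^sub>1, vec_of r\<^sub>2, vec_of r\<^sub>3, vec_of r\<^sub>4, vec_of r\<^sub>5, vec_of r\<^sub>6]"

fun row_add :: "row \<Rightarrow> row \<Rightarrow> row" where
  "row_add (a, b, c, d, e, f) (a', b', c', d', e', f') = (a + a', b + b', c + c', d + d', e + e', f + f')"

fun row_scale :: "gf3 \<Rightarrow> row \<Rightarrow> row" where
  "row_scale k (a, b, c, d, e, f) = (k * a, k * b, k * c, k * d, k * e, k * f)"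

fun dot :: "row \<Rightarrow> row \<Rightarrow> gf3" where
  "dot (a, b, c, d, e, f) (a', b', c', d', e', f') = a * a' + b * b' + c * c' + d * d' + e * e' + f * f'"

definition comb :: "gf3 \<Rightarrow> row \<Rightarrow> gf3 \<Rightarrow> row \<Rightarrow> row" where
  "comb a u b w = row_add (row_scale a u) (row_scale b w)"

fun row_mult :: "row \<Rightarrow> rows \<Rightarrow> row" where
  "row_mult (a, b, c, d, e, f) (r\<^sub>1, r\<^sub>2, r\<^sub>3, r\<^sub>4, r\<^sub>5, r\<^sub>6) =
     row_add (comb a r\<^sub>1 b r\<^sub>2) (row_add (comb c r\<^sub>3 d r\<^sub>4) (comb e r\<^sub>5 f r\<^sub>6))"

definition row_form :: "rows \<Rightarrow> row \<Rightarrow> row \<Rightarrow> gf3" where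
  "row_form m u v = dot (row_mult u m) v"

definition zero_row :: row where
  "zero_row = (0, 0, 0, 0, 0, 0)"

lemma vec_of_add: "vec_of (row_add u v) = vec_of u + vec_of v"
  by (cases u rule: prod_cases6; cases v rule: prod_cases6) (simp add: vec_eq_iff forall_6)

lemma vec_of_scale: "vec_of (row_scale k u) = k *s vec_of u"
  by (cases u rule: prod_cases6) (simp add: vec_eq_iff forall_6)

lemma vec_of_comb: "vec_of (comb a u b w) = a *s vec_of u + b *s vec_of w"
  by (simp add: comb_def vec_of_add vec_of_scale)

lemma vec_of_zero: "vec_of zero_row = 0"
  by (simp add: zero_row_def vec_eq_iff forall_6)

lemma vec_of_eq_iff: "vec_of u = vec_of v \<longleftrightarrow> u = v"
  by (cases u rule: prod_cases6; cases v rule: prod_cases6) (simp add: vec_eq_iff forall_6)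

lemma vec_of_eq_0_iff: "vec_of u = 0 \<longleftrightarrow> u = zero_row"
  using vec_of_eq_iff[of u zero_row] by (simp add: vec_of_zero)

lemma vec_of_surj: obtains r where "v = vec_of r"
proof
  show "v = vec_of (v $ 1, v $ 2, v $ 3, v $ 4, v $ 5, v $ 6)"
    by (simp add: vec_eq_iff forall_6)
qed

lemma mat_of_surj: obtains m where "M = mat_of m"
proof -
  have "\<exists>r. v = vec_of r" for v using vec_of_surj by metis
  then obtain f where f: "\<And>v. v = vec_of (f v)" by metis
  have "M = mat_of (f (M $ 1), f (M $ 2), f (M $ 3), f (M $ 4), f (M $ 5), f (M $ 6))"
    unfolding mat_of.simps f[symmetric] by (simp add: vec_eq_iff[of M] forall_6)
  then show ?thesis using that by blast
qed

lemma vec_of_mult: "vec_of u v* mat_of m = vec_of (row_mult u m)"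
proof -
  obtain a b c d e f where u: "u = (a, b, c, d, e, f)" by (cases u rule: prod_cases6)
  obtain r1 r2 r3 r4 r5 r6 where m: "m = (r1, r2, r3, r4, r5, r6)" by (cases m rule: prod_cases6)
  have "vec_of u v* mat_of m = a *s vec_of r1 + b *s vec_of r2 + c *s vec_of r3 + d *s vec_of r4
      + e *s vec_of r5 + f *s vec_of r6"
    by (simp add: u m vector_matrix_mult_def vec_eq_iff sum_6)
  also have "\<dots> = vec_of (row_mult u m)"
    by (simp add: u m vec_of_add vec_of_comb add_ac)
  finally show ?thesis .
qed

lemma form_mat_of: "form (mat_of m) (vec_of u) (vec_of v) = row_form m u v"
proof -
  have "(\<Sum>j\<in>UNIV. vec_of x $ j * vec_of y $ j) = dot x y" for x y
    by (cases x rule: prod_cases6; cases y rule: prod_cases6) (simp add: sum_6)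
  then show ?thesis by (simp add: form_def vec_of_mult row_form_def)
qed

declare vec_of.simps [simp del] mat_of.simps [simp del]

type_synonym basis = "row \<times> row"

fun line_of :: "basis \<Rightarrow> vec6 set" where
  "line_of (u, w) = vec.span {vec_of u, vec_of w}"

fun in_line :: "row \<Rightarrow> basis \<Rightarrow> bool" where
  "in_line v (u, w) \<longleftrightarrow> (\<exists>a b. v = comb a u b w)"

fun independent_rows :: "basis \<Rightarrow> bool" where
  "independent_rows (u, w) \<longleftrightarrow> (\<forall>a b. comb a u b w = zero_row \<longrightarrow> a = 0 \<and> b = 0)"

lemma vec_of_mem_line_of: "vec_of v \<in> line_of l \<longleftrightarrow> in_line v l"
  by (cases l rule: prod.exhaust) (simp add: mem_span_pair vec_of_comb[symmetric] vec_of_eq_iff)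

lemma line_of_mem_pg_lines: "independent_rows l \<Longrightarrow> line_of l \<in> pg_lines"
  unfolding pg_lines_def
  by (cases l rule: prod.exhaust) (simp add: span_pair_dim_2 independent_pair_def vec_of_comb[symmetric] vec_of_eq_0_iff)

lemma subspace_line_of: "vec.subspace (line_of l)"
  by (cases l rule: prod.exhaust) simp

lemma line_of_subsetI:
  assumes "vec.subspace U" "vec_of u \<in> U" "vec_of w \<in> U"
  shows "line_of (u, w) \<subseteq> U"
  using assms by (simp add: vec.span_minimal)

lemma mem_line_ofE:
  assumes "v \<in> line_of (u, w)"
  obtains a b where "v = vec_of (comb a u b w)"
  using assms by (auto simp: mem_span_pair vec_of_comb)

lemma act_line_of: "act (mat_of m) (line_of (u, w)) = line_of (row_mult u m, row_mult w m)"
  by (simp add: act_span vec_of_mult)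

lemma line_of_eqI:
  assumes "independent_rows (u, w)" "independent_rows k" "in_line u k" "in_line w k"
  shows "line_of (u, w) = line_of k"
  using assms line_of_mem_pg_lines dim_2_eqI[of "line_of (u, w)" "line_of k"]
    line_of_subsetI[OF subspace_line_of] vec_of_mem_line_of
  unfolding pg_lines_def by blast

declare line_of.simps [simp del]

section \<open>All choices of the fifth line are equivalent\<close>

lemma finite_3_last_eq [simp]: "Enum.finite_3.a\<^sub>3 = -1"
  by code_simp

definition frame :: "basis list" where
  "frame =
    [((1, 0, 0, 0, 0, 0), (0, 1, 0, 0, 0, 0)),
     ((0, 0, 1, 0, 0, 0), (0, 0, 0, 1, 0, 0)),
     ((0, 0, 0, 0, 1, 0), (0, 0, 0, 0, 0, 1)),
     ((1, 0, 1, 0, 1, 0), (0, 1, 0, 1, 0, 1))]"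

fun fifth_line :: "gf3 \<times> gf3 \<times> gf3 \<times> gf3 \<Rightarrow> gf3 \<times> gf3 \<times> gf3 \<times> gf3 \<Rightarrow> basis" where
  "fifth_line (a, b, c, d) (a', b', c', d') = ((1, 0, a, b, a', b'), (0, 1, c, d, c', d'))"

fun mat2_of :: "gf3 \<times> gf3 \<times> gf3 \<times> gf3 \<Rightarrow> mat2" where
  "mat2_of (a, b, c, d) = vector [vector [a, b], vector [c, d]]"

lemma mat2_of_surj: obtains a b c d where "A = mat2_of (a, b, c, d)"
proof
  show "A = mat2_of (A $ 1 $ 1, A $ 1 $ 2, A $ 2 $ 1, A $ 2 $ 2)"
    by (simp add: vec_eq_iff forall_2)
qed

lemma block_line_eq:
  "block_line A B C = line_of ((A$1$1, A$1$2, B$1$1, B$1$2, C$1$1, C$1$2), (A$2$1, A$2$2, B$2$1, B$2$2, C$2$1, C$2$2))"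
proof -
  have "rows (\<chi> i. block_row A B C i) = {block_row A B C 1, block_row A B C 2}"
    by (auto simp: rows_def row_def vec_lambda_eta) (metis exhaust_2)
  then show ?thesis by (simp add: block_line_def block_row_def vec_of.simps line_of.simps)
qed

lemma F4_eq: "F4 = line_of ` set frame"
  by (simp add: F4_def frame_def block_line_eq mat_def)

lemma block_line_fifth: "block_line (mat 1) (mat2_of r) (mat2_of s) = line_of (fifth_line r s)"
  by (cases r rule: prod_cases4; cases s rule: prod_cases4) (simp add: block_line_eq mat_def)

lemma F5_eq: "F5 (mat2_of r) (mat2_of s) = line_of ` set (frame @ [fifth_line r s])"
  by (auto simp: F5_def F4_eq block_line_fifth)

definition M0_rows :: rows where
  "M0_rows = ((0,0,0,1,0,1), (0,0,-1,0,-1,0), (0,1,0,0,0,1), (-1,0,0,0,-1,0), (0,1,0,1,0,0), (-1,0,-1,0,0,0))"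

lemma M\<^sub>0_eq: "M\<^sub>0 = mat_of M0_rows"
  by (simp add: M\<^sub>0_def block_mat_def block_row_def X_def M0_rows_def vec_of.simps mat_of.simps)

lemma mem_perp_line_of:
  "vec_of v \<in> perp (mat_of m) (line_of (u, w)) \<longleftrightarrow> row_form m u v = 0 \<and> row_form m w v = 0"
proof
  assume "vec_of v \<in> perp (mat_of m) (line_of (u, w))"
  moreover have "vec_of u \<in> line_of (u, w)" "vec_of w \<in> line_of (u, w)"
    by (simp_all add: line_of.simps vec.span_base)
  ultimately show "row_form m u v = 0 \<and> row_form m w v = 0"
    unfolding perp_def by (auto simp flip: form_mat_of)
next
  assume "row_form m u v = 0 \<and> row_form m w v = 0"
  then show "vec_of v \<in> perp (mat_of m) (line_of (u, w))"
    unfolding perp_def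
    by (auto simp: line_of.simps mem_span_pair form_add_left form_scale_left form_mat_of)
qed

lemma mem_joinI:
  assumes "u \<in> U" "v \<in> V" shows "u + v \<in> join U V"
  unfolding join_def using assms by (intro vec.span_add vec.span_base) auto

text \<open>A vector \<open>(x, y, z)\<close>, in blocks of length two, lies in the span of two lines of the frame exactly when one
of its blocks is zero or two of them coincide.\<close>

fun in_general_position :: "basis \<Rightarrow> bool" where
  "in_general_position (u, w) \<longleftrightarrow> (\<forall>a b. (a, b) = (0, 0) \<or>
     (case comb a u b w of (x, x', y, y', z, z') \<Rightarrow>
       (x, x') \<noteq> (0, 0) \<and> (y, y') \<noteq> (0, 0) \<and> (z, z') \<noteq> (0, 0) \<and>
       (x, x') \<noteq> (y, y') \<and> (x, x') \<noteq> (z, z') \<and> (y, y') \<noteq> (z, z')))"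

text \<open>One clause for each line of the frame: \<open>(x, y, z)\<close> is perpendicular to the first three lines with respect to
\<open>M\<^sub>0\<close> if \<open>y + z\<close>, \<open>x + z\<close>, \<open>x + y\<close> vanishes, respectively, and to the last one if \<open>x + y + z\<close> vanishes.\<close>

fun meets_perps :: "basis \<Rightarrow> bool" where
  "meets_perps (u, w) \<longleftrightarrow>
     (\<exists>a b. (a, b) \<noteq> (0, 0) \<and> (case comb a u b w of (x, x', y, y', z, z') \<Rightarrow> (y + z, y' + z') = (0, 0))) \<and>
     (\<exists>a b. (a, b) \<noteq> (0, 0) \<and> (case comb a u b w of (x, x', y, y', z, z') \<Rightarrow> (x + z, x' + z') = (0, 0))) \<and>
     (\<exists>a b. (a, b) \<noteq> (0, 0) \<and> (case comb a u b w of (x, x', y, y', z, z') \<Rightarrow> (x + y, x' + y') = (0, 0))) \<and>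
     (\<exists>a b. (a, b) \<noteq> (0, 0) \<and> (case comb a u b w of (x, x', y, y', z, z') \<Rightarrow> (x + y + z, x' + y' + z') = (0, 0)))"

lemma frame_lines_distinct:
  assumes "k \<in> set frame" "l \<in> set frame" "k \<noteq> l"
  shows "line_of k \<noteq> line_of l"
proof -
  have "\<forall>k\<in>set frame. \<forall>l\<in>set frame. k \<noteq> l \<longrightarrow> in_line (fst k) k \<and> \<not> in_line (fst k) l"
    by code_simp
  then have "vec_of (fst k) \<in> line_of k" "vec_of (fst k) \<notin> line_of l"
    using assms by (auto simp: vec_of_mem_line_of)
  then show ?thesis by auto
qed

text \<open>The line \<open>(I R S)\<close> avoids the six solids spanned by the frame and contains a point of each of the four
perps. These two properties already determine \<open>(R, S)\<close> up to conjugation.\<close>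

lemma admissible_line_conditions:
  assumes L: "block_line (mat 1) (mat2_of r) (mat2_of s) \<in> \<L>"
  shows "in_general_position (fifth_line r s)" and "meets_perps (fifth_line r s)"
proof -
  obtain a b c d where r: "r = (a, b, c, d)" by (cases r rule: prod_cases4)
  obtain a' b' c' d' where s: "s = (a', b', c', d')" by (cases s rule: prod_cases4)
  let ?u = "(1, 0, a, b, a', b') :: row" and ?w = "(0, 1, c, d, c', d') :: row"
  have uw: "fifth_line r s = (?u, ?w)" by (simp add: r s)
  have nz: "vec_of (comb i ?u j ?w) \<noteq> 0" if "(i, j) \<noteq> (0, 0)" for i j
    using that by (auto simp: comb_def vec_of_eq_0_iff zero_row_def)
  have mem: "vec_of (comb i ?u j ?w) \<in> line_of (fifth_line r s)" for i j
    unfolding uw vec_of_mem_line_of by auto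
  have disj: "vec_of (row_add x y) \<notin> line_of (fifth_line r s) \<or> vec_of (row_add x y) = 0"
    if "k \<in> set frame" "l \<in> set frame" "k \<noteq> l" "in_line x k" "in_line y l" for x y k l
  proof -
    have "pg_disjoint (line_of (fifth_line r s)) (join (line_of k) (line_of l))"
      using L that frame_lines_distinct[OF that(1-3)] unfolding \<L>_def block_line_fifth F4_eq by auto
    moreover have "vec_of (row_add x y) \<in> join (line_of k) (line_of l)"
      unfolding vec_of_add using that by (intro mem_joinI) (simp_all add: vec_of_mem_line_of)
    ultimately show ?thesis
      using pg_disjointD subspace_line_of subspace_join by blast
  qed
  have block_cases: "(x, x') \<noteq> (0, 0) \<and> (y, y') \<noteq> (0, 0) \<and> (z, z') \<noteq> (0, 0) \<and>
       (x, x') \<noteq> (y, y') \<and> (x, x') \<noteq> (z, z') \<and> (y, y') \<noteq> (z, z')"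
    if v: "vec_of (x, x', y, y', z, z') \<in> line_of (fifth_line r s)" "vec_of (x, x', y, y', z, z') \<noteq> 0"
    for x x' y y' z z'
  proof -
    have "(x, x', y, y', z, z') \<noteq> row_add v\<^sub>1 v\<^sub>2"
      if "k \<in> set frame" "l \<in> set frame" "k \<noteq> l" "in_line v\<^sub>1 k" "in_line v\<^sub>2 l" for v\<^sub>1 v\<^sub>2 k l
      using disj[OF that] v by metis
    from this[of "frame ! 1" "frame ! 2" "(0, 0, y, y', 0, 0)" "(0, 0, 0, 0, z, z')"]
      this[of "frame ! 0" "frame ! 2" "(x, x', 0, 0, 0, 0)" "(0, 0, 0, 0, z, z')"]
      this[of "frame ! 0" "frame ! 1" "(x, x', 0, 0, 0, 0)" "(0, 0, y, y', 0, 0)"]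
      this[of "frame ! 2" "frame ! 3" "(0, 0, 0, 0, z - x, z' - x')" "(x, x', x, x', x, x')"]
      this[of "frame ! 1" "frame ! 3" "(0, 0, y - x, y' - x', 0, 0)" "(x, x', x, x', x, x')"]
      this[of "frame ! 0" "frame ! 3" "(x - y, x' - y', 0, 0, 0, 0)" "(y, y', y, y', y, y')"]
    show ?thesis by (auto simp: frame_def comb_def)
  qed
  show "in_general_position (fifth_line r s)"
    unfolding uw in_general_position.simps disj_imp
  proof (intro allI impI)
    fix i j :: gf3 assume ij: "(i, j) \<noteq> (0, 0)"
    obtain x x' y y' z z' where v: "comb i ?u j ?w = (x, x', y, y', z, z')"
      by (cases "comb i ?u j ?w" rule: prod_cases6)
    show "case comb i ?u j ?w of (x, x', y, y', z, z') \<Rightarrow>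
       (x, x') \<noteq> (0, 0) \<and> (y, y') \<noteq> (0, 0) \<and> (z, z') \<noteq> (0, 0) \<and>
       (x, x') \<noteq> (y, y') \<and> (x, x') \<noteq> (z, z') \<and> (y, y') \<noteq> (z, z')"
      using block_cases nz[OF ij] mem[of i j] unfolding v by simp
  qed
  have meet: "\<exists>i j. (i, j) \<noteq> (0, 0) \<and> row_form M0_rows x (comb i ?u j ?w) = 0 \<and> row_form M0_rows y (comb i ?u j ?w) = 0"
    if "(x, y) \<in> set frame" for x y
  proof -
    have "line_of (x, y) \<in> F4" using that by (simp add: F4_eq)
    then have "\<exists>!P. P \<in> points_of (line_of (fifth_line r s)) \<inter> points_of (perp M\<^sub>0 (line_of (x, y)))"
      using L unfolding \<L>_def block_line_fifth by simp
    then obtain P where "P \<in> points_of (line_of (fifth_line r s)) \<inter> points_of (perp M\<^sub>0 (line_of (x, y)))"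
      by (elim ex1E)
    then have P: "P \<in> subspaces_of_dim 1" "P \<subseteq> line_of (fifth_line r s)" "P \<subseteq> perp M\<^sub>0 (line_of (x, y))"
      by (simp_all add: points_of_def)
    have "\<not> P \<subseteq> {0}"
      using P(1) vec.dim_eq_0[of P] unfolding subspaces_of_dim_def by auto
    then obtain v where v: "v \<in> P" "v \<noteq> 0" by auto
    then obtain i j where ij: "v = vec_of (comb i ?u j ?w)"
      using P(2) mem_line_ofE unfolding uw by blast
    have "(i, j) \<noteq> (0, 0)"
      using v(2) ij by (auto simp: comb_def vec_of_eq_0_iff zero_row_def)
    moreover have "vec_of (comb i ?u j ?w) \<in> perp (mat_of M0_rows) (line_of (x, y))"
      using v(1) P(3) ij M\<^sub>0_eq by auto
    ultimately show ?thesis unfolding mem_perp_line_of by blast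
  qed
  show "meets_perps (fifth_line r s)"
    unfolding uw meets_perps.simps
  proof (intro conjI)
    have *: "\<exists>i j. (i, j) \<noteq> (0, 0) \<and> Q (comb i ?u j ?w)"
      if "(x, y) \<in> set frame" "\<And>v. row_form M0_rows x v = 0 \<Longrightarrow> row_form M0_rows y v = 0 \<Longrightarrow> Q v" for x y Q
      using meet[OF that(1)] that(2) by metis
    have neg: "- p - q = 0 \<longleftrightarrow> p + q = 0" for p q :: gf3
      by (metis add_uminus_conv_diff minus_add_distrib neg_equal_0_iff_equal)
    have neg3: "- p - q - r = 0 \<longleftrightarrow> p + q + r = 0" for p q r :: gf3
      by (metis add_uminus_conv_diff minus_add_distrib neg_equal_0_iff_equal)
    note row_form_simps = row_form_def M0_rows_def comb_def frame_def split_paired_all neg neg3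
    show "\<exists>a b. (a, b) \<noteq> (0, 0) \<and> (case comb a ?u b ?w of (x, x', y, y', z, z') \<Rightarrow> (y + z, y' + z') = (0, 0))"
      by (rule *[of "(1, 0, 0, 0, 0, 0)" "(0, 1, 0, 0, 0, 0)"]) (auto simp: row_form_simps)
    show "\<exists>a b. (a, b) \<noteq> (0, 0) \<and> (case comb a ?u b ?w of (x, x', y, y', z, z') \<Rightarrow> (x + z, x' + z') = (0, 0))"
      by (rule *[of "(0, 0, 1, 0, 0, 0)" "(0, 0, 0, 1, 0, 0)"]) (auto simp: row_form_simps)
    show "\<exists>a b. (a, b) \<noteq> (0, 0) \<and> (case comb a ?u b ?w of (x, x', y, y', z, z') \<Rightarrow> (x + y, x' + y') = (0, 0))"
      by (rule *[of "(0, 0, 0, 0, 1, 0)" "(0, 0, 0, 0, 0, 1)"]) (auto simp: row_form_simps)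
    show "\<exists>a b. (a, b) \<noteq> (0, 0) \<and> (case comb a ?u b ?w of (x, x', y, y', z, z') \<Rightarrow> (x + y + z, x' + y' + z') = (0, 0))"
      by (rule *[of "(1, 0, 1, 0, 1, 0)" "(0, 1, 0, 1, 0, 1)"]) (auto simp: row_form_simps)
  qed
qed

text \<open>Representatives of the admissible pairs; both matrices have characteristic polynomial \<open>(x + 1)\<^sup>2\<close>.\<close>

definition R\<^sub>0 :: "gf3 \<times> gf3 \<times> gf3 \<times> gf3" where "R\<^sub>0 = (0, 1, -1, 1)"
definition S\<^sub>0 :: "gf3 \<times> gf3 \<times> gf3 \<times> gf3" where "S\<^sub>0 = (0, -1, 1, 1)"

fun mult2 :: "gf3 \<times> gf3 \<times> gf3 \<times> gf3 \<Rightarrow> gf3 \<times> gf3 \<times> gf3 \<times> gf3 \<Rightarrow> gf3 \<times> gf3 \<times> gf3 \<times> gf3" where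
  "mult2 (a, b, c, d) (a', b', c', d') = (a*a' + b*c', a*b' + b*d', c*a' + d*c', c*b' + d*d')"

text \<open>Neither 0 nor 1 is an eigenvalue but \<open>-1\<close> is one. Over \<open>GF(3)\<close> this makes \<open>-1\<close> the only eigenvalue.\<close>

fun minus_unipotent :: "gf3 \<times> gf3 \<times> gf3 \<times> gf3 \<Rightarrow> bool" where
  "minus_unipotent (a, b, c, d) \<longleftrightarrow>
     (\<forall>i j. (i, j) = (0, 0) \<or> (i * a + j * c, i * b + j * d) \<noteq> (0, 0) \<and> (i, j) \<noteq> (i * a + j * c, i * b + j * d)) \<and>
     (\<exists>i j. (i, j) \<noteq> (0, 0) \<and> (i + (i * a + j * c), j + (i * b + j * d)) = (0, 0))"

text \<open>There are 24 admissible pairs. They generate \<open>SL(2,3)\<close>, whose centraliser consists of the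
scalars, so \<open>PGL(2,3)\<close> of order 24 permutes them regularly.\<close>

lemma conjugate_to_representative:
  assumes "in_general_position (fifth_line r s)" "meets_perps (fifth_line r s)"
  shows "\<exists>a b c d. a * d - b * c \<noteq> 0 \<and>
    mult2 (a, b, c, d) r = mult2 R\<^sub>0 (a, b, c, d) \<and> mult2 (a, b, c, d) s = mult2 S\<^sub>0 (a, b, c, d)"
proof -
  \<comment> \<open>The condition on \<open>R\<close> alone leaves few matrices \<open>R\<close>, so that the search for \<open>S\<close> stays small.\<close>
  have check: "\<forall>a b c d. minus_unipotent (a, b, c, d) \<longrightarrow>
     (\<forall>a' b' c' d'. in_general_position (fifth_line (a, b, c, d) (a', b', c', d')) \<and>
         meets_perps (fifth_line (a, b, c, d) (a', b', c', d')) \<longrightarrow>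
        (\<exists>p q r s. p * s - q * r \<noteq> 0 \<and> mult2 (p, q, r, s) (a, b, c, d) = mult2 R\<^sub>0 (p, q, r, s) \<and>
           mult2 (p, q, r, s) (a', b', c', d') = mult2 S\<^sub>0 (p, q, r, s)))"
    unfolding imp_conv_disj by code_simp
  obtain a b c d where r: "r = (a, b, c, d)" by (cases r rule: prod_cases4)
  obtain a' b' c' d' where s: "s = (a', b', c', d')" by (cases s rule: prod_cases4)
  have "minus_unipotent (a, b, c, d)"
    using assms by (simp add: r s comb_def) blast
  then show ?thesis using check assms unfolding r s by blast
qed

fun block_diag :: "gf3 \<times> gf3 \<times> gf3 \<times> gf3 \<Rightarrow> rows" where
  "block_diag (a, b, c, d) =
     ((a, b, 0, 0, 0, 0), (c, d, 0, 0, 0, 0), (0, 0, a, b, 0, 0), (0, 0, c, d, 0, 0), (0, 0, 0, 0, a, b), (0, 0, 0, 0, c, d))"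

definition one_rows :: rows where
  "one_rows = block_diag (1, 0, 0, 1)"

fun rows_mult :: "rows \<Rightarrow> rows \<Rightarrow> rows" where
  "rows_mult (r\<^sub>1, r\<^sub>2, r\<^sub>3, r\<^sub>4, r\<^sub>5, r\<^sub>6) m =
     (row_mult r\<^sub>1 m, row_mult r\<^sub>2 m, row_mult r\<^sub>3 m, row_mult r\<^sub>4 m, row_mult r\<^sub>5 m, row_mult r\<^sub>6 m)"

lemma mat_of_mult: "mat_of m ** mat_of m' = mat_of (rows_mult m m')"
proof (rule matrix_eqI)
  fix v :: vec6
  obtain a b c d e f where v: "v = vec_of (a, b, c, d, e, f)" using vec_of_surj by (metis prod_cases6)
  obtain r1 r2 r3 r4 r5 r6 where m: "m = (r1, r2, r3, r4, r5, r6)" by (cases m rule: prod_cases6)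
  have "v v* mat_of (x1, x2, x3, x4, x5, x6) = a *s vec_of x1 + b *s vec_of x2 + c *s vec_of x3 + d *s vec_of x4
      + e *s vec_of x5 + f *s vec_of x6" for x1 x2 x3 x4 x5 x6
    unfolding v vec_of_mult by (simp add: vec_of_add vec_of_comb add_ac)
  then show "v v* (mat_of m ** mat_of m') = v v* mat_of (rows_mult m m')"
    unfolding m by (simp add: vector_matrix_left_distrib scalar_vector_matrix_assoc vec_of_mult flip: vector_matrix_mul_assoc)
qed

lemma mat_of_one: "mat_of one_rows = mat 1"
  by (simp add: one_rows_def mat_of.simps vec_of.simps vec_eq_iff forall_6 mat_def)

lemma invertible_mat_of:
  assumes "rows_mult m m' = one_rows"
  shows "invertible (mat_of m)"
proof -
  have "mat_of m ** mat_of m' = mat 1" using assms by (simp add: mat_of_mult mat_of_one)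
  then show ?thesis using invertible_right_inverse by blast
qed

text \<open>The matrix \<open>diag(h, h, h)\<close> fixes the four lines of the frame and maps \<open>(I R\<^sub>0 S\<^sub>0)\<close> to
\<open>(h R\<^sub>0h S\<^sub>0h) = (h hR hS)\<close>, which has the same row space as \<open>(I R S)\<close>.\<close>

lemma F5_conjugate:
  assumes "in_general_position (fifth_line r s)" "meets_perps (fifth_line r s)"
  shows "\<exists>t. invertible t \<and> (\<forall>k\<in>set frame. act t (line_of k) = line_of k) \<and> F5 (mat2_of r) (mat2_of s) = act t ` F5 (mat2_of R\<^sub>0) (mat2_of S\<^sub>0)"
proof -
  obtain a b c d where h: "a * d - b * c \<noteq> 0"
      "mult2 (a, b, c, d) r = mult2 R\<^sub>0 (a, b, c, d)" "mult2 (a, b, c, d) s = mult2 S\<^sub>0 (a, b, c, d)"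
    using conjugate_to_representative[OF assms] by blast
  define t where "t = block_diag (a, b, c, d)"
  define k where "k = a * d - b * c"
  have "\<forall>a b c d. a * d - b * c \<noteq> (0::gf3) \<longrightarrow> rows_mult (block_diag (a, b, c, d))
      (block_diag ((a * d - b * c) * d, - (a * d - b * c) * b, - (a * d - b * c) * c, (a * d - b * c) * a)) = one_rows"
    unfolding imp_conv_disj by code_simp
  then have inv: "invertible (mat_of t)"
    using h(1) invertible_mat_of unfolding t_def by blast
  have act_t: "act (mat_of t) (line_of (u, w)) = line_of k"
    if "independent_rows (u, w)" "independent_rows k" "in_line (row_mult u t) k" "in_line (row_mult w t) k" for u w k
  proof (rule dim_2_eqI)
    show "act (mat_of t) (line_of (u, w)) \<in> subspaces_of_dim 2" "line_of k \<in> subspaces_of_dim 2"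
      using that line_of_mem_pg_lines act_subspaces_of_dim[OF inv] unfolding pg_lines_def by blast+
    show "act (mat_of t) (line_of (u, w)) \<subseteq> line_of k"
      unfolding act_line_of using that by (intro line_of_subsetI subspace_line_of) (simp_all add: vec_of_mem_line_of)
  qed
  have ind: "independent_rows ((1, 0, x), (0, 1, y))" for x y
    by (cases x rule: prod_cases4; cases y rule: prod_cases4) (simp add: comb_def zero_row_def)
  have frame: "act (mat_of t) (line_of k) = line_of k" if "k \<in> set frame" for k
  proof -
    have "independent_rows k \<and> in_line (row_mult (fst k) t) k \<and> in_line (row_mult (snd k) t) k"
      using that unfolding frame_def t_def by (auto simp: comb_def zero_row_def)
    then show ?thesis using act_t[of "fst k" "snd k" k] by simp
  qed
  have fifth: "act (mat_of t) (line_of (fifth_line R\<^sub>0 S\<^sub>0)) = line_of (fifth_line r s)"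
  proof -
    obtain p q p' q' where r: "r = (p, q, p', q')" by (cases r rule: prod_cases4)
    obtain x y x' y' where s: "s = (x, y, x', y')" by (cases s rule: prod_cases4)
    show ?thesis using h(2,3) unfolding r s R\<^sub>0_def S\<^sub>0_def fifth_line.simps
      by (intro act_t ind) (auto simp: comb_def t_def)
  qed
  have "act (mat_of t) ` F5 (mat2_of R\<^sub>0) (mat2_of S\<^sub>0) = F5 (mat2_of r) (mat2_of s)"
    unfolding F5_eq by (simp add: image_image frame fifth)
  then show ?thesis using inv frame by metis
qed

section \<open>The stabiliser of the five lines\<close>

definition five_lines :: "basis list" where
  "five_lines = frame @ [fifth_line R\<^sub>0 S\<^sub>0]"

text \<open>An entry \<open>(p, m, b)\<close> consists of a 5-cycle \<open>p\<close> with \<open>p 0 = 1\<close>, given by its list of values, the matrix \<open>m\<close>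
with fifth power 1 that induces \<open>p\<close> on the five lines, and a basis \<open>b\<close> of the space fixed by \<open>m\<close>. The six
cycles represent the six subgroups of order 5 of the symmetric group.\<close>

definition five_cycles :: "(nat list \<times> rows \<times> basis) list" where
  "five_cycles =
    [([1, 2, 3, 4, 0],
      ((0, 0, 1, -1, 0, 0),
       (0, 0, 0, 1, 0, 0),
       (0, 0, 0, 0, 1, 1),
       (0, 0, 0, 0, 1, -1),
       (-1, 0, -1, 0, -1, 0),
       (1, -1, 1, -1, 1, -1)),
      ((1, 0, -1, -1, -1, 0), (0, 1, 0, -1, -1, -1))),
     ([1, 2, 4, 0, 3],
      ((0, 0, 0, 1, 0, 0),
       (0, 0, -1, 0, 0, 0),
       (0, 0, 0, 0, 0, -1),
       (0, 0, 0, 0, 1, -1),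
       (-1, 0, 0, -1, 0, 1),
       (1, -1, 1, 0, -1, 1)),
      ((1, 0, 0, -1, -1, 0), (0, 1, 1, 1, -1, -1))),
     ([1, 3, 0, 4, 2],
      ((0, 0, -1, 1, 0, 0),
       (0, 0, 1, 1, 0, 0),
       (-1, 0, -1, 0, -1, 0),
       (1, -1, 1, -1, 1, -1),
       (0, -1, 0, 0, 0, 0),
       (1, -1, 0, 0, 0, 0)),
      ((1, 0, -1, -1, 0, 1), (0, 1, 0, -1, -1, 1))),
     ([1, 3, 4, 2, 0],
      ((0, 0, 1, 1, 0, 0),
       (0, 0, 0, 1, 0, 0),
       (1, 1, 1, 1, 1, 1),
       (1, -1, 1, -1, 1, -1),
       (-1, -1, 1, 1, -1, 0),
       (-1, 1, -1, 0, 1, -1)),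
      ((1, 0, -1, 0, 0, 1), (0, 1, 1, -1, -1, 1))),
     ([1, 4, 0, 2, 3],
      ((0, 0, -1, -1, 0, 0),
       (0, 0, 1, 0, 0, 0),
       (-1, -1, 1, 1, -1, 0),
       (-1, 1, -1, 0, 1, -1),
       (1, 1, 0, 0, 0, 0),
       (1, -1, 0, 0, 0, 0)),
      ((1, 0, 0, -1, -1, 1), (0, 1, 1, 1, 0, -1))),
     ([1, 4, 3, 0, 2],
      ((0, 0, 0, 1, 0, 0),
       (0, 0, -1, -1, 0, 0),
       (1, 0, 0, 1, 0, -1),
       (-1, 1, -1, 0, 1, -1),
       (0, 1, 0, 1, 0, 1),
       (-1, 1, -1, 1, -1, 1)),
      ((1, 0, -1, 0, -1, 1), (0, 1, 1, -1, 0, -1)))]"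

definition five_line :: "nat \<Rightarrow> vec6 set" where
  "five_line i = line_of (five_lines ! i)"

lemma F5_reference: "F5 (mat2_of R\<^sub>0) (mat2_of S\<^sub>0) = line_of ` set five_lines"
  by (simp add: F5_eq five_lines_def)

lemma length_five_lines: "length five_lines = 5"
  by (simp add: five_lines_def frame_def)

lemma F5_eq_five_line: "F5 (mat2_of R\<^sub>0) (mat2_of S\<^sub>0) = five_line ` {..<5}"
  unfolding F5_reference five_line_def set_conv_nth length_five_lines by auto

lemma five_line_subspace: "vec.subspace (five_line i)"
  by (simp add: five_line_def subspace_line_of)

lemma less_5_iff: "i < 5 \<longleftrightarrow> i \<in> set [0, 1, 2, 3, 4]" for i :: nat
  by auto

lemma five_line_inj: "i < 5 \<Longrightarrow> j < 5 \<Longrightarrow> five_line i = five_line j \<Longrightarrow> i = j"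
proof -
  have check: "\<forall>i\<in>set [0, 1, 2, 3, 4]. \<forall>j\<in>set [0, 1, 2, 3, 4]. i = j \<or>
      in_line (fst (five_lines ! i)) (five_lines ! i) \<and> \<not> in_line (fst (five_lines ! i)) (five_lines ! j)"
    by code_simp
  assume "i < 5" "j < 5" "five_line i = five_line j"
  then show "i = j"
    using check unfolding less_5_iff five_line_def by (metis vec_of_mem_line_of)
qed

text \<open>A matrix fixing the four lines of the frame has the form \<open>diag(h, h, h)\<close>; to fix the fifth line as well,
\<open>h\<close> has to commute with \<open>R\<^sub>0\<close> and \<open>S\<^sub>0\<close>, which leaves only the scalars.\<close>

lemma scalar_of_fixes_five_lines:
  assumes "\<And>i. i < 5 \<Longrightarrow> act g (five_line i) = five_line i"
  shows "\<exists>c. g = mat c"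
proof -
  obtain m where g: "g = mat_of m" using mat_of_surj by blast
  have inl: "in_line (row_mult u m) (u, w) \<and> in_line (row_mult w m) (u, w)" if "(u, w) \<in> set five_lines" for u w
  proof -
    obtain i where "i < 5" "five_line i = line_of (u, w)"
      using \<open>(u, w) \<in> set five_lines\<close> unfolding five_line_def in_set_conv_nth length_five_lines by metis
    then have "line_of (row_mult u m, row_mult w m) = line_of (u, w)"
      using assms[of i] by (simp add: g act_line_of)
    moreover have "vec_of (row_mult u m) \<in> line_of (row_mult u m, row_mult w m)"
        "vec_of (row_mult w m) \<in> line_of (row_mult u m, row_mult w m)"
      by (simp_all add: line_of.simps vec.span_base)
    ultimately show ?thesis by (simp add: vec_of_mem_line_of)
  qed
  obtain r1 r2 r3 r4 r5 r6 where m: "m = (r1, r2, r3, r4, r5, r6)" by (cases m rule: prod_cases6)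
  have [simp]: "row_scale 0 r = zero_row" "row_scale 1 r = r" "row_add zero_row r = r" "row_add r zero_row = r" for r
    by (cases r rule: prod_cases6; simp add: zero_row_def)+
  have m_rows: "in_line r1 (frame ! 0)" "in_line r2 (frame ! 0)" "in_line r3 (frame ! 1)" "in_line r4 (frame ! 1)"
      "in_line r5 (frame ! 2)" "in_line r6 (frame ! 2)"
      "in_line (row_add r1 (row_add r3 r5)) (frame ! 3)" "in_line (row_add r2 (row_add r4 r6)) (frame ! 3)"
    using inl[of "(1, 0, 0, 0, 0, 0)" "(0, 1, 0, 0, 0, 0)"] inl[of "(0, 0, 1, 0, 0, 0)" "(0, 0, 0, 1, 0, 0)"]
      inl[of "(0, 0, 0, 0, 1, 0)" "(0, 0, 0, 0, 0, 1)"] inl[of "(1, 0, 1, 0, 1, 0)" "(0, 1, 0, 1, 0, 1)"]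
    unfolding m by (simp_all add: five_lines_def frame_def comb_def)
  obtain a b c d where m_eq: "m = block_diag (a, b, c, d)"
    using m_rows unfolding m frame_def by (auto simp: comb_def)
  have "\<forall>a b c d. in_line (row_mult (fst (fifth_line R\<^sub>0 S\<^sub>0)) (block_diag (a, b, c, d))) (fifth_line R\<^sub>0 S\<^sub>0) \<and>
      in_line (row_mult (snd (fifth_line R\<^sub>0 S\<^sub>0)) (block_diag (a, b, c, d))) (fifth_line R\<^sub>0 S\<^sub>0)
      \<longrightarrow> b = 0 \<and> c = 0 \<and> a = d"
    unfolding imp_conv_disj by code_simp
  then have abcd: "b = 0" "c = 0" "a = d"
    using inl[of "fst (fifth_line R\<^sub>0 S\<^sub>0)" "snd (fifth_line R\<^sub>0 S\<^sub>0)"] unfolding m_eq by (auto simp: five_lines_def)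
  have "g = mat a"
    unfolding g m_eq abcd by (simp add: mat_of.simps vec_of.simps vec_eq_iff forall_6 mat_def)
  then show ?thesis by blast
qed

lemma five_cycles_perm:
  assumes "(p, m, b) \<in> set five_cycles" "i < 5"
  shows "act (mat_of m) (five_line i) = five_line (p ! i)" and "p ! i < 5"
proof -
  have "\<forall>x\<in>set five_cycles. case x of (p, m, b) \<Rightarrow> \<forall>i\<in>set [0, 1, 2, 3, 4].
      case five_lines ! i of (u, w) \<Rightarrow> 
        independent_rows (row_mult u m, row_mult w m) \<and> independent_rows (five_lines ! (p ! i)) \<and> 
        in_line (row_mult u m) (five_lines ! (p ! i)) \<and> in_line (row_mult w m) (five_lines ! (p ! i)) \<and> p ! i < 5"
    by code_simp
  then have check: "case five_lines ! i of (u, w) \<Rightarrow> 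
        independent_rows (row_mult u m, row_mult w m) \<and> independent_rows (five_lines ! (p ! i)) \<and> 
        in_line (row_mult u m) (five_lines ! (p ! i)) \<and> in_line (row_mult w m) (five_lines ! (p ! i)) \<and> p ! i < 5"
    using assms(2) unfolding less_5_iff by (drule_tac bspec[OF _ assms(1)]) (simp only: prod.case)
  obtain u w where uw: "five_lines ! i = (u, w)" by (cases "five_lines ! i")
  show "act (mat_of m) (five_line i) = five_line (p ! i)"
    using check line_of_eqI unfolding five_line_def uw act_line_of by simp
  show "p ! i < 5" using check uw by simp
qed

lemma five_cycles_power:
  assumes "(p, m, b) \<in> set five_cycles"
  shows "mat_of m ** mat_of m ** mat_of m ** mat_of m ** mat_of m = mat 1"
    and "invertible (mat_of m)"
proof -
  have "\<forall>x\<in>set five_cycles. case x of (p, m, b) \<Rightarrow>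
      rows_mult (rows_mult (rows_mult (rows_mult m m) m) m) m = one_rows"
    by code_simp
  then have check: "rows_mult (rows_mult (rows_mult (rows_mult m m) m) m) m = one_rows"
    by (drule_tac bspec[OF _ assms]) (simp only: prod.case)
  then show *: "mat_of m ** mat_of m ** mat_of m ** mat_of m ** mat_of m = mat 1"
    by (simp add: mat_of_mult mat_of_one)
  then show "invertible (mat_of m)"
    using invertible_left_inverse by blast
qed

lemma five_cycles_fixed_line:
  assumes "(p, m, b) \<in> set five_cycles"
  shows "independent_rows b"
    and "in_line v b \<Longrightarrow> row_mult v m = v"
    and "row_mult v m = v \<Longrightarrow> in_line v b"
proof -
  have "\<forall>x\<in>set five_cycles. case x of (p, m, b) \<Rightarrow> independent_rows b \<and>
      (\<forall>i j. row_mult (comb i (fst b) j (snd b)) m = comb i (fst b) j (snd b))"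
    by code_simp
  then have check: "independent_rows b" "\<And>i j. row_mult (comb i (fst b) j (snd b)) m = comb i (fst b) j (snd b)"
    by (drule_tac bspec[OF _ assms], simp only: prod.case)+
  show "independent_rows b" by (rule check)
  show "row_mult v m = v" if "in_line v b"
    using that check(2) by (cases b rule: prod.exhaust) auto
  have "\<forall>x\<in>set five_cycles. case x of (p, m, b) \<Rightarrow> 
      \<forall>v\<^sub>1 v\<^sub>2 v\<^sub>3 v\<^sub>4 v\<^sub>5 v\<^sub>6. row_mult (v\<^sub>1, v\<^sub>2, v\<^sub>3, v\<^sub>4, v\<^sub>5, v\<^sub>6) m = (v\<^sub>1, v\<^sub>2, v\<^sub>3, v\<^sub>4, v\<^sub>5, v\<^sub>6) \<longrightarrow>
        in_line (v\<^sub>1, v\<^sub>2, v\<^sub>3, v\<^sub>4, v\<^sub>5, v\<^sub>6) b"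
    unfolding imp_conv_disj by code_simp
  then have "\<forall>v\<^sub>1 v\<^sub>2 v\<^sub>3 v\<^sub>4 v\<^sub>5 v\<^sub>6. row_mult (v\<^sub>1, v\<^sub>2, v\<^sub>3, v\<^sub>4, v\<^sub>5, v\<^sub>6) m = (v\<^sub>1, v\<^sub>2, v\<^sub>3, v\<^sub>4, v\<^sub>5, v\<^sub>6) \<longrightarrow>
        in_line (v\<^sub>1, v\<^sub>2, v\<^sub>3, v\<^sub>4, v\<^sub>5, v\<^sub>6) b"
    by (drule_tac bspec[OF _ assms]) (simp only: prod.case)
  then show "in_line v b" if "row_mult v m = v"
    using that by (cases v rule: prod_cases6) blast
qed

text \<open>A permutation whose order divides 5 is trivial or a 5-cycle, and every 5-cycle has a power that maps 0
to 1.\<close>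

lemma five_cycles_represent:
  assumes "\<And>i. i < 5 \<Longrightarrow> \<pi> i < 5" "inj_on \<pi> {..<5}" "\<And>i. i < 5 \<Longrightarrow> (\<pi> ^^ 5) i = i"
  shows "(\<forall>i<5. \<pi> i = i) \<or>
    (\<exists>p m b n. (p, m, b) \<in> set five_cycles \<and> (\<forall>i<5. (\<pi> ^^ n) i = p ! i))"
proof -
  define q where "q = map \<pi> [0, 1, 2, 3, 4]"
  have nth: "q ! i = \<pi> i" if "i < 5" for i
    using that unfolding q_def less_5_iff by auto
  have pow: "((!) q ^^ n) i = (\<pi> ^^ n) i \<and> (\<pi> ^^ n) i < 5" if "i < 5" for n i
    using that by (induction n) (use assms(1) nth in auto)
  have check: "\<forall>a\<in>set [0, 1, 2, 3, 4]. \<forall>b\<in>set [0, 1, 2, 3, 4]. \<forall>c\<in>set [0, 1, 2, 3, 4]. \<forall>d\<in>set [0, 1, 2, 3, 4]. \<forall>e\<in>set [0, 1, 2, 3, 4].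
    distinct [a, b, c, d, e] \<and> (\<forall>i\<in>set [0, 1, 2, 3, 4]. ((!) [a, b, c, d, e] ^^ 5) i = i) \<longrightarrow>
    (\<forall>i\<in>set [0, 1, 2, 3, 4]. [a, b, c, d, e] ! i = i) \<or>
    (\<exists>x\<in>set five_cycles. \<exists>n\<in>set [1, 2, 3, 4]. \<forall>i\<in>set [0, 1, 2, 3, 4]. ((!) [a, b, c, d, e] ^^ n) i = fst x ! i)"
    unfolding imp_conv_disj by code_simp
  have "distinct q"
  proof -
    have "distinct [0, 1, 2, 3, 4 :: nat]" by simp
    moreover have "inj_on \<pi> (set [0, 1, 2, 3, 4])" by (rule inj_on_subset[OF assms(2)]) auto
    ultimately show ?thesis unfolding q_def distinct_map by (rule conjI)
  qed
  moreover have "\<pi> i \<in> set [0, 1, 2, 3, 4]" if "i < 5" for i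
    using assms(1)[OF that] unfolding less_5_iff .
  ultimately have "(\<forall>i\<in>set [0, 1, 2, 3, 4]. q ! i = i) \<or>
    (\<exists>x\<in>set five_cycles. \<exists>n\<in>set [1, 2, 3, 4]. \<forall>i\<in>set [0, 1, 2, 3, 4]. ((!) q ^^ n) i = fst x ! i)"
    using check[rule_format, of "\<pi> 0" "\<pi> 1" "\<pi> 2" "\<pi> 3" "\<pi> 4"] pow assms(3)
    unfolding less_5_iff[symmetric] by (simp add: q_def)
  then show ?thesis
  proof
    assume "\<forall>i\<in>set [0, 1, 2, 3, 4]. q ! i = i"
    then have "\<forall>i<5. \<pi> i = i" unfolding less_5_iff[symmetric] Ball_def using nth by simp
    then show ?thesis ..
  next
    assume "\<exists>x\<in>set five_cycles. \<exists>n\<in>set [1, 2, 3, 4]. \<forall>i\<in>set [0, 1, 2, 3, 4]. ((!) q ^^ n) i = fst x ! i"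
    then obtain x n where x: "x \<in> set five_cycles" and n: "\<forall>i<5. ((!) q ^^ n) i = fst x ! i"
      unfolding less_5_iff[symmetric] Ball_def by blast
    obtain p m b where "x = (p, m, b)" by (rule prod_cases3)
    then have "(p, m, b) \<in> set five_cycles" "\<forall>i<5. (\<pi> ^^ n) i = p ! i"
      using x n pow by simp_all
    then show ?thesis by blast
  qed
qed

text \<open>The restriction of \<open>g\<close> to an invariant line is an element of \<open>GL(2,3)\<close>, whose order 48 is prime to 5.\<close>

lemma order_5_fixes_invariant_line:
  fixes g :: mat6
  assumes g5: "g ** g ** g ** g ** g = mat 1" and l: "l \<in> pg_lines" "act g l = l" and v: "v \<in> l"
  shows "v v* g = v"
proof -
  obtain u w where ind: "independent_pair u w" and uw: "l = vec.span {u, w}"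
    using l dim_2_span_pair unfolding pg_lines_def by metis
  have "u v* g \<in> l" "w v* g \<in> l"
    using l(2) uw unfolding act_def by (metis image_eqI vec.span_base insertI1 insertI2)+
  then obtain a b c d where u: "u v* g = a *s u + b *s w" and w: "w v* g = c *s u + d *s w"
    unfolding uw mem_span_pair by metis
  \<comment> \<open>\<open>A\<close> is the matrix of the restriction of \<open>g\<close> to \<open>l\<close>.\<close>
  define A where "A = (a, b, c, d)"
  have step: "(p *s u + q *s w) v* g = (p * a + q * c) *s u + (p * b + q * d) *s w" for p q
    by (simp add: vector_matrix_left_distrib scalar_vector_matrix_assoc u w algebra_simps)
  have "u v* g v* g v* g v* g v* g = u" "w v* g v* g v* g v* g v* g = w"
    using g5 by (simp_all add: vector_matrix_mul_assoc)
  then have "case mult2 (mult2 (mult2 (mult2 A A) A) A) A of (p, q, r, s) \<Rightarrow> 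
      p *s u + q *s w = u \<and> r *s u + s *s w = w"
    unfolding u w step A_def by (simp add: step)
  then have "mult2 (mult2 (mult2 (mult2 A A) A) A) A = (1, 0, 0, 1)"
  proof (cases "mult2 (mult2 (mult2 (mult2 A A) A) A) A" rule: prod_cases4)
    case (fields p q r s)
    assume *: "case mult2 (mult2 (mult2 (mult2 A A) A) A) A of (p, q, r, s) \<Rightarrow> 
      p *s u + q *s w = u \<and> r *s u + s *s w = w"
    then have "(p - 1) *s u + q *s w = 0" "r *s u + (s - 1) *s w = 0"
      unfolding fields by (simp_all add: algebra_simps)
    then show ?thesis using ind unfolding independent_pair_def fields by fastforce
  qed
  moreover have "\<forall>a b c d. mult2 (mult2 (mult2 (mult2 (a, b, c, d) (a, b, c, d)) (a, b, c, d)) (a, b, c, d)) (a, b, c, d) = (1, 0, 0, 1)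
      \<longrightarrow> (a, b, c, d) = (1, 0, 0, 1 :: gf3)"
    unfolding imp_conv_disj by code_simp
  ultimately have "(a, b, c, d) = (1, 0, 0, 1)" unfolding A_def by blast
  then have "u v* g = u" "w v* g = w" using u w by simp_all
  moreover obtain p q where "v = p *s u + q *s w" using v unfolding uw mem_span_pair by blast
  ultimately show ?thesis by (simp add: vector_matrix_left_distrib scalar_vector_matrix_assoc)
qed

lemma GL6_pow_5: "g [^]\<^bsub>GL6\<^esub> (5::nat) = g ** g ** g ** g ** g"
proof -
  have "(5::nat) = Suc (Suc (Suc (Suc (Suc 0))))" by simp
  then show ?thesis by (simp only: nat_pow_Suc nat_pow_0 GL6_simps matrix_mul_lid)
qed

definition six_lines :: "basis list" where
  "six_lines = map (\<lambda>(p, m, b). b) five_cycles"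

lemma fixed_line_of_five_cycle:
  assumes "(p, m, b) \<in> set five_cycles" "l \<in> pg_lines" "act (mat_of m) l = l"
  shows "l = line_of b"
proof (rule dim_2_eqI)
  show "l \<in> subspaces_of_dim 2" "line_of b \<in> subspaces_of_dim 2"
    using assms line_of_mem_pg_lines five_cycles_fixed_line(1) unfolding pg_lines_def by blast+
  show "l \<subseteq> line_of b"
  proof
    fix v assume "v \<in> l"
    then have "v v* mat_of m = v"
      using order_5_fixes_invariant_line five_cycles_power(1) assms by blast
    moreover obtain x where "v = vec_of x" using vec_of_surj by blast
    ultimately show "v \<in> line_of b"
      using five_cycles_fixed_line(3)[OF assms(1)] by (simp add: vec_of_mult vec_of_eq_iff vec_of_mem_line_of)
  qed
qed

lemma five_cycles_stabilise:
  assumes "(p, m, b) \<in> set five_cycles"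
  shows "act (mat_of m) ` five_line ` {..<5} = five_line ` {..<5}"
proof (rule card_subset_eq)
  show "act (mat_of m) ` five_line ` {..<5} \<subseteq> five_line ` {..<5}"
    using five_cycles_perm[OF assms] by auto
  have "inj (act (mat_of m))"
    using act_eq_iff[OF five_cycles_power(2)[OF assms]] by (rule_tac injI) simp
  then show "card (act (mat_of m) ` five_line ` {..<5}) = card (five_line ` {..<5})"
    by (intro card_image) (auto intro: inj_on_subset)
qed simp

lemma GL6_pow_act: "act (g [^]\<^bsub>GL6\<^esub> (n::nat)) U = (act g ^^ n) U"
proof (induction n)
  case 0
  then show ?case by (simp add: GL6_simps)
next
  case (Suc n)
  then show ?case by (simp add: GL6_simps act_mult)
qed

text \<open>If \<open>g\<close> has projective order 5, it induces a 5-cycle, as otherwise it would be a scalar. Some power of \<open>g\<close>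
agrees on the five lines with a matrix of the list \<open>five_cycles\<close>, and hence differs from it by a scalar.
That matrix has its fixed space as only invariant line.\<close>

theorem F6_reference: "F6 (stabiliser (five_line ` {..<5})) = line_of ` set six_lines"
proof
  have sub: "\<forall>U\<in>five_line ` {..<5}. vec.subspace U" using five_line_subspace by blast
  show "line_of ` set six_lines \<subseteq> F6 (stabiliser (five_line ` {..<5}))"
  proof
    fix l assume "l \<in> line_of ` set six_lines"
    then obtain p m b where x: "(p, m, b) \<in> set five_cycles" and l: "l = line_of b"
      unfolding six_lines_def by auto
    have "projective_order_5 (mat_of m)"
    proof -
      have "act (mat_of m) (five_line 0) \<noteq> five_line 0"
      proof
        assume "act (mat_of m) (five_line 0) = five_line 0"
        then have "p ! 0 = 0" using five_cycles_perm[OF x, of 0] five_line_inj[of "p ! 0" 0] by simp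
        moreover have "\<forall>x\<in>set five_cycles. fst x ! 0 = 1" by code_simp
        ultimately show False using x by fastforce
      qed
      then have "\<nexists>c. mat_of m = mat c"
        using act_scalar[OF five_line_subspace] invertible_mat_nonzero five_cycles_power(2)[OF x] by metis
      then show ?thesis
        unfolding projective_order_5_def GL6_pow_5 using five_cycles_power(1)[OF x] by blast
    qed
    moreover have "act (mat_of m) l = l"
    proof -
      have "v v* mat_of m = v" if "v \<in> l" for v
      proof -
        obtain x where "v = vec_of x" using vec_of_surj by blast
        then show ?thesis using that five_cycles_fixed_line(2)[OF \<open>(p, m, b) \<in> set five_cycles\<close>]
          by (simp add: l vec_of_mult vec_of_mem_line_of)
      qed
      then show ?thesis by (auto simp: act_def image_iff)
    qed
    moreover have "l \<in> pg_lines" using l x five_cycles_fixed_line(1) line_of_mem_pg_lines by blast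
    ultimately show "l \<in> F6 (stabiliser (five_line ` {..<5}))"
      unfolding mem_F6_stabiliser_iff[OF sub]
      using five_cycles_power(2)[OF x] five_cycles_stabilise[OF x] by blast
  qed
  show "F6 (stabiliser (five_line ` {..<5})) \<subseteq> line_of ` set six_lines"
  proof
    fix l assume "l \<in> F6 (stabiliser (five_line ` {..<5}))"
    then obtain g where l: "l \<in> pg_lines" "act g l = l"
        and g: "invertible g" "act g ` five_line ` {..<5} = five_line ` {..<5}" "projective_order_5 g"
      unfolding mem_F6_stabiliser_iff[OF sub] by blast
    have "\<exists>j<5. act g (five_line i) = five_line j" if "i < 5" for i
      using g(2) that by blast
    then obtain \<pi> where \<pi>: "\<And>i. i < 5 \<Longrightarrow> \<pi> i < 5" "\<And>i. i < 5 \<Longrightarrow> act g (five_line i) = five_line (\<pi> i)"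
      by metis
    have inj: "inj_on \<pi> {..<5}"
      using \<pi>(2) act_eq_iff[OF g(1)] five_line_inj by (metis inj_onI lessThan_iff)
    have pow: "act (g [^]\<^bsub>GL6\<^esub> n) (five_line i) = five_line ((\<pi> ^^ n) i) \<and> (\<pi> ^^ n) i < 5" if "i < 5" for n i
      by (induction n) (use \<pi> that in \<open>auto simp: GL6_simps act_mult\<close>)
    obtain c where c: "g [^]\<^bsub>GL6\<^esub> (5::nat) = mat c" using g(3) unfolding projective_order_5_def by blast
    have "c \<noteq> 0" using c invertible_pow[OF g(1), of 5] invertible_mat_nonzero by simp
    have five: "(\<pi> ^^ 5) i = i" if "i < 5" for i
      using pow[OF that, of 5] c act_scalar[OF five_line_subspace \<open>c \<noteq> 0\<close>] five_line_inj[OF _ that] by simp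
    have "\<not> (\<forall>i<5. \<pi> i = i)"
      using scalar_of_fixes_five_lines[of g] \<pi>(2) g(3) unfolding projective_order_5_def by metis
    then obtain p m b n where x: "(p, m, b) \<in> set five_cycles" and n: "\<And>i. i < 5 \<Longrightarrow> (\<pi> ^^ n) i = p ! i"
      using five_cycles_represent[OF \<pi>(1) inj five] by blast
    define h where "h = g [^]\<^bsub>GL6\<^esub> n"
    have h: "invertible h" using invertible_pow[OF g(1)] unfolding h_def .
    note m_inv = five_cycles_power(2)[OF x]
    have "act (h ** matrix_inv (mat_of m)) (five_line i) = five_line i" if "i < 5" for i
    proof -
      have "act h (five_line i) = act (mat_of m) (five_line i)"
        using pow[OF that] n[OF that] five_cycles_perm(1)[OF x that] unfolding h_def by simp
      then show ?thesis using act_inverse(1)[OF m_inv] by (simp add: act_mult)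
    qed
    then obtain d where "h ** matrix_inv (mat_of m) = mat d"
      using scalar_of_fixes_five_lines by blast
    then have hm: "h = mat d ** mat_of m"
      using matrix_inv(2)[OF m_inv] by (metis matrix_mul_assoc matrix_mul_rid)
    have "d \<noteq> 0"
      using \<open>h ** matrix_inv (mat_of m) = mat d\<close> invertible_mat_nonzero
        invertible_mult[OF h invertible_matrix_inv[OF m_inv]] by simp
    have "vec.subspace l" using l(1) by (simp add: pg_lines_def subspaces_of_dim_def)
    \<comment> \<open>Passing from \<open>g\<close> to its power \<open>h\<close> keeps the invariant line \<open>l\<close>.\<close>
    have "(act g ^^ n) l = l" using l(2) by (induction n) simp_all
    then have "act (mat_of m) l = l"
      using hm act_scalar[OF \<open>vec.subspace l\<close> \<open>d \<noteq> 0\<close>] unfolding h_def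
      by (metis GL6_pow_act act_mult)
    then have "l = line_of b" using fixed_line_of_five_cycle[OF x l(1)] by blast
    then show "l \<in> line_of ` set six_lines" using x unfolding six_lines_def by force
  qed
qed

section \<open>The invariant symplectic form\<close>

text \<open>The Gram matrix, up to a factor, of the symplectic form that the stabiliser leaves invariant up to sign.\<close>

definition M_rows :: rows where
  "M_rows =
    ((0, 0, 1, 0, -1, 0),
     (0, 0, 1, 0, 1, 0),
     (-1, -1, 0, 0, 1, 1),
     (0, 0, 0, 0, -1, -1),
     (1, -1, -1, 1, 0, 0),
     (0, 0, -1, 1, 0, 0))"

lemma five_cycles_1_4:
  "(five_cycles ! 1) \<in> set five_cycles" "(five_cycles ! 4) \<in> set five_cycles"
  by (simp_all add: five_cycles_def)

text \<open>The shape of the Gram matrix leaves twelve unknown entries. Two matrices \<open>g\<close> of order 5 provide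
linear equations \<open>g M g\<^sup>T = M\<close>, from which eleven can be chosen in triangular form.\<close>

lemma invariant_form_unique:
  fixes M :: mat6
  assumes skew: "\<And>u v. form M v u = - form M u v"
    and iso: "\<And>i u v. i < 3 \<Longrightarrow> u \<in> five_line i \<Longrightarrow> v \<in> five_line i \<Longrightarrow> form M u v = 0"
    and inv: "\<And>p m b u v. (p, m, b) \<in> set five_cycles \<Longrightarrow> form M (u v* mat_of m) (v v* mat_of m) = form M u v"
  shows "\<exists>c. \<forall>u v. form M u v = c * form (mat_of M_rows) u v"
proof -
  obtain m where M: "M = mat_of m" using mat_of_surj by blast
  obtain x11 x12 x13 x14 x15 x16 x21 x22 x23 x24 x25 x26 x31 x32 x33 x34 x35 x36 x41 x42 x43 x44 x45 x46 x51 x52 x53 x54 x55 x56 x61 x62 x63 x64 x65 x66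
    where "m = ((x11, x12, x13, x14, x15, x16),
      (x21, x22, x23, x24, x25, x26),
      (x31, x32, x33, x34, x35, x36),
      (x41, x42, x43, x44, x45, x46),
      (x51, x52, x53, x54, x55, x56),
      (x61, x62, x63, x64, x65, x66))"
    by (metis prod_cases6)
  note m = this
  have skew': "row_form m v u = - row_form m u v" for u v
    using skew[of "vec_of v" "vec_of u"] by (simp add: M form_mat_of)
  have iso': "row_form m u v = 0" if "i < 3" "in_line u (five_lines ! i)" "in_line v (five_lines ! i)" for i u v
    using iso[OF that(1)] that(2,3) unfolding five_line_def M by (metis form_mat_of vec_of_mem_line_of)
  have inv': "row_form m (row_mult u (fst (snd x))) (row_mult v (fst (snd x))) = row_form m u v" if "x \<in> set five_cycles" for x u v
    using inv[of "fst x" "fst (snd x)" "snd (snd x)" "vec_of u" "vec_of v"] that by (simp add: M form_mat_of vec_of_mult)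
  have diag0: "x11 = 0" "x12 = 0" "x21 = 0" "x22 = 0"
    using iso'[of 0 "(1, 0, 0, 0, 0, 0)" "(1, 0, 0, 0, 0, 0)"] iso'[of 0 "(1, 0, 0, 0, 0, 0)" "(0, 1, 0, 0, 0, 0)"]
      iso'[of 0 "(0, 1, 0, 0, 0, 0)" "(1, 0, 0, 0, 0, 0)"] iso'[of 0 "(0, 1, 0, 0, 0, 0)" "(0, 1, 0, 0, 0, 0)"]
    by (simp_all add: m row_form_def comb_def five_lines_def frame_def)
  have diag1: "x33 = 0" "x34 = 0" "x43 = 0" "x44 = 0"
    using iso'[of 1 "(0, 0, 1, 0, 0, 0)" "(0, 0, 1, 0, 0, 0)"] iso'[of 1 "(0, 0, 1, 0, 0, 0)" "(0, 0, 0, 1, 0, 0)"]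
      iso'[of 1 "(0, 0, 0, 1, 0, 0)" "(0, 0, 1, 0, 0, 0)"] iso'[of 1 "(0, 0, 0, 1, 0, 0)" "(0, 0, 0, 1, 0, 0)"]
    by (simp_all add: m row_form_def comb_def five_lines_def frame_def)
  have diag2: "x55 = 0" "x56 = 0" "x65 = 0" "x66 = 0"
    using iso'[of 2 "(0, 0, 0, 0, 1, 0)" "(0, 0, 0, 0, 1, 0)"] iso'[of 2 "(0, 0, 0, 0, 1, 0)" "(0, 0, 0, 0, 0, 1)"]
      iso'[of 2 "(0, 0, 0, 0, 0, 1)" "(0, 0, 0, 0, 1, 0)"] iso'[of 2 "(0, 0, 0, 0, 0, 1)" "(0, 0, 0, 0, 0, 1)"]
    by (simp_all add: m row_form_def comb_def five_lines_def frame_def)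
  have lower01: "x31 = - x13" "x32 = - x23" "x41 = - x14" "x42 = - x24"
    using skew'[of "(0, 0, 1, 0, 0, 0)" "(1, 0, 0, 0, 0, 0)"]
      skew'[of "(0, 0, 1, 0, 0, 0)" "(0, 1, 0, 0, 0, 0)"]
      skew'[of "(0, 0, 0, 1, 0, 0)" "(1, 0, 0, 0, 0, 0)"]
      skew'[of "(0, 0, 0, 1, 0, 0)" "(0, 1, 0, 0, 0, 0)"]
    by (simp_all add: m row_form_def comb_def)
  have lower02: "x51 = - x15" "x52 = - x25" "x61 = - x16" "x62 = - x26"
    using skew'[of "(0, 0, 0, 0, 1, 0)" "(1, 0, 0, 0, 0, 0)"]
      skew'[of "(0, 0, 0, 0, 1, 0)" "(0, 1, 0, 0, 0, 0)"]
      skew'[of "(0, 0, 0, 0, 0, 1)" "(1, 0, 0, 0, 0, 0)"]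
      skew'[of "(0, 0, 0, 0, 0, 1)" "(0, 1, 0, 0, 0, 0)"]
    by (simp_all add: m row_form_def comb_def)
  have lower12: "x53 = - x35" "x54 = - x45" "x63 = - x36" "x64 = - x46"
    using skew'[of "(0, 0, 0, 0, 1, 0)" "(0, 0, 1, 0, 0, 0)"]
      skew'[of "(0, 0, 0, 0, 1, 0)" "(0, 0, 0, 1, 0, 0)"]
      skew'[of "(0, 0, 0, 0, 0, 1)" "(0, 0, 1, 0, 0, 0)"]
      skew'[of "(0, 0, 0, 0, 0, 1)" "(0, 0, 0, 1, 0, 0)"]
    by (simp_all add: m row_form_def comb_def)
  note entries = diag0 diag1 diag2 lower01 lower02 lower12
  \<comment> \<open>In this order every equation expresses one further entry as a multiple of \<open>x13\<close>.\<close>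
  have e1: "- x46 = x13"
    using inv'[OF five_cycles_1_4(1), of "(1, 0, 0, 0, 0, 0)" "(0, 0, 1, 0, 0, 0)"]
    by (simp add: m row_form_def comb_def five_cycles_def entries algebra_simps)
  have e2: "x13 + x23 - x35 = x23"
    using inv'[OF five_cycles_1_4(2), of "(0, 1, 0, 0, 0, 0)" "(0, 0, 1, 0, 0, 0)"]
    by (simp add: m row_form_def comb_def five_cycles_def entries algebra_simps)
  have e3: "- x16 - x46 = x35"
    using inv'[OF five_cycles_1_4(1), of "(0, 0, 1, 0, 0, 0)" "(0, 0, 0, 0, 1, 0)"]
    by (simp add: m row_form_def comb_def five_cycles_def entries algebra_simps)
  have e4: "x16 - x26 + x36 = x36"
    using inv'[OF five_cycles_1_4(1), of "(0, 0, 1, 0, 0, 0)" "(0, 0, 0, 0, 0, 1)"]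
    by (simp add: m row_form_def comb_def five_cycles_def entries algebra_simps)
  have e5: "x15 - x16 + x45 - x46 = x45"
    using inv'[OF five_cycles_1_4(1), of "(0, 0, 0, 1, 0, 0)" "(0, 0, 0, 0, 1, 0)"]
    by (simp add: m row_form_def comb_def five_cycles_def entries algebra_simps)
  have e6: "x14 + x46 = x15"
    using inv'[OF five_cycles_1_4(1), of "(1, 0, 0, 0, 0, 0)" "(0, 0, 0, 0, 1, 0)"]
    by (simp add: m row_form_def comb_def five_cycles_def entries algebra_simps)
  have e7: "x45 - x46 = x14"
    using inv'[OF five_cycles_1_4(1), of "(1, 0, 0, 0, 0, 0)" "(0, 0, 0, 1, 0, 0)"]
    by (simp add: m row_form_def comb_def five_cycles_def entries algebra_simps)
  have e8: "- x13 + x23 = x26"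
    using inv'[OF five_cycles_1_4(2), of "(0, 1, 0, 0, 0, 0)" "(0, 0, 0, 0, 0, 1)"]
    by (simp add: m row_form_def comb_def five_cycles_def entries algebra_simps)
  have e9: "x36 = x23"
    using inv'[OF five_cycles_1_4(1), of "(0, 1, 0, 0, 0, 0)" "(0, 0, 1, 0, 0, 0)"]
    by (simp add: m row_form_def comb_def five_cycles_def entries algebra_simps)
  have e10: "- x35 + x36 = x24"
    using inv'[OF five_cycles_1_4(1), of "(0, 1, 0, 0, 0, 0)" "(0, 0, 0, 1, 0, 0)"]
    by (simp add: m row_form_def comb_def five_cycles_def entries algebra_simps)
  have e11: "- x13 - x36 = x25"
    using inv'[OF five_cycles_1_4(1), of "(0, 1, 0, 0, 0, 0)" "(0, 0, 0, 0, 1, 0)"]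
    by (simp add: m row_form_def comb_def five_cycles_def entries algebra_simps)
  have "\<forall>x::gf3. - x - x = x" by code_simp
  then have three: "- x - x = x" for x :: gf3 ..
  have s1: "x46 = - x13" using e1 by (metis minus_minus)
  have s2: "x35 = x13" using e2 by simp
  have s3: "x16 = 0" using e3 unfolding s1 s2 by simp
  have s4: "x26 = 0" using e4 unfolding s3 by simp
  have s5: "x15 = - x13" using e5 unfolding s3 s1 by (simp add: eq_neg_iff_add_eq_0)
  have s6: "x14 = 0" using e6 unfolding s1 s5 by simp
  have s7: "x45 = - x13" using e7 unfolding s1 s6 by (simp add: eq_neg_iff_add_eq_0)
  have s8: "x23 = x13" using e8 unfolding s4 by simp
  have s9: "x36 = x13" using e9 unfolding s8 by simp
  have s10: "x24 = 0" using e10 unfolding s2 s9 by simp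
  have s11: "x25 = x13" using e11 unfolding s9 three by simp
  have "row_form m u v = x13 * row_form M_rows u v" for u v
    by (cases u rule: prod_cases6; cases v rule: prod_cases6)
       (simp add: m entries s1 s2 s3 s4 s5 s6 s7 s8 s9 s10 s11 row_form_def comb_def M_rows_def algebra_simps)
  then have "form M u v = x13 * form (mat_of M_rows) u v" for u v
    unfolding M by (metis form_mat_of vec_of_surj)
  then show ?thesis by blast
qed

section \<open>The fifteen points\<close>

text \<open>An entry \<open>((i, j), k, b)\<close> describes the solid spanned by lines \<open>i\<close> and \<open>j\<close> of \<open>six_lines\<close>: \<open>k\<close> is a pair of
linear equations for it and \<open>b\<close> a basis of the line of \<open>\<F>\<^sub>1\<^sub>5\<close> that it contains.\<close>

definition point_table :: "((nat \<times> nat) \<times> (row \<times> row) \<times> basis) list" where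
  "point_table =
    [((0, 1), ((1, 1, 0, 0, 1, 0), (0, 1, 0, 0, 0, 1)),
       ((1, 0, 0, 0, -1, 0), (0, 1, 0, 0, -1, -1))),
     ((0, 2), ((1, 0, 1, 0, 0, 0), (1, 1, 0, 1, 0, 0)),
       ((1, 0, -1, -1, 1, 0), (0, 1, 0, -1, 0, 1))),
     ((0, 3), ((0, 0, 0, -1, 1, 0), (0, 0, 1, -1, 0, 1)),
       ((1, 0, 1, 0, 0, -1), (0, 1, 0, 1, 1, 1))),
     ((0, 4), ((-1, -1, 0, 1, 1, 0), (1, 0, -1, -1, 0, 1)),
       ((1, 0, 0, 1, 0, 0), (0, 1, -1, 1, 0, 0))),
     ((0, 5), ((0, 1, -1, 0, 1, 0), (-1, 0, 0, -1, 0, 1)),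
       ((0, 0, 1, 0, 1, 0), (0, 0, 0, 1, 0, 1))),
     ((1, 2), ((-1, -1, 1, 1, 1, 0), (-1, 1, 1, -1, 0, 1)),
       ((1, 0, 1, 0, 0, 0), (0, 1, 0, 1, 0, 0))),
     ((1, 3), ((1, 0, 1, 0, 1, 0), (1, 1, -1, 1, 0, 1)),
       ((0, 0, 1, 0, -1, 1), (0, 0, 0, 1, 0, -1))),
     ((1, 4), ((0, -1, 1, 0, 0, 0), (1, -1, 0, 1, 0, 0)),
       ((1, 0, 0, -1, 0, -1), (0, 1, 1, 1, 1, 1))),
     ((1, 5), ((0, 0, -1, -1, 1, 0), (0, 0, 1, 0, 0, 1)),
       ((1, 0, 0, 1, 1, 0), (0, 1, -1, 1, 0, 1))),
     ((2, 3), ((0, 1, 0, 0, 1, 0), (-1, -1, 0, 0, 0, 1)),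
       ((1, 0, 0, 1, 0, 1), (0, 1, -1, 1, -1, 1))),
     ((2, 4), ((0, 0, 1, -1, 1, 0), (0, 0, 0, 1, 0, 1)),
       ((0, 0, 1, 0, -1, 0), (0, 0, 0, 1, 1, -1))),
     ((2, 5), ((0, -1, -1, 1, 1, 0), (1, -1, -1, 0, 0, 1)),
       ((1, 0, 0, 0, 0, -1), (0, 1, 0, 0, 1, 1))),
     ((3, 4), ((-1, 0, -1, 1, 1, 0), (0, -1, 1, 1, 0, 1)),
       ((1, 0, 0, 0, 1, 0), (0, 1, 0, 0, 0, 1))),
     ((3, 5), ((1, -1, 1, 0, 0, 0), (0, 1, 0, 1, 0, 0)),
       ((1, 0, -1, 0, 0, 0), (0, 1, 1, -1, 0, 0))),
     ((4, 5), ((1, 0, 0, 0, 1, 0), (-1, 1, 0, 0, 0, 1)),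
       ((1, 0, 1, 0, -1, 1), (0, 1, 0, 1, 0, -1)))]"

text \<open>The linear equations of the six subspaces \<open>m\<^sup>\<perp>\<close>.\<close>

definition perp_table :: "(row \<times> row) list" where
  "perp_table =
    [((0, -1, -1, -1, -1, 0), (-1, 1, 0, 1, -1, 1)),
     ((-1, 1, -1, -1, 0, 1), (1, 0, 0, 1, 1, 0)),
     ((1, 1, 0, 1, -1, 0), (-1, 1, 1, 0, -1, 1)),
     ((1, 1, 0, 1, 1, -1), (1, 0, 1, 0, 0, -1)),
     ((-1, 1, 1, 0, 0, 1), (-1, -1, -1, -1, 1, 0)),
     ((0, -1, 1, 0, 1, -1), (-1, -1, -1, -1, 0, -1))]"

fun in_null_space :: "row \<Rightarrow> row \<times> row \<Rightarrow> bool" where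
  "in_null_space v (f, g) \<longleftrightarrow> dot f v = 0 \<and> dot g v = 0"

definition null_space :: "row \<times> row \<Rightarrow> vec6 set" where
  "null_space k = {vec_of v | v. in_null_space v k}"

lemma vec_of_mem_null_space: "vec_of v \<in> null_space k \<longleftrightarrow> in_null_space v k"
  by (simp add: null_space_def vec_of_eq_iff del: split_paired_Ex)

lemma dot_add: "dot f (row_add u v) = dot f u + dot f v"
  by (cases f rule: prod_cases6; cases u rule: prod_cases6; cases v rule: prod_cases6) (simp add: algebra_simps)

lemma dot_scale: "dot f (row_scale c u) = c * dot f u"
  by (cases f rule: prod_cases6; cases u rule: prod_cases6) (simp add: algebra_simps)

lemma dot_zero: "dot f zero_row = 0"
  by (cases f rule: prod_cases6) (simp add: zero_row_def)

lemma in_null_space_closed: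
  "in_null_space zero_row k"
  "in_null_space u k \<Longrightarrow> in_null_space v k \<Longrightarrow> in_null_space (row_add u v) k"
  "in_null_space u k \<Longrightarrow> in_null_space (row_scale c u) k"
  by (cases k rule: prod.exhaust; simp add: dot_zero dot_add dot_scale)+

lemma subspace_null_space: "vec.subspace (null_space k)"
  unfolding vec.subspace_def
proof (intro conjI ballI allI)
  show "0 \<in> null_space k"
    using vec_of_mem_null_space[of zero_row k] by (simp add: vec_of_zero in_null_space_closed)
next
  fix u v assume "u \<in> null_space k" "v \<in> null_space k"
  then obtain x y where "u = vec_of x" "v = vec_of y" "in_null_space x k" "in_null_space y k"
    unfolding null_space_def by blast
  then show "u + v \<in> null_space k"
    using vec_of_mem_null_space[of "row_add x y" k] by (simp add: vec_of_add in_null_space_closed)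
next
  fix c u assume "u \<in> null_space k"
  then obtain x where "u = vec_of x" "in_null_space x k"
    unfolding null_space_def by blast
  then show "c *s u \<in> null_space k"
    using vec_of_mem_null_space[of "row_scale c x" k] by (simp add: vec_of_scale in_null_space_closed)
qed

lemma mem_perp_line_of_iff:
  "vec_of v \<in> perp (mat_of m) (line_of l) \<longleftrightarrow> in_null_space v (row_mult (fst l) m, row_mult (snd l) m)"
  by (cases l rule: prod.exhaust) (simp add: mem_perp_line_of row_form_def)

text \<open>The bases in \<open>six_lines\<close> begin with identity blocks. So in a sum of vectors of two of these lines the first
two coordinates determine the coefficients of the second vector from those of the first.\<close>

fun in_solid :: "row \<Rightarrow> basis \<Rightarrow> basis \<Rightarrow> bool" where
  "in_solid (v\<^sub>1, v\<^sub>2, v\<^sub>3, v\<^sub>4, v\<^sub>5, v\<^sub>6) (u, w) (u', w') \<longleftrightarrow>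
     (\<exists>a b. (v\<^sub>1, v\<^sub>2, v\<^sub>3, v\<^sub>4, v\<^sub>5, v\<^sub>6) = row_add (comb a u b w) (comb (v\<^sub>1 - a) u' (v\<^sub>2 - b) w'))"

lemma in_solid_mem_join:
  assumes "in_solid v k l"
  shows "vec_of v \<in> join (line_of k) (line_of l)"
proof -
  obtain u w u' w' where kl: "k = (u, w)" "l = (u', w')" by (metis prod.exhaust)
  obtain v\<^sub>1 v\<^sub>2 v\<^sub>3 v\<^sub>4 v\<^sub>5 v\<^sub>6 where v: "v = (v\<^sub>1, v\<^sub>2, v\<^sub>3, v\<^sub>4, v\<^sub>5, v\<^sub>6)" by (rule prod_cases6)
  obtain a b where "v = row_add (comb a u b w) (comb (v\<^sub>1 - a) u' (v\<^sub>2 - b) w')"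
    using assms unfolding kl v in_solid.simps by blast
  then have "vec_of v = vec_of (comb a u b w) + vec_of (comb (v\<^sub>1 - a) u' (v\<^sub>2 - b) w')"
    by (simp only: vec_of_add)
  moreover have "vec_of (comb a u b w) \<in> line_of k" "vec_of (comb (v\<^sub>1 - a) u' (v\<^sub>2 - b) w') \<in> line_of l"
    unfolding kl vec_of_mem_line_of in_line.simps by blast+
  ultimately show ?thesis by (simp add: mem_joinI)
qed

lemma point_table_bases:
  "\<forall>x\<in>set point_table. case x of ((i, j), k, b) \<Rightarrow> i < j \<and> j < 6 \<and>
     in_null_space (fst (six_lines ! i)) k \<and> in_null_space (snd (six_lines ! i)) k \<and>
     in_null_space (fst (six_lines ! j)) k \<and> in_null_space (snd (six_lines ! j)) k \<and>
     in_null_space (fst b) k \<and> in_null_space (snd b) k \<and> independent_rows b"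
  by code_simp

lemma point_table_null_space_in_solid:
  "\<forall>x\<in>set point_table. case x of ((i, j), k, b) \<Rightarrow>
     \<forall>v\<^sub>1 v\<^sub>2 v\<^sub>3 v\<^sub>4 v\<^sub>5 v\<^sub>6. in_null_space (v\<^sub>1, v\<^sub>2, v\<^sub>3, v\<^sub>4, v\<^sub>5, v\<^sub>6) k \<longrightarrow>
       in_solid (v\<^sub>1, v\<^sub>2, v\<^sub>3, v\<^sub>4, v\<^sub>5, v\<^sub>6) (six_lines ! i) (six_lines ! j)"
  unfolding imp_conv_disj by code_simp

lemma perp_table_eq: "perp_table = map (\<lambda>(u, w). (row_mult u M_rows, row_mult w M_rows)) six_lines"
  by code_simp

definition in_some_perp :: "row \<Rightarrow> bool" where
  "in_some_perp v \<longleftrightarrow> (\<exists>p\<in>set perp_table. in_null_space v p)"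

definition in_other_solid :: "nat \<times> nat \<Rightarrow> row \<Rightarrow> bool" where
  "in_other_solid ij v \<longleftrightarrow> (\<exists>y\<in>set point_table. fst y \<noteq> ij \<and> in_null_space v (fst (snd y)))"

definition inadmissible_or_in_line :: "nat \<times> nat \<Rightarrow> basis \<Rightarrow> row \<Rightarrow> bool" where
  "inadmissible_or_in_line ij b v \<longleftrightarrow> v = zero_row \<or> in_other_solid ij v \<or> in_some_perp v \<or> in_line v b"

definition zero_or_admissible :: "nat \<times> nat \<Rightarrow> row \<Rightarrow> bool" where
  "zero_or_admissible ij v \<longleftrightarrow> v = zero_row \<or> \<not> in_other_solid ij v \<and> \<not> in_some_perp v"

text \<open>No nonzero vector of a solid outside the tabulated line is admissible: it lies in another solid or in
some \<open>m\<^sup>\<perp>\<close>.\<close>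

lemma point_table_complete:
  "\<forall>x\<in>set point_table. case x of ((i, j), k, b) \<Rightarrow> \<forall>c\<^sub>1 c\<^sub>2 c\<^sub>3 c\<^sub>4.
     inadmissible_or_in_line (i, j) b
       (row_add (comb c\<^sub>1 (fst (six_lines ! i)) c\<^sub>2 (snd (six_lines ! i)))
          (comb c\<^sub>3 (fst (six_lines ! j)) c\<^sub>4 (snd (six_lines ! j))))"
  by code_simp

lemma point_table_admissible:
  "\<forall>x\<in>set point_table. case x of ((i, j), k, b) \<Rightarrow>
     \<forall>c\<^sub>1 c\<^sub>2. zero_or_admissible (i, j) (comb c\<^sub>1 (fst b) c\<^sub>2 (snd b))"
  by code_simp

abbreviation M\<^sub>1 :: mat6 where "M\<^sub>1 \<equiv> mat_of M_rows"

lemma length_six_lines: "length six_lines = 6"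
  by (simp add: six_lines_def five_cycles_def)

lemma join_commute: "join U V = join V U"
  by (simp add: join_def Un_commute)

lemma mem_join_iff:
  assumes "vec.subspace U" "vec.subspace V"
  shows "v \<in> join U V \<longleftrightarrow> (\<exists>x\<in>U. \<exists>y\<in>V. v = x + y)"
proof -
  have "vec.span U = U" "vec.span V = V" using assms by simp_all
  then show ?thesis unfolding join_def vec.span_Un by blast
qed

lemma line_of_subset_null_space:
  assumes "in_null_space (fst l) k" "in_null_space (snd l) k"
  shows "line_of l \<subseteq> null_space k"
  using line_of_subsetI[OF subspace_null_space, of "fst l" k "snd l"] assms
  by (simp add: vec_of_mem_null_space)

lemma point_table_entry:
  assumes "((i, j), k, b) \<in> set point_table"
  shows "i < j" "j < 6" "join (line_of (six_lines ! i)) (line_of (six_lines ! j)) = null_space k"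
    "line_of b \<subseteq> null_space k" "line_of b \<in> pg_lines"
proof -
  have *: "i < j \<and> j < 6 \<and>
     in_null_space (fst (six_lines ! i)) k \<and> in_null_space (snd (six_lines ! i)) k \<and>
     in_null_space (fst (six_lines ! j)) k \<and> in_null_space (snd (six_lines ! j)) k \<and>
     in_null_space (fst b) k \<and> in_null_space (snd b) k \<and> independent_rows b"
    using bspec[OF point_table_bases assms] by (simp only: prod.case)
  then show "i < j" "j < 6" "line_of b \<subseteq> null_space k" "line_of b \<in> pg_lines"
    using line_of_subset_null_space line_of_mem_pg_lines by blast+
  show "join (line_of (six_lines ! i)) (line_of (six_lines ! j)) = null_space k"
  proof
    show "join (line_of (six_lines ! i)) (line_of (six_lines ! j)) \<subseteq> null_space k"
      unfolding join_def using * line_of_subset_null_space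
      by (intro vec.span_minimal subspace_null_space Un_least) blast+
    show "null_space k \<subseteq> join (line_of (six_lines ! i)) (line_of (six_lines ! j))"
    proof
      fix v assume v: "v \<in> null_space k"
      obtain x where x: "v = vec_of x" using vec_of_surj by blast
      obtain x\<^sub>1 x\<^sub>2 x\<^sub>3 x\<^sub>4 x\<^sub>5 x\<^sub>6 where x': "x = (x\<^sub>1, x\<^sub>2, x\<^sub>3, x\<^sub>4, x\<^sub>5, x\<^sub>6)" by (rule prod_cases6)
      have "in_solid x (six_lines ! i) (six_lines ! j)"
        using bspec[OF point_table_null_space_in_solid assms] v unfolding x x' vec_of_mem_null_space prod.case by blast
      then show "v \<in> join (line_of (six_lines ! i)) (line_of (six_lines ! j))"
        unfolding x by (rule in_solid_mem_join)
    qed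
  qed
qed

lemma mem_perp_six_lines:
  assumes "s \<in> set six_lines"
  obtains p where "p \<in> set perp_table" "\<And>v. vec_of v \<in> perp M\<^sub>1 (line_of s) \<longleftrightarrow> in_null_space v p"
proof
  show "(row_mult (fst s) M_rows, row_mult (snd s) M_rows) \<in> set perp_table"
    using assms unfolding perp_table_eq by (force simp: case_prod_beta)
qed (rule mem_perp_line_of_iff)

lemma mem_perp_table:
  assumes "p \<in> set perp_table"
  obtains s where "s \<in> set six_lines" "\<And>v. vec_of v \<in> perp M\<^sub>1 (line_of s) \<longleftrightarrow> in_null_space v p"
proof -
  obtain s where "s \<in> set six_lines" "p = (row_mult (fst s) M_rows, row_mult (snd s) M_rows)"
    using assms unfolding perp_table_eq by (auto simp: case_prod_beta simp del: split_paired_Ex)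
  then show ?thesis using that mem_perp_line_of_iff by blast
qed

lemma independent_rows_fst:
  assumes "independent_rows b"
  shows "in_line (fst b) b" "fst b \<noteq> zero_row"
proof -
  obtain u w where b: "b = (u, w)" by (rule prod.exhaust)
  have one: "comb 1 u 0 w = u"
    by (cases u rule: prod_cases6; cases w rule: prod_cases6) (simp add: comb_def)
  show "in_line (fst b) b" unfolding b in_line.simps fst_conv using one by metis
  show "fst b \<noteq> zero_row" using assms one unfolding b independent_rows.simps fst_conv by (metis one_neq_zero)
qed

lemma point_table_vector:
  assumes "((i, j), k, b) \<in> set point_table" "in_line v b" "v \<noteq> zero_row"
  shows "p \<in> set perp_table \<Longrightarrow> \<not> in_null_space v p"
    and "((i', j'), k', b') \<in> set point_table \<Longrightarrow> (i', j') \<noteq> (i, j) \<Longrightarrow> \<not> in_null_space v k'"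
proof -
  obtain c\<^sub>1 c\<^sub>2 where v: "v = comb c\<^sub>1 (fst b) c\<^sub>2 (snd b)"
    using assms(2) by (cases b rule: prod.exhaust) (auto simp del: split_paired_Ex)
  have *: "(\<forall>p\<in>set perp_table. \<not> in_null_space v p) \<and> (\<forall>y\<in>set point_table. fst y = (i, j) \<or> \<not> in_null_space v (fst (snd y)))"
    using bspec[OF point_table_admissible assms(1)] assms(3)
    unfolding v prod.case zero_or_admissible_def in_other_solid_def in_some_perp_def by blast
  show "\<not> in_null_space v p" if "p \<in> set perp_table" using * that by blast
  show "\<not> in_null_space v k'" if "((i', j'), k', b') \<in> set point_table" "(i', j') \<noteq> (i, j)"
    using bspec[OF conjunct2[OF *] that(1)] that(2) by auto
qed

text \<open>Different pairs of the six lines span different solids: a nonzero vector of the tabulated line in one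
solid lies in none of the others.\<close>

lemma null_space_distinct:
  assumes "((i, j), k, b) \<in> set point_table" "((i', j'), k', b') \<in> set point_table"
  shows "null_space k = null_space k' \<longleftrightarrow> (i, j) = (i', j')"
proof
  assume "(i, j) = (i', j')"
  then show "null_space k = null_space k'" using point_table_entry(3)[OF assms(1)] point_table_entry(3)[OF assms(2)] by simp
next
  assume eq: "null_space k = null_space k'"
  show "(i, j) = (i', j')"
  proof (rule ccontr)
    assume neq: "(i, j) \<noteq> (i', j')"
    have "independent_rows b"
      using bspec[OF point_table_bases assms(1)] by (simp only: prod.case)
    then have "in_line (fst b) b" "fst b \<noteq> zero_row"
      using independent_rows_fst by blast+
    note b = this
    have "\<not> in_null_space (fst b) k'"
      by (rule point_table_vector(2)[OF assms(1) b assms(2)]) (use neq in auto)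
    moreover have "vec_of (fst b) \<in> null_space k'"
      using point_table_entry(4)[OF assms(1)] b(1) unfolding vec_of_mem_line_of[symmetric] eq by blast
    ultimately show False unfolding vec_of_mem_null_space by contradiction
  qed
qed

lemma joins_six_lines:
  "a \<in> joins (line_of ` set six_lines) \<longleftrightarrow> (\<exists>i j k b. ((i, j), k, b) \<in> set point_table \<and> a = null_space k)"
proof
  assume "a \<in> joins (line_of ` set six_lines)"
  then obtain s t where st: "s \<in> set six_lines" "t \<in> set six_lines" "line_of s \<noteq> line_of t" "a = join (line_of s) (line_of t)"
    unfolding joins_def by blast
  then obtain i j where ij: "i < 6" "s = six_lines ! i" "j < 6" "t = six_lines ! j"
    unfolding in_set_conv_nth length_six_lines by metis
  have "i \<noteq> j" using st ij by blast
  have entry: "\<exists>k b. ((i, j), k, b) \<in> set point_table" if "i < j" "j < 6" for i j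
  proof -
    have "\<forall>j\<in>set [0, 1, 2, 3, 4, 5]. \<forall>i\<in>set [0, 1, 2, 3, 4, 5]. i < j \<longrightarrow> (i, j) \<in> fst ` set point_table"
      by code_simp
    moreover have "i \<in> set [0, 1, 2, 3, 4, 5]" "j \<in> set [0, 1, 2, 3, 4, 5]" using that by auto
    ultimately have "(i, j) \<in> fst ` set point_table" using that by blast
    then show ?thesis by force
  qed
  consider "i < j" | "j < i" using \<open>i \<noteq> j\<close> by linarith
  then show "\<exists>i j k b. ((i, j), k, b) \<in> set point_table \<and> a = null_space k"
  proof cases
    case 1
    then show ?thesis using entry[of i j] point_table_entry(3) ij st(4) by metis
  next
    case 2
    then show ?thesis using entry[of j i] point_table_entry(3) ij st(4) join_commute by metis
  qed
next
  assume "\<exists>i j k b. ((i, j), k, b) \<in> set point_table \<and> a = null_space k"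
  then obtain i j k b where x: "((i, j), k, b) \<in> set point_table" and a: "a = null_space k" by blast
  have "i < 6" "j < 6" using point_table_entry(1,2)[OF x] by auto
  have "\<forall>i\<in>set [0, 1, 2, 3, 4, 5]. \<forall>j\<in>set [0, 1, 2, 3, 4, 5]. i = j \<or> \<not> in_line (fst (six_lines ! i)) (six_lines ! j)"
    by code_simp
  moreover have "i \<in> set [0, 1, 2, 3, 4, 5]" "j \<in> set [0, 1, 2, 3, 4, 5]" "i \<noteq> j" using point_table_entry(1,2)[OF x] by auto
  ultimately have "vec_of (fst (six_lines ! i)) \<notin> line_of (six_lines ! j)"
    unfolding vec_of_mem_line_of by blast
  moreover have "vec_of (fst (six_lines ! i)) \<in> line_of (six_lines ! i)"
    by (cases "six_lines ! i" rule: prod.exhaust) (simp add: line_of.simps vec.span_base)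
  ultimately have "line_of (six_lines ! i) \<noteq> line_of (six_lines ! j)" by metis
  moreover have "six_lines ! i \<in> set six_lines" "six_lines ! j \<in> set six_lines"
    using \<open>i < 6\<close> \<open>j < 6\<close> length_six_lines by simp_all
  ultimately show "a \<in> joins (line_of ` set six_lines)"
    unfolding joins_def a point_table_entry(3)[OF x, symmetric] by blast
qed

lemma point_table_mem_F15:
  assumes x: "((i, j), k, b) \<in> set point_table"
  shows "line_of b \<in> F15 M\<^sub>1 (line_of ` set six_lines)"
proof -
  have zero: "v = 0" if "v \<in> line_of b" "p \<in> set perp_table \<and> v \<in> null_space p \<or> 
      ((i', j'), k', b') \<in> set point_table \<and> (i', j') \<noteq> (i, j) \<and> v \<in> null_space k'" for v p i' j' k' b'
  proof -
    obtain r where r: "v = vec_of r" using vec_of_surj by blast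
    have "r = zero_row"
      using that point_table_vector[OF x, of r] unfolding r vec_of_mem_null_space vec_of_mem_line_of by blast
    then show ?thesis unfolding r by (simp add: vec_of_zero)
  qed
  have "opposite M\<^sub>1 (line_of b) m" if m: "m \<in> line_of ` set six_lines" for m
  proof -
    obtain s where s: "s \<in> set six_lines" "m = line_of s" using m by blast
    obtain p where p: "p \<in> set perp_table" "\<And>v. vec_of v \<in> perp M\<^sub>1 (line_of s) \<longleftrightarrow> in_null_space v p"
      using mem_perp_six_lines[OF s(1)] by blast
    have "perp M\<^sub>1 m \<subseteq> null_space p"
      using p(2) vec_of_surj unfolding s(2) by (metis subsetI vec_of_mem_null_space)
    then show ?thesis unfolding opposite_def using zero p(1) by (intro pg_disjointI) blast
  qed
  moreover have "pg_disjoint (line_of b) a" if a: "a \<in> joins (line_of ` set six_lines)" "a \<noteq> null_space k" for a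
  proof -
    obtain i' j' k' b' where y: "((i', j'), k', b') \<in> set point_table" "a = null_space k'"
      using a(1) unfolding joins_six_lines by blast
    then have "(i', j') \<noteq> (i, j)" using null_space_distinct[OF x y(1)] a(2) by auto
    then show ?thesis unfolding y(2) using zero y(1) by (intro pg_disjointI) blast
  qed
  moreover have "null_space k \<in> joins (line_of ` set six_lines)" using x unfolding joins_six_lines by blast
  ultimately show ?thesis unfolding F15_def using point_table_entry(4,5)[OF x] by blast
qed

theorem F15_reference: "F15 M\<^sub>1 (line_of ` set six_lines) = (\<lambda>x. line_of (snd (snd x))) ` set point_table"
proof
  show "(\<lambda>x. line_of (snd (snd x))) ` set point_table \<subseteq> F15 M\<^sub>1 (line_of ` set six_lines)"
  proof
    fix l assume "l \<in> (\<lambda>x. line_of (snd (snd x))) ` set point_table"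
    then obtain x where "x \<in> set point_table" "l = line_of (snd (snd x))" by blast
    then show "l \<in> F15 M\<^sub>1 (line_of ` set six_lines)"
      using point_table_mem_F15[of "fst (fst x)" "snd (fst x)" "fst (snd x)" "snd (snd x)"] by simp
  qed
  show "F15 M\<^sub>1 (line_of ` set six_lines) \<subseteq> (\<lambda>x. line_of (snd (snd x))) ` set point_table"
  proof
    fix l assume "l \<in> F15 M\<^sub>1 (line_of ` set six_lines)"
    then have l: "l \<in> pg_lines" and "\<exists>a\<in>joins (line_of ` set six_lines). l \<subseteq> a \<and>
        (\<forall>m\<in>line_of ` set six_lines. opposite M\<^sub>1 l m) \<and>
        (\<forall>c\<in>joins (line_of ` set six_lines). c \<noteq> a \<longrightarrow> pg_disjoint l c)"
      unfolding F15_def mem_Collect_eq by simp_all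
    then obtain a where a: "a \<in> joins (line_of ` set six_lines)" and la: "l \<subseteq> a"
      and opp: "\<forall>m\<in>line_of ` set six_lines. opposite M\<^sub>1 l m"
      and disj: "\<forall>c\<in>joins (line_of ` set six_lines). c \<noteq> a \<longrightarrow> pg_disjoint l c"
      by (elim bexE conjE)
    obtain i j k b where x: "((i, j), k, b) \<in> set point_table" and a_eq: "a = null_space k"
      using a unfolding joins_six_lines by blast
    have sub_l: "vec.subspace l" using l by (simp add: pg_lines_def subspaces_of_dim_def)
    have "l \<subseteq> line_of b"
    proof
      fix v assume v: "v \<in> l"
      then have "v \<in> join (line_of (six_lines ! i)) (line_of (six_lines ! j))"
        using la point_table_entry(3)[OF x] a_eq by blast
      then obtain y z where yz: "y \<in> line_of (six_lines ! i)" "z \<in> line_of (six_lines ! j)" "v = y + z"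
        unfolding mem_join_iff[OF subspace_line_of subspace_line_of] by blast
      obtain c\<^sub>1 c\<^sub>2 where y: "y = vec_of (comb c\<^sub>1 (fst (six_lines ! i)) c\<^sub>2 (snd (six_lines ! i)))"
        using mem_line_ofE[of y "fst (six_lines ! i)" "snd (six_lines ! i)"] yz(1) by auto
      obtain c\<^sub>3 c\<^sub>4 where z: "z = vec_of (comb c\<^sub>3 (fst (six_lines ! j)) c\<^sub>4 (snd (six_lines ! j)))"
        using mem_line_ofE[of z "fst (six_lines ! j)" "snd (six_lines ! j)"] yz(2) by auto
      define r where "r = row_add (comb c\<^sub>1 (fst (six_lines ! i)) c\<^sub>2 (snd (six_lines ! i)))
          (comb c\<^sub>3 (fst (six_lines ! j)) c\<^sub>4 (snd (six_lines ! j)))"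
      have v_eq: "v = vec_of r" unfolding yz(3) y z r_def vec_of_add ..
      have "r = zero_row \<or> (\<exists>p\<in>set perp_table. in_null_space r p) \<or>
         (\<exists>y\<in>set point_table. fst y \<noteq> (i, j) \<and> in_null_space r (fst (snd y))) \<or> in_line r b"
        using bspec[OF point_table_complete x]
        unfolding prod.case r_def inadmissible_or_in_line_def in_other_solid_def in_some_perp_def by blast
      then have "v = 0 \<or> in_line r b"
      proof (elim disjE bexE conjE)
        fix p assume p: "p \<in> set perp_table" "in_null_space r p"
        obtain s where s: "s \<in> set six_lines" "\<And>v. vec_of v \<in> perp M\<^sub>1 (line_of s) \<longleftrightarrow> in_null_space v p"
          using mem_perp_table[OF p(1)] by blast
        have "pg_disjoint l (perp M\<^sub>1 (line_of s))" using opp s(1) unfolding opposite_def by blast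
        then show ?thesis using pg_disjointD[OF _ sub_l perp_subspace v] s(2) p(2) v_eq by blast
      next
        fix y assume y: "y \<in> set point_table" "fst y \<noteq> (i, j)" "in_null_space r (fst (snd y))"
        obtain i' j' k' b' where y': "y = ((i', j'), k', b')" by (metis prod.exhaust)
        have "null_space k' \<noteq> a" using null_space_distinct[OF x, of i' j' k' b'] y unfolding y' a_eq by auto
        moreover have "null_space k' \<in> joins (line_of ` set six_lines)" using y(1) unfolding joins_six_lines y' by blast
        ultimately have "pg_disjoint l (null_space k')" using disj by blast
        then show ?thesis using pg_disjointD[OF _ sub_l subspace_null_space v] y(3) unfolding y' v_eq vec_of_mem_null_space by simp
      qed (simp_all add: v_eq vec_of_zero)
      then show "v \<in> line_of b"
        using vec.subspace_0[OF subspace_line_of] vec_of_mem_line_of v_eq by blast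
    qed
    then have "l = line_of b"
      using dim_2_eqI l point_table_entry(5)[OF x] unfolding pg_lines_def by blast
    then show "l \<in> (\<lambda>x. line_of (snd (snd x))) ` set point_table" using x by force
  qed
qed

section \<open>Coordinates for the symplectic quadrangle\<close>

text \<open>Both structures are labelled by the same index sets. As points and lines are separated by their
incidences, all four labellings are automatically injective.\<close>

lemma isomorphic_by_labelling:
  assumes points: "Points A = f ` I" "Points B = f' ` I" and lines: "Lines A = g ` J" "Lines B = g' ` J"
    and inc: "\<And>i j. i \<in> I \<Longrightarrow> j \<in> J \<Longrightarrow> Inc A (f i) (g j) \<longleftrightarrow> K i j"
      "\<And>i j. i \<in> I \<Longrightarrow> j \<in> J \<Longrightarrow> Inc B (f' i) (g' j) \<longleftrightarrow> K i j"
    and sep: "\<And>i i'. i \<in> I \<Longrightarrow> i' \<in> I \<Longrightarrow> (\<And>j. j \<in> J \<Longrightarrow> K i j \<longleftrightarrow> K i' j) \<Longrightarrow> i = i'"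
      "\<And>j j'. j \<in> J \<Longrightarrow> j' \<in> J \<Longrightarrow> (\<And>i. i \<in> I \<Longrightarrow> K i j \<longleftrightarrow> K i j') \<Longrightarrow> j = j'"
  shows "isomorphic A B"
proof -
  have inj: "inj_on f I" "inj_on f' I"
    using inc sep(1) by (metis inj_onI)+
  have inj': "inj_on g J" "inj_on g' J"
    using inc sep(2) by (metis inj_onI)+
  have "bij_betw (f' \<circ> inv_into I f) (Points A) (Points B)"
    unfolding points by (rule bij_betw_trans[OF bij_betw_inv_into]) (simp_all add: bij_betw_def inj)
  moreover have "bij_betw (g' \<circ> inv_into J g) (Lines A) (Lines B)"
    unfolding lines by (rule bij_betw_trans[OF bij_betw_inv_into]) (simp_all add: bij_betw_def inj')
  moreover have "\<forall>p\<in>Points A. \<forall>l\<in>Lines A. Inc A p l \<longleftrightarrow> Inc B ((f' \<circ> inv_into I f) p) ((g' \<circ> inv_into J g) l)"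
    unfolding points lines using inc inj(1) inj'(1) by simp
  ultimately show ?thesis unfolding isomorphic_def by blast
qed

type_synonym quad = "gf2 \<times> gf2 \<times> gf2 \<times> gf2"

text \<open>The points and lines of \<open>W(2)\<close> in an order that matches \<open>point_table\<close> and \<open>structure_line\<close>. A line is given
by two of its three points.\<close>

definition w_points :: "quad list" where
  "w_points =
    [(0, 0, 0, 1), (1, 0, 0, 0), (1, 0, 1, 1), (1, 1, 0, 1), (1, 1, 1, 1),
     (1, 0, 0, 1), (1, 0, 1, 0), (1, 1, 0, 0), (1, 1, 1, 0), (0, 0, 1, 1),
     (0, 1, 0, 1), (0, 1, 1, 1), (0, 1, 1, 0), (0, 1, 0, 0), (0, 0, 1, 0)]"

definition w_lines :: "(quad \<times> quad) list" where
  "w_lines =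
    [((1, 0, 1, 1), (1, 1, 1, 0)), ((0, 0, 0, 1), (0, 0, 1, 1)), ((1, 0, 0, 0), (1, 1, 0, 0)),
     ((1, 1, 0, 1), (1, 0, 1, 0)), ((1, 1, 1, 1), (1, 0, 0, 1)), ((1, 1, 0, 1), (1, 0, 0, 1)),
     ((0, 0, 0, 1), (0, 1, 1, 1)), ((1, 1, 1, 1), (1, 1, 0, 0)), ((1, 0, 0, 0), (1, 0, 1, 0)),
     ((1, 1, 1, 1), (1, 0, 1, 0)), ((1, 0, 0, 0), (1, 1, 1, 0)), ((1, 0, 1, 1), (1, 1, 0, 0)),
     ((1, 0, 1, 1), (1, 0, 0, 1)), ((1, 1, 0, 1), (1, 1, 1, 0)), ((0, 0, 0, 1), (0, 1, 0, 1))]"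

text \<open>For each pair of the five lines, two vectors perpendicular to the solid that they span. They serve to show
that a point is not contained in the double perp of that solid.\<close>

definition pair_table :: "((nat \<times> nat) \<times> basis) list" where
  "pair_table =
    [((0, 1), ((1, -1, 0, 0, 0, 0), (0, 0, 0, 1, 0, 0))),
     ((0, 2), ((1, 1, 0, 0, 0, 0), (0, 0, 0, 0, 0, 1))),
     ((0, 3), ((1, 0, 0, 0, 0, 0), (0, 1, 0, 1, 0, 1))),
     ((0, 4), ((1, 0, 0, 1, 0, -1), (0, 1, 0, 0, 0, 0))),
     ((1, 2), ((0, 0, 1, 1, 0, 0), (0, 0, 0, 0, 1, -1))),
     ((1, 3), ((1, -1, 0, -1, 1, -1), (0, 0, 1, 0, 0, 0))),
     ((1, 4), ((1, -1, 0, 1, -1, 1), (0, 0, 1, -1, 0, 0))),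
     ((2, 3), ((1, 1, 1, 1, 0, 1), (0, 0, 0, 0, 1, 0))),
     ((2, 4), ((1, 1, -1, -1, 0, -1), (0, 0, 0, 0, 1, 1))),
     ((3, 4), ((1, 0, 1, 0, 1, 0), (0, 1, -1, 1, 1, 1)))]"

fun quad_vec :: "quad \<Rightarrow> gf2 ^ 4" where
  "quad_vec (a, b, c, d) = vector [a, b, c, d]"

lemma vector_4:
  "(vector [a, b, c, d] :: 'a::zero ^ 4) $ 1 = a" "(vector [a, b, c, d] :: 'a::zero ^ 4) $ 2 = b"
  "(vector [a, b, c, d] :: 'a::zero ^ 4) $ 3 = c" "(vector [a, b, c, d] :: 'a::zero ^ 4) $ 4 = d"
  unfolding vector_def by simp_all

fun quad_comb :: "gf2 \<Rightarrow> quad \<Rightarrow> gf2 \<Rightarrow> quad \<Rightarrow> quad" where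
  "quad_comb k (a, b, c, d) l (a', b', c', d') = (k * a + l * a', k * b + l * b', k * c + l * c', k * d + l * d')"

fun quad_form :: "quad \<Rightarrow> quad \<Rightarrow> gf2" where
  "quad_form (a, b, c, d) (a', b', c', d') = a * d' + b * c' + c * b' + d * a'"

lemma quad_vec_comb: "quad_vec (quad_comb k x l y) = k *s quad_vec x + l *s quad_vec y"
  by (cases x rule: prod_cases4; cases y rule: prod_cases4) (simp add: vec_eq_iff forall_4 vector_4)

lemma quad_vec_eq_iff: "quad_vec x = quad_vec y \<longleftrightarrow> x = y"
  by (cases x rule: prod_cases4; cases y rule: prod_cases4) (simp add: vec_eq_iff forall_4 vector_4)

lemma quad_vec_surj: obtains x where "v = quad_vec x"
proof
  show "v = quad_vec (v $ 1, v $ 2, v $ 3, v $ 4)" by (simp add: vec_eq_iff forall_4 vector_4)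
qed

lemma quad_vec_zero: "quad_vec (0, 0, 0, 0) = 0"
  by (simp add: vec_eq_iff forall_4 vector_4)

lemma form_W2_gram: "form W2_gram (quad_vec x) (quad_vec y) = quad_form x y"
  by (cases x rule: prod_cases4; cases y rule: prod_cases4)
     (simp add: form_def vector_matrix_mult_def W2_gram_def sum_4 vector_4 algebra_simps)

declare quad_vec.simps [simp del]

definition quad_line :: "quad \<times> quad \<Rightarrow> (gf2 ^ 4) set" where
  "quad_line l = vec.span {quad_vec (fst l), quad_vec (snd l)}"

definition in_quad_line :: "quad \<Rightarrow> quad \<times> quad \<Rightarrow> bool" where
  "in_quad_line z l \<longleftrightarrow> (\<exists>a b. z = quad_comb a (fst l) b (snd l))"

definition independent_quads :: "quad \<times> quad \<Rightarrow> bool" where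
  "independent_quads l \<longleftrightarrow> (\<forall>a b. quad_comb a (fst l) b (snd l) = (0, 0, 0, 0) \<longrightarrow> a = 0 \<and> b = 0)"

lemma quad_vec_mem_quad_line: "quad_vec z \<in> quad_line l \<longleftrightarrow> in_quad_line z l"
  unfolding quad_line_def in_quad_line_def mem_span_pair quad_vec_comb[symmetric] quad_vec_eq_iff ..

lemma independent_pair_quads: "independent_pair (quad_vec x) (quad_vec y) \<longleftrightarrow> independent_quads (x, y)"
  unfolding independent_pair_def independent_quads_def fst_conv snd_conv
  by (simp only: quad_vec_comb[symmetric] quad_vec_zero[symmetric] quad_vec_eq_iff)

lemma quad_line_dim_2: "independent_quads l \<Longrightarrow> quad_line l \<in> subspaces_of_dim 2"
  unfolding quad_line_def by (rule span_pair_dim_2) (simp add: independent_pair_quads)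

lemma ball_upto_15: "(\<forall>n<15. P n) \<longleftrightarrow> (\<forall>n\<in>set [0..<15]. P n)"
  by (simp add: Ball_def)

lemma Points_W2: "Points W2 = (\<lambda>n. quad_vec (w_points ! n)) ` {..<15}"
proof -
  have check: "\<forall>a b c d. (a, b, c, d) \<in> set w_points \<longleftrightarrow> (a, b, c, d) \<noteq> (0, 0, 0, 0)" by code_simp
  have "v \<noteq> 0 \<longleftrightarrow> v \<in> quad_vec ` set w_points" for v
  proof -
    obtain x where v: "v = quad_vec x" using quad_vec_surj by blast
    have "v \<noteq> 0 \<longleftrightarrow> x \<noteq> (0, 0, 0, 0)" unfolding v quad_vec_zero[symmetric] quad_vec_eq_iff ..
    also have "\<dots> \<longleftrightarrow> x \<in> set w_points" using check by (cases x rule: prod_cases4) blast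
    also have "\<dots> \<longleftrightarrow> v \<in> quad_vec ` set w_points"
      unfolding v by (rule inj_image_mem_iff[symmetric], rule injI) (simp add: quad_vec_eq_iff)
    finally show ?thesis .
  qed
  then have "Points W2 = quad_vec ` set w_points" by (auto simp: W2_def)
  moreover have "length w_points = 15" by (simp add: w_points_def)
  then have "set w_points = (!) w_points ` {..<15}" unfolding set_conv_nth by auto
  ultimately show ?thesis by (simp add: image_image)
qed

lemma Lines_W2: "Lines W2 = (\<lambda>n. quad_line (w_lines ! n)) ` {..<15}"
proof -
  have dims: "quad_line l \<in> subspaces_of_dim 2" "totally_isotropic W2_gram (quad_line l)" if "l \<in> set w_lines" for l
  proof -
    have "\<forall>l\<in>set w_lines. independent_quads l \<and> quad_form (fst l) (fst l) = 0 \<and> quad_form (fst l) (snd l) = 0 \<and>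
        quad_form (snd l) (fst l) = 0 \<and> quad_form (snd l) (snd l) = 0"
      unfolding independent_quads_def imp_conv_disj by code_simp
    then have *: "independent_quads l" "quad_form (fst l) (fst l) = 0" "quad_form (fst l) (snd l) = 0"
        "quad_form (snd l) (fst l) = 0" "quad_form (snd l) (snd l) = 0" using that by blast+
    show "quad_line l \<in> subspaces_of_dim 2" using quad_line_dim_2 *(1) .
    show "totally_isotropic W2_gram (quad_line l)"
      unfolding totally_isotropic_def quad_line_def mem_span_pair Ball_def
      using *(2-5) by (auto simp: form_add_left form_add_right form_scale_left form_scale_right form_W2_gram simp del: split_paired_Ex split_paired_All)
  qed
  have "U \<in> quad_line ` set w_lines" if U: "U \<in> subspaces_of_dim 2" "totally_isotropic W2_gram U" for U
  proof -
    obtain u w where "independent_pair u w" "U = vec.span {u, w}" using dim_2_span_pair[OF U(1)] by blast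
    moreover obtain x y where "u = quad_vec x" "w = quad_vec y" using quad_vec_surj by metis
    ultimately have ind: "independent_quads (x, y)" and U_eq: "U = vec.span {quad_vec x, quad_vec y}"
      by (simp_all add: independent_pair_quads)
    have "form W2_gram (quad_vec x) (quad_vec y) = 0"
      using U(2) unfolding U_eq totally_isotropic_def by (simp add: vec.span_base)
    then have xy: "quad_form x y = 0" by (simp add: form_W2_gram)
    have check: "\<forall>a b c d a' b' c' d'. quad_form (a, b, c, d) (a', b', c', d') = 0 \<longrightarrow>
      independent_quads ((a, b, c, d), (a', b', c', d')) \<longrightarrow>
      (\<exists>l\<in>set w_lines. in_quad_line (a, b, c, d) l \<and> in_quad_line (a', b', c', d') l)"
      unfolding independent_quads_def imp_conv_disj by code_simp
    obtain a b c d where x: "x = (a, b, c, d)" by (rule prod_cases4)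
    obtain a' b' c' d' where y: "y = (a', b', c', d')" by (rule prod_cases4)
    obtain l where l: "l \<in> set w_lines" "in_quad_line x l" "in_quad_line y l"
      using check ind xy unfolding x y by blast
    have "U \<subseteq> quad_line l"
      unfolding U_eq using l(2,3) by (intro vec.span_minimal) (simp_all add: quad_vec_mem_quad_line, simp add: quad_line_def)
    then have "U = quad_line l" using dim_2_eqI U(1) dims(1)[OF l(1)] by blast
    then show ?thesis using l(1) by blast
  qed
  then have "Lines W2 = quad_line ` set w_lines" using dims by (auto simp: W2_def simp del: split_paired_Ex split_paired_All)
  moreover have "length w_lines = 15" by (simp add: w_lines_def)
  then have "set w_lines = (!) w_lines ` {..<15}" unfolding set_conv_nth by auto
  ultimately show ?thesis by (simp add: image_image)
qed

text \<open>The common incidence relation: label \<open>n\<close> denotes a point, and label \<open>m\<close> a line, of type (i) if \<open>m < 5\<close> and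
of type (ii) otherwise.\<close>

definition incident :: "nat \<Rightarrow> nat \<Rightarrow> bool" where
  "incident n m \<longleftrightarrow> in_quad_line (w_points ! n) (w_lines ! m)"

lemma incidence_separates_points:
  assumes "n < 15" "n' < 15" "\<And>m. m < 15 \<Longrightarrow> incident n m \<longleftrightarrow> incident n' m"
  shows "n = n'"
proof -
  have "\<forall>n<15. \<forall>n'<15. n = n' \<or> (\<exists>m\<in>set [0..<15]. incident n m \<noteq> incident n' m)"
    unfolding ball_upto_15 by code_simp
  then have "n = n' \<or> (\<exists>m\<in>set [0..<15]. incident n m \<noteq> incident n' m)"
    using assms(1,2) by blast
  moreover have "incident n m = incident n' m" if "m \<in> set [0..<15]" for m
    using that assms(3) by simp
  ultimately show ?thesis by blast
qed

lemma incidence_separates_lines: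
  assumes "m < 15" "m' < 15" "\<And>n. n < 15 \<Longrightarrow> incident n m \<longleftrightarrow> incident n m'"
  shows "m = m'"
proof -
  have "\<forall>m<15. \<forall>m'<15. m = m' \<or> (\<exists>n\<in>set [0..<15]. incident n m \<noteq> incident n m')"
    unfolding ball_upto_15 by code_simp
  then have "m = m' \<or> (\<exists>n\<in>set [0..<15]. incident n m \<noteq> incident n m')"
    using assms(1,2) by blast
  moreover have "incident n m = incident n m'" if "n \<in> set [0..<15]" for n
    using that assms(3) by simp
  ultimately show ?thesis by blast
qed

section \<open>Incidences\<close>

lemma form_M_rows_skew: "form M\<^sub>1 v u = - form M\<^sub>1 u v"
proof -
  have skew: "row_form M_rows y x = - row_form M_rows x y" for x y
    by (cases x rule: prod_cases6; cases y rule: prod_cases6) (simp add: row_form_def M_rows_def comb_def algebra_simps)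
  obtain x y where "u = vec_of x" "v = vec_of y" using vec_of_surj by metis
  then show ?thesis by (simp only: form_mat_of) (rule skew)
qed

definition structure_point :: "nat \<Rightarrow> vec6 set" where
  "structure_point n = line_of (snd (snd (point_table ! n)))"

definition pair_of :: "nat \<Rightarrow> nat \<times> nat" where
  "pair_of m = fst (pair_table ! (m - 5))"

definition structure_line :: "nat \<Rightarrow> vec6 set + vec6 set" where
  "structure_line m = (if m < 5 then Inl (five_line m) else Inr (perp M\<^sub>1 (join (five_line (fst (pair_of m))) (five_line (snd (pair_of m))))))"

definition meets_only_in_zero :: "basis \<Rightarrow> row \<times> row \<Rightarrow> bool" where
  "meets_only_in_zero b k \<longleftrightarrow> (\<forall>c\<^sub>1 c\<^sub>2. comb c\<^sub>1 (fst b) c\<^sub>2 (snd b) = zero_row \<or> \<not> in_null_space (comb c\<^sub>1 (fst b) c\<^sub>2 (snd b)) k)"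

lemma pg_disjoint_perp_iff:
  "pg_disjoint (line_of b) (perp M\<^sub>1 (line_of l)) \<longleftrightarrow> meets_only_in_zero b (row_mult (fst l) M_rows, row_mult (snd l) M_rows)"
    (is "?D \<longleftrightarrow> meets_only_in_zero b ?k")
proof
  assume D: ?D
  show "meets_only_in_zero b ?k"
    unfolding meets_only_in_zero_def disj_not2
  proof (intro allI impI)
    fix c\<^sub>1 c\<^sub>2 assume k: "in_null_space (comb c\<^sub>1 (fst b) c\<^sub>2 (snd b)) ?k"
    have "vec_of (comb c\<^sub>1 (fst b) c\<^sub>2 (snd b)) \<in> line_of b"
      unfolding vec_of_mem_line_of by (cases b rule: prod.exhaust) (auto simp del: split_paired_Ex)
    moreover have "vec_of (comb c\<^sub>1 (fst b) c\<^sub>2 (snd b)) \<in> perp M\<^sub>1 (line_of l)"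
      using k unfolding mem_perp_line_of_iff .
    ultimately show "comb c\<^sub>1 (fst b) c\<^sub>2 (snd b) = zero_row"
      using pg_disjointD[OF D subspace_line_of perp_subspace] vec_of_eq_0_iff by blast
  qed
next
  assume Z: "meets_only_in_zero b ?k"
  show ?D
  proof (rule pg_disjointI)
    fix v assume v: "v \<in> line_of b" "v \<in> perp M\<^sub>1 (line_of l)"
    obtain c\<^sub>1 c\<^sub>2 where v_eq: "v = vec_of (comb c\<^sub>1 (fst b) c\<^sub>2 (snd b))"
      using mem_line_ofE[of v "fst b" "snd b"] v(1) by auto
    show "v = 0"
      using Z v(2) unfolding v_eq mem_perp_line_of_iff meets_only_in_zero_def vec_of_eq_0_iff by blast
  qed
qed

lemma incidence_type_i:
  assumes "n < 15" "m < 5"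
  shows "pg_disjoint (structure_point n) (perp M\<^sub>1 (five_line m)) \<longleftrightarrow> incident n m"
proof -
  have "\<forall>n\<in>set [0..<15]. \<forall>m\<in>set [0..<5]. meets_only_in_zero (snd (snd (point_table ! n)))
      (row_mult (fst (five_lines ! m)) M_rows, row_mult (snd (five_lines ! m)) M_rows) = incident n m"
    by code_simp
  moreover have "n \<in> set [0..<15]" "m \<in> set [0..<5]" using assms by auto
  ultimately show ?thesis
    unfolding structure_point_def five_line_def pg_disjoint_perp_iff by blast
qed

definition in_sum :: "row \<Rightarrow> basis \<Rightarrow> basis \<Rightarrow> bool" where
  "in_sum v k l \<longleftrightarrow> (\<exists>a b c d. v = row_add (comb a (fst k) b (snd k)) (comb c (fst l) d (snd l)))"

lemma in_sum_mem_join: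
  assumes "in_sum v k l" shows "vec_of v \<in> join (line_of k) (line_of l)"
proof -
  obtain a b c d where "v = row_add (comb a (fst k) b (snd k)) (comb c (fst l) d (snd l))"
    using assms unfolding in_sum_def by blast
  then have "vec_of v = vec_of (comb a (fst k) b (snd k)) + vec_of (comb c (fst l) d (snd l))"
    by (simp only: vec_of_add)
  moreover have "vec_of (comb a (fst k) b (snd k)) \<in> line_of k" for a b k
    unfolding vec_of_mem_line_of by (cases k rule: prod.exhaust) (auto simp del: split_paired_Ex)
  ultimately show ?thesis by (simp add: mem_joinI)
qed

lemma subset_double_perp:
  "U \<subseteq> perp M\<^sub>1 (perp M\<^sub>1 U)"
proof
  fix v assume v: "v \<in> U"
  show "v \<in> perp M\<^sub>1 (perp M\<^sub>1 U)"
    unfolding perp_def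
  proof (intro CollectI ballI)
    fix w assume "w \<in> {w. \<forall>u\<in>U. form M\<^sub>1 u w = 0}"
    then have "form M\<^sub>1 v w = 0" using v by blast
    then show "form M\<^sub>1 w v = 0" using form_M_rows_skew[of w v] by simp
  qed
qed

lemma mem_perp_join:
  assumes "vec_of y \<in> perp (mat_of m) (line_of k)" "vec_of y \<in> perp (mat_of m) (line_of l)"
  shows "vec_of y \<in> perp (mat_of m) (join (line_of k) (line_of l))"
  unfolding perp_def
proof (intro CollectI ballI)
  fix u assume "u \<in> join (line_of k) (line_of l)"
  then obtain a b where "a \<in> line_of k" "b \<in> line_of l" "u = a + b"
    unfolding mem_join_iff[OF subspace_line_of subspace_line_of] by blast
  then show "form (mat_of m) u (vec_of y) = 0"
    using assms unfolding perp_def by (simp add: form_add_left)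
qed

text \<open>If a point is contained in the solid, it is contained in the double perp; otherwise a vector of the
perp, taken from \<open>pair_table\<close>, is not perpendicular to it. Thus the double perp need not be computed.\<close>

lemma incidence_type_ii:
  assumes "n < 15" "5 \<le> m" "m < 15"
  shows "structure_point n \<subseteq> perp M\<^sub>1 (perp M\<^sub>1 (join (five_line (fst (pair_of m))) (five_line (snd (pair_of m))))) \<longleftrightarrow> incident n m"
proof -
  define b where "b = snd (snd (point_table ! n))"
  define i j where "i = fst (pair_of m)" and "j = snd (pair_of m)"
  define d where "d = snd (pair_table ! (m - 5))"
  note m_simps = b_def i_def j_def d_def
  let ?J = "join (line_of (five_lines ! i)) (line_of (five_lines ! j))"
  have mem: "n \<in> set [0..<15]" "m \<in> set [5..<15]"
    using assms by (simp_all only: set_upt atLeastLessThan_iff le0 simp_thms)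
  have "\<forall>m\<in>set [5..<15]. \<forall>y\<in>set [fst (snd (pair_table ! (m - 5))), snd (snd (pair_table ! (m - 5)))].
      \<forall>i\<in>set [fst (pair_of m), snd (pair_of m)].
         row_form M_rows (fst (five_lines ! i)) y = 0 \<and> row_form M_rows (snd (five_lines ! i)) y = 0"
    by code_simp
  then have "\<forall>y\<in>set [fst d, snd d]. \<forall>i\<in>set [i, j]. row_form M_rows (fst (five_lines ! i)) y = 0 \<and> row_form M_rows (snd (five_lines ! i)) y = 0"
    using mem(2) unfolding m_simps by blast
  then have dual: "vec_of y \<in> perp M\<^sub>1 ?J" if "y = fst d \<or> y = snd d" for y
    using that by (intro mem_perp_join) (auto simp: mem_perp_line_of_iff row_form_def)
  have "\<forall>n\<in>set [0..<15]. \<forall>m\<in>set [5..<15]. if incident n m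
     then in_sum (fst (snd (snd (point_table ! n)))) (five_lines ! (fst (pair_of m))) (five_lines ! (snd (pair_of m))) \<and>
       in_sum (snd (snd (snd (point_table ! n)))) (five_lines ! (fst (pair_of m))) (five_lines ! (snd (pair_of m)))
     else \<exists>y\<in>set [fst (snd (pair_table ! (m - 5))), snd (snd (pair_table ! (m - 5)))].
       \<exists>z\<in>set [fst (snd (snd (point_table ! n))), snd (snd (snd (point_table ! n)))]. row_form M_rows y z \<noteq> 0"
    by code_simp
  then have check: "if incident n m
     then in_sum (fst b) (five_lines ! i) (five_lines ! j) \<and> in_sum (snd b) (five_lines ! i) (five_lines ! j)
     else \<exists>y\<in>set [fst d, snd d]. \<exists>z\<in>set [fst b, snd b]. row_form M_rows y z \<noteq> 0"
    using mem unfolding m_simps by blast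
  have "line_of b \<subseteq> perp M\<^sub>1 (perp M\<^sub>1 ?J) \<longleftrightarrow> incident n m"
  proof (cases "incident n m")
    case True
    then have "line_of b \<subseteq> ?J"
      using check line_of_subsetI[OF subspace_join, of "fst b" _ _ "snd b"] in_sum_mem_join by simp
    then show ?thesis using True subset_double_perp by blast
  next
    case False
    then obtain y z where "y \<in> set [fst d, snd d]" "z \<in> set [fst b, snd b]" "row_form M_rows y z \<noteq> 0"
      using check unfolding if_not_P[OF False] by blast
    then have yz: "y = fst d \<or> y = snd d" "z = fst b \<or> z = snd b" "row_form M_rows y z \<noteq> 0"
      by simp_all
    have "vec_of z \<in> line_of b"
      using yz(2) by (cases b rule: prod.exhaust) (auto simp: line_of.simps vec.span_base)
    moreover have "vec_of z \<notin> perp M\<^sub>1 (perp M\<^sub>1 ?J)"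
      using dual[OF yz(1)] yz(3) unfolding perp_def by (auto simp: form_mat_of)
    ultimately show ?thesis using False by blast
  qed
  then show ?thesis unfolding structure_point_def five_line_def m_simps .
qed

lemma joins_five_line: "joins (five_line ` {..<5}) = (\<lambda>m. join (five_line (fst (pair_of m))) (five_line (snd (pair_of m)))) ` {5..<15}"
proof -
  have "\<forall>i\<in>set [0..<5]. \<forall>j\<in>set [0..<5]. i < j \<longrightarrow> (\<exists>m\<in>set [5..<15]. pair_of m = (i, j))"
    by code_simp
  note check = this[unfolded set_upt]
  have "\<forall>m\<in>set [5..<15]. fst (pair_of m) < snd (pair_of m) \<and> snd (pair_of m) < 5"
    by code_simp
  note check2 = this[unfolded set_upt]
  show ?thesis
  proof
    show "joins (five_line ` {..<5}) \<subseteq> (\<lambda>m. join (five_line (fst (pair_of m))) (five_line (snd (pair_of m)))) ` {5..<15}"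
    proof
      fix a assume "a \<in> joins (five_line ` {..<5})"
      then obtain i j where ij: "i < 5" "j < 5" "five_line i \<noteq> five_line j" "a = join (five_line i) (five_line j)"
        unfolding joins_def by auto
      have range: "i \<in> {0..<5}" "j \<in> {0..<5}" using ij by simp_all
      have "i \<noteq> j" using ij by blast
      then consider "i < j" | "j < i" by linarith
      then show "a \<in> (\<lambda>m. join (five_line (fst (pair_of m))) (five_line (snd (pair_of m)))) ` {5..<15}"
      proof cases
        case 1
        then obtain m where "m \<in> {5..<15}" "pair_of m = (i, j)" using check range by blast
        then show ?thesis using ij(4) by (intro image_eqI[of _ _ m]) simp_all
      next
        case 2
        then obtain m where "m \<in> {5..<15}" "pair_of m = (j, i)" using check range by blast
        then show ?thesis using ij(4) join_commute by (intro image_eqI[of _ _ m]) auto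
      qed
    qed
    show "(\<lambda>m. join (five_line (fst (pair_of m))) (five_line (snd (pair_of m)))) ` {5..<15} \<subseteq> joins (five_line ` {..<5})"
    proof
      fix a assume "a \<in> (\<lambda>m. join (five_line (fst (pair_of m))) (five_line (snd (pair_of m)))) ` {5..<15}"
      then obtain m where m: "m \<in> {5..<15}" "a = join (five_line (fst (pair_of m))) (five_line (snd (pair_of m)))" by auto
      then have "fst (pair_of m) < snd (pair_of m)" "snd (pair_of m) < 5" using check2 by blast+
      then have "five_line (fst (pair_of m)) \<noteq> five_line (snd (pair_of m))"
        "five_line (fst (pair_of m)) \<in> five_line ` {..<5}" "five_line (snd (pair_of m)) \<in> five_line ` {..<5}" using five_line_inj[of "fst (pair_of m)" "snd (pair_of m)"] by auto
      then show "a \<in> joins (five_line ` {..<5})"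
        unfolding joins_def m(2) by blast
    qed
  qed
qed

theorem reference_structure_isomorphic_W2:
  "isomorphic (mathon_structure M\<^sub>1 (F15 M\<^sub>1 (line_of ` set six_lines)) (five_line ` {..<5}) (F10 M\<^sub>1 (five_line ` {..<5}))) W2"
proof (rule isomorphic_by_labelling[where I = "{..<15}" and J = "{..<15}" and K = incident
      and f = structure_point and g = structure_line and f' = "\<lambda>n. quad_vec (w_points ! n)" and g' = "\<lambda>n. quad_line (w_lines ! n)"])
  have "length point_table = 15" by (simp add: point_table_def)
  then have "set point_table = (!) point_table ` {..<15}" unfolding set_conv_nth by auto
  then show "Points (mathon_structure M\<^sub>1 (F15 M\<^sub>1 (line_of ` set six_lines)) (five_line ` {..<5}) (F10 M\<^sub>1 (five_line ` {..<5}))) = structure_point ` {..<15}"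
    by (simp add: mathon_structure_def F15_reference image_image structure_point_def)
  have split: "{..<15::nat} = {..<5} \<union> {5..<15}" by auto
  have "structure_line ` {..<5} = Inl ` five_line ` {..<5}"
    by (auto simp: structure_line_def image_iff)
  moreover have "structure_line ` {5..<15} = Inr ` F10 M\<^sub>1 (five_line ` {..<5})"
    unfolding F10_def joins_five_line image_image by (rule image_cong) (auto simp: structure_line_def)
  ultimately show "Lines (mathon_structure M\<^sub>1 (F15 M\<^sub>1 (line_of ` set six_lines)) (five_line ` {..<5}) (F10 M\<^sub>1 (five_line ` {..<5}))) = structure_line ` {..<15}"
    unfolding split image_Un by (simp add: mathon_structure_def)
  show "Inc (mathon_structure M\<^sub>1 (F15 M\<^sub>1 (line_of ` set six_lines)) (five_line ` {..<5}) (F10 M\<^sub>1 (five_line ` {..<5}))) (structure_point n) (structure_line m) \<longleftrightarrow> incident n m"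
    if "n \<in> {..<15}" "m \<in> {..<15}" for n m
    using that incidence_type_i[of n m] incidence_type_ii[of n m] by (simp add: mathon_structure_def structure_line_def)
  show "Inc W2 (quad_vec (w_points ! n)) (quad_line (w_lines ! m)) \<longleftrightarrow> incident n m" for n m
    by (simp add: W2_def quad_vec_mem_quad_line incident_def)
qed (use incidence_separates_points incidence_separates_lines in \<open>auto simp: Points_W2 Lines_W2\<close>)

section \<open>Mathon structures and the symplectic quadrangle\<close>

text \<open>The Gram matrix enters all constructions only through its polarity.\<close>

lemma F15_cong:
  assumes "perp M = perp N" shows "F15 M F = F15 N F"
  unfolding F15_def opposite_def assms ..

lemma F10_cong:
  assumes "perp M = perp N" shows "F10 M F = F10 N F"
  unfolding F10_def assms ..

lemma mathon_structure_cong: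
  assumes "perp M = perp N" shows "mathon_structure M P F L = mathon_structure N P F L"
  unfolding mathon_structure_def assms ..

lemma perp_scale:
  assumes "c \<noteq> 0" "\<And>u v. form M u v = c * form N u v"
  shows "perp M = perp N"
  by (rule ext) (simp add: perp_def assms)

lemma form_uminus: "form (- M) u v = - form M u v"
proof -
  have "u v* (- M) = - (u v* M)"
    by (simp add: vector_matrix_mult_def vec_eq_iff sum_negf)
  then show ?thesis by (simp add: form_def sum_negf)
qed

lemma form_eq_zero_imp:
  fixes M :: mat6
  assumes "\<And>u v. form M u v = 0"
  shows "M = mat 0"
proof (rule matrix_eqI)
  fix u :: vec6
  have "(u v* M) $ j = form M u (axis j 1)" for j
  proof -
    have "form M u (axis j 1) = (\<Sum>i\<in>UNIV. if i = j then (u v* M) $ i else 0)"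
      unfolding form_def by (rule sum.cong) (auto simp: axis_def)
    then show ?thesis by simp
  qed
  then show "u v* M = u v* mat 0" by (simp add: assms vec_eq_iff vector_mult_mat)
qed

lemma block_mat_skew:
  "form (block_mat 0 A B (- transpose A) 0 C (- transpose B) (- transpose C) 0) v u =
   - form (block_mat 0 A B (- transpose A) 0 C (- transpose B) (- transpose C) 0) u v"
proof -
  obtain x\<^sub>1 x\<^sub>2 x\<^sub>3 x\<^sub>4 x\<^sub>5 x\<^sub>6 where u: "u = vec_of (x\<^sub>1, x\<^sub>2, x\<^sub>3, x\<^sub>4, x\<^sub>5, x\<^sub>6)" by (metis vec_of_surj prod_cases6)
  obtain y\<^sub>1 y\<^sub>2 y\<^sub>3 y\<^sub>4 y\<^sub>5 y\<^sub>6 where v: "v = vec_of (y\<^sub>1, y\<^sub>2, y\<^sub>3, y\<^sub>4, y\<^sub>5, y\<^sub>6)" by (metis vec_of_surj prod_cases6)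
  show ?thesis
    unfolding u v form_def
    by (simp add: vec_of.simps vector_matrix_mult_def sum_6 block_mat_def block_row_def transpose_def algebra_simps)
qed

lemma block_mat_isotropic:
  assumes "i < 3" "u \<in> five_line i" "v \<in> five_line i"
  shows "form (block_mat 0 A B (- transpose A) 0 C (- transpose B) (- transpose C) 0) u v = 0"
proof -
  let ?M = "block_mat 0 A B (- transpose A) 0 C (- transpose B) (- transpose C) 0"
  obtain x y where xy: "five_lines ! i = (x, y)" by (rule prod.exhaust)
  have "i = 0 \<or> i = 1 \<or> i = 2" using assms(1) by auto
  then have zero: "form ?M (vec_of x) (vec_of x) = 0" "form ?M (vec_of x) (vec_of y) = 0"
      "form ?M (vec_of y) (vec_of x) = 0" "form ?M (vec_of y) (vec_of y) = 0"
    using xy unfolding form_def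
    by (auto simp: five_lines_def frame_def vec_of.simps vector_matrix_mult_def sum_6 block_mat_def block_row_def transpose_def)
  obtain a b where "u = vec_of (comb a x b y)" using mem_line_ofE assms(2) unfolding five_line_def xy by metis
  moreover obtain c d where "v = vec_of (comb c x d y)" using mem_line_ofE assms(3) unfolding five_line_def xy by metis
  ultimately show ?thesis
    by (simp add: vec_of_comb form_add_left form_add_right form_scale_left form_scale_right zero)
qed

theorem theorem3p2:
  fixes R S A B C :: mat2 and M :: mat6 and G :: "mat6 set set"
    and \<F>\<^sub>5 \<F>\<^sub>6 \<F>\<^sub>1\<^sub>0 \<F>\<^sub>1\<^sub>5 :: "vec6 set set"
  assumes "invertible R" and "invertible S" and "block_line (mat 1) R S \<in> \<L>"
  defines "\<F>\<^sub>5 \<equiv> F5 R S"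
  defines "G \<equiv> stabiliser \<F>\<^sub>5"
  defines "\<F>\<^sub>6 \<equiv> F6 G"
  defines "M \<equiv> block_mat 0 A B
                         (- transpose A) 0 C
                         (- transpose B) (- transpose C) 0"
  assumes "invertible M"
    and "transpose (A + B + C) = A + B + C"
    and "transpose (A ** transpose R + B ** transpose S + R ** C ** transpose S)
           = A ** transpose R + B ** transpose S + R ** C ** transpose S"
    and "\<forall>\<gamma>\<in>G. \<forall>g\<in>\<gamma>. g ** M ** transpose g = M \<or> g ** M ** transpose g = - M"
  defines "\<F>\<^sub>1\<^sub>5 \<equiv> F15 M \<F>\<^sub>6"
  defines "\<F>\<^sub>1\<^sub>0 \<equiv> F10 M \<F>\<^sub>5"
  shows "isomorphic (mathon_structure M \<F>\<^sub>1\<^sub>5 \<F>\<^sub>5 \<F>\<^sub>1\<^sub>0) W2"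
proof -
  obtain r where r: "R = mat2_of r" using mat2_of_surj by blast
  obtain s where s: "S = mat2_of s" using mat2_of_surj by blast
  have L: "block_line (mat 1) (mat2_of r) (mat2_of s) \<in> \<L>"
    using \<open>block_line (mat 1) R S \<in> \<L>\<close> unfolding r s .
  obtain t where t: "invertible t" and t_frame: "\<forall>k\<in>set frame. act t (line_of k) = line_of k"
    and F5_t: "F5 (mat2_of r) (mat2_of s) = act t ` F5 (mat2_of R\<^sub>0) (mat2_of S\<^sub>0)"
    using F5_conjugate[OF admissible_line_conditions[OF L]] by blast
  have F5: "\<F>\<^sub>5 = act t ` five_line ` {..<5}"
    unfolding \<F>\<^sub>5_def r s F5_t F5_eq_five_line ..
  have sub: "\<forall>U\<in>five_line ` {..<5}. vec.subspace U" "\<forall>U\<in>\<F>\<^sub>5. vec.subspace U"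
    unfolding F5 using five_line_subspace subspace_act by blast+
  have F6: "\<F>\<^sub>6 = act t ` line_of ` set six_lines"
    unfolding \<F>\<^sub>6_def G_def F5 F6_stabiliser_act[OF t sub(1)] F6_reference ..
  define N where "N = t ** M ** transpose t"
  have form_N: "form N u v = form M (u v* t) (v v* t)" for u v
    unfolding N_def form_transform ..
  have "\<exists>c. \<forall>u v. form N u v = c * form M\<^sub>1 u v"
  proof (rule invariant_form_unique)
    show "form N v u = - form N u v" for u v
      unfolding form_N M_def by (rule block_mat_skew)
    show "form N u v = 0" if "i < 3" "u \<in> five_line i" "v \<in> five_line i" for i u v
    proof -
      have "five_lines ! i \<in> set frame"
        using that(1) by (auto simp: five_lines_def nth_append frame_def less_Suc_eq numeral_3_eq_3)
      then have "act t (five_line i) = five_line i" using t_frame unfolding five_line_def by blast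
      then have "u v* t \<in> five_line i" "v v* t \<in> five_line i" using that(2,3) unfolding act_def by blast+
      then show ?thesis unfolding form_N M_def using block_mat_isotropic[OF that(1)] by blast
    qed
    show "form N (u v* mat_of m) (v v* mat_of m) = form N u v" if x: "(p, m, b) \<in> set five_cycles" for p m b u v
    proof -
      define g where "g = matrix_inv t ** mat_of m ** t"
      have tg: "t ** g = mat_of m ** t"
        unfolding g_def using matrix_inv(1)[OF t] by (simp add: matrix_mul_assoc)
      have g: "invertible g"
        unfolding g_def by (intro invertible_mult invertible_matrix_inv t five_cycles_power(2)[OF x])
      have "act g ` \<F>\<^sub>5 = act t ` act (mat_of m) ` five_line ` {..<5}"
        unfolding F5 image_image act_mult[symmetric] tg ..
      then have "act g ` \<F>\<^sub>5 = \<F>\<^sub>5"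
        unfolding five_cycles_stabilise[OF x] F5 .
      then have "projectivity g \<in> G"
        unfolding G_def using projectivity_mem_stabiliser_iff[OF g sub(2)] by blast
      then have "g ** M ** transpose g = M \<or> g ** M ** transpose g = - M"
        using \<open>\<forall>\<gamma>\<in>G. \<forall>g\<in>\<gamma>. g ** M ** transpose g = M \<or> g ** M ** transpose g = - M\<close> projectivity_self by blast
      then have sign: "(\<forall>u v. form M (u v* g) (v v* g) = form M u v) \<or> (\<forall>u v. form M (u v* g) (v v* g) = - form M u v)"
        unfolding form_transform by (auto simp: form_uminus)
      have step: "form N (u v* mat_of m) (v v* mat_of m) = form M (u v* t v* g) (v v* t v* g)" for u v
        unfolding form_N vector_matrix_mul_assoc tg ..
      show ?thesis
        using sign
      proof
        assume "\<forall>u v. form M (u v* g) (v v* g) = form M u v"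
        then show ?thesis unfolding step unfolding form_N by blast
      next
        assume "\<forall>u v. form M (u v* g) (v v* g) = - form M u v"
        \<comment> \<open>With the sign \<open>-1\<close>, five steps lead back to the start, so the form vanishes and both sides are 0.\<close>
        then have neg: "form N (u v* mat_of m) (v v* mat_of m) = - form N u v" for u v
          unfolding step unfolding form_N by blast
        have "u v* (mat_of m ** mat_of m ** mat_of m ** mat_of m ** mat_of m) = u" for u
          unfolding five_cycles_power(1)[OF x] by simp
        then have five: "u v* mat_of m v* mat_of m v* mat_of m v* mat_of m v* mat_of m = u" for u
          by (simp only: vector_matrix_mul_assoc)
        have "form N u v = - form N u v" for u v
          using neg[of "u v* mat_of m v* mat_of m v* mat_of m v* mat_of m" "v v* mat_of m v* mat_of m v* mat_of m v* mat_of m"]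
          unfolding five by (simp only: neg minus_minus)
        moreover have "\<forall>x::gf3. x = - x \<longrightarrow> x = 0" by code_simp
        ultimately have "form N u v = 0" for u v by blast
        then show ?thesis by simp
      qed
    qed
  qed
  then obtain c where c: "\<And>u v. form N u v = c * form M\<^sub>1 u v" by blast
  have "c \<noteq> 0"
  proof
    assume "c = 0"
    then have "form M (u v* t) (v v* t) = 0" for u v using c form_N by simp
    then have "form M u v = 0" for u v
      using matrix_inv(2)[OF t] by (metis vector_matrix_mul_assoc vector_matrix_mul_rid)
    then have "M = mat 0" by (rule form_eq_zero_imp)
    then show False using \<open>invertible M\<close> invertible_mat_nonzero by blast
  qed
  then have perp: "perp N = perp M\<^sub>1" using c by (rule perp_scale)
  have F15: "\<F>\<^sub>1\<^sub>5 = act t ` F15 M\<^sub>1 (line_of ` set six_lines)"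
    unfolding \<F>\<^sub>1\<^sub>5_def F6 F15_act[OF t] N_def[symmetric] F15_cong[OF perp] ..
  have F10: "\<F>\<^sub>1\<^sub>0 = act t ` F10 M\<^sub>1 (five_line ` {..<5})"
    unfolding \<F>\<^sub>1\<^sub>0_def F5 F10_act[OF t] N_def[symmetric] F10_cong[OF perp] ..
  have "isomorphic (mathon_structure M\<^sub>1 (F15 M\<^sub>1 (line_of ` set six_lines)) (five_line ` {..<5}) (F10 M\<^sub>1 (five_line ` {..<5})))
      (mathon_structure M \<F>\<^sub>1\<^sub>5 \<F>\<^sub>5 \<F>\<^sub>1\<^sub>0)"
    using mathon_structure_act[OF t, of M] unfolding N_def[symmetric] mathon_structure_cong[OF perp] F15 F5 F10 .
  then show ?thesis
    using isomorphic_trans[OF isomorphic_sym reference_structure_isomorphic_W2] by blast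
qed

end
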